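(* Let $\mathcal T$ be a simplicial triangulation of a bounded polyhedral domain $\Omega\subset\mathbb R^n$, let $r\ge1$ and $0\le k\le n$. Then $$\mathcal P^-_r\Lambda^k(\mathcal T)=\bigoplus_{\substack{f\in\Delta(\mathcal T)\\ \dim f\ge k}}E_f\big[\mathring{\mathcal P}^-_r\Lambda^k(f)\big],$$ where $E_f:\mathring{\mathcal P}^-_r\Lambda^k(f)\to\mathcal P^-_r\Lambda^k(\mathcal T)$ is the global extension operator determined by the barycentric extension operators $E^{k,r,-}_{f,g}$, that is, $(E_f\mu)|_T=E^{k,r,-}_{f,T}\mu$ if $T\in\mathcal T$ contains $f$ and $(E_f\mu)|_T=0$ for the other $T\in\mathcal T$.
   Context: A simplicial triangulation $\mathcal T$ of $\Omega$ is a finite set of closed $n$-simplices whose union is the closure of $\Omega$ and such that the intersection of any two is either empty or a common subsimplex of each. $\Delta(T)$ is the set of all nonempty faces of $T$ of all dimensions (including $T$), $\Delta(\mathcal T)=\bigcup_{T\in\mathcal T}\Delta(T)$. The vertices of $\mathcal T$ are numbered, $x_0,\dots,x_N$, and $\mathcal I(f)$ is the set of indices of the vertices of the simplex $f$. For $i\in\mathcal I(f)$, $\lambda_i^f$ is the barycentric coordinate: the affine function on $f$ with $\lambda_i^f(x_j)=\delta_{ij}$, $j\in\mathcal I(f)$. For simplices $f\subseteq g$, $\operatorname{tr}_{g,f}$ is the pullback of differential forms under the inclusion $f\hookrightarrow g$. For a simplex $f$, $\mathcal P_r\Lambda^k(f)$ is the space of differential $k$-forms on $f$ with coefficients polynomials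 of degree at most $r$ ($\{0\}$ if $r<0$ or $k>\dim f$). Choosing any origin $o$ in the affine hull of $f$, the Koszul operator is $(\kappa\omega)_x(v_1,\dots,v_{k-1})=\omega_x(x-o,v_1,\dots,v_{k-1})$, and $\mathcal P^-_r\Lambda^k(f)=\mathcal P_{r-1}\Lambda^k(f)+\kappa\mathcal P_{r-1}\Lambda^{k+1}(f)$ (independent of $o$). $\mathring{\mathcal P}^-_r\Lambda^k(f)$ is the subspace of forms whose trace on $\partial f$ (on every proper face of $f$) vanishes. $\mathcal P^-_r\Lambda^k(\mathcal T)$ is the space of $\omega\in L^2\Lambda^k(\Omega)$ with $\omega|_T\in\mathcal P^-_r\Lambda^k(T)$ for all $T\in\mathcal T$ and such that for each $f\in\Delta(\mathcal T)$ with $k\le\dim f\le n-1$, $\operatorname{tr}_f\omega$ is single-valued, i.e. $\operatorname{tr}_{T,f}(\omega|_T)$ is the same for all $T\in\mathcal T$ containing $f$. For an increasing map $\sigma:\{0,\dots,k\}\to\mathcal I(f)$ the Whitney form is $$\phi^f_\sigma=\sum_{i=0}^k(-1)^i\lambda^f_{\sigma(i)}\,d\lambda^f_{\sigma(0)}\wedge\cdots\wedge\widehat{d\lambda^f_{\sigma(i)}}\wedge\cdots\wedge d\lambda^f_{\sigma(k)}.$$ For $f\subseteq g$ in $\Delta(\mathcal T)$, $E^{k,r,-}_{f,g}:\mathcal P^-_r\Lambda^k(f)\to\mathcal P^-_r\Lambda^k(g)$ is the unique (well-defined) linear map with $E^{k,r,-}_{f,g}[(\lambda^f)^\alpha\phi^f_\sigma]=(\lambda^g)^\alpha\phi^g_\sigma$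 for all multi-indices $\alpha=(\alpha_i)_{i\in\mathcal I(f)}$ of nonnegative integers with $|\alpha|=r-1$ and all increasing $\sigma:\{0,\dots,k\}\to\mathcal I(f)$; here $(\lambda^g)^\alpha=\prod_{i\in\mathcal I(f)}(\lambda^g_i)^{\alpha_i}$. *)

theory Defs
  imports "HOL-Analysis.Analysis" "HOL-Library.Function_Algebras"
begin

section \<open>Pointwise real vector space structure on functions\<close>

instantiation "fun" :: (type, scaleR) scaleR
begin
definition scaleR_fun_def: "c *\<^sub>R f = (\<lambda>x. c *\<^sub>R f x)"
instance ..
end

instance "fun" :: (type, real_vector) real_vector
  by standard (auto simp: scaleR_fun_def fun_eq_iff scaleR_add_right scaleR_add_left)

definition linear_on_subspace :: "'b::real_vector set \<Rightarrow> ('b \<Rightarrow> 'c::real_vector) \<Rightarrow> bool" where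
  "linear_on_subspace V F \<longleftrightarrow>
     (\<forall>u\<in>V. \<forall>w\<in>V. F (u + w) = F u + F w) \<and> (\<forall>c. \<forall>u\<in>V. F (c *\<^sub>R u) = c *\<^sub>R F u)"

definition is_internal_direct_sum :: "'b::real_vector set \<Rightarrow> 'i set \<Rightarrow> ('i \<Rightarrow> 'b set) \<Rightarrow> bool" where
  "is_internal_direct_sum V I W \<longleftrightarrow>
     finite I \<and> (\<forall>i\<in>I. subspace (W i)) \<and>
     V = {\<Sum>i\<in>I. w i |w. \<forall>i\<in>I. w i \<in> W i} \<and>
     (\<forall>w. (\<forall>i\<in>I. w i \<in> W i) \<and> (\<Sum>i\<in>I. w i) = 0 \<longrightarrow> (\<forall>i\<in>I. w i = 0))"


section \<open>Differential forms on a simplex\<close>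

text \<open>A form \<open>\<omega>\<close> takes a point and the list of its vector arguments. A \<open>k\<close>-form on a simplex
  \<open>f\<close> is meaningful at points of \<open>f\<close> and at lists of \<open>k\<close> vectors tangent to \<open>f\<close>; it is
  required to be \<open>0\<close> at all other arguments, so that equality of forms on \<open>f\<close> is equality
  of functions.\<close>

type_synonym 'a form = "'a \<Rightarrow> 'a list \<Rightarrow> real"

definition tangent :: "'a::euclidean_space set \<Rightarrow> 'a set" where
  "tangent f = span {a - b |a b. a \<in> f \<and> b \<in> f}"

definition alt_multilinear :: "'a::euclidean_space set \<Rightarrow> nat \<Rightarrow> ('a list \<Rightarrow> real) \<Rightarrow> bool" where
  "alt_multilinear V k a \<longleftrightarrow>
     (\<forall>vs. \<not> (length vs = k \<and> set vs \<subseteq> V) \<longrightarrow> a vs = 0) \<and>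
     (\<forall>us ws. length us + 1 + length ws = k \<and> set us \<subseteq> V \<and> set ws \<subseteq> V \<longrightarrow>
        linear_on_subspace V (\<lambda>v. a (us @ v # ws))) \<and>
     (\<forall>vs. length vs = k \<and> set vs \<subseteq> V \<and> \<not> distinct vs \<longrightarrow> a vs = 0)"

text \<open>Polynomial functions of degree at most \<open>r\<close>; only \<open>0\<close> if \<open>r < 0\<close>.\<close>

definition polys :: "int \<Rightarrow> ('a::euclidean_space \<Rightarrow> real) set" where
  "polys r = span {(\<lambda>x. \<Prod>b\<in>Basis. (x \<bullet> b) ^ \<alpha> b) |\<alpha>. int (\<Sum>b\<in>Basis. \<alpha> b) \<le> r}"

definition poly_forms :: "int \<Rightarrow> nat \<Rightarrow> 'a::euclidean_space set \<Rightarrow> 'a form set" where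
  "poly_forms r k f = {\<omega>.
     (\<forall>x\<in>f. alt_multilinear (tangent f) k (\<omega> x)) \<and>
     (\<forall>x. x \<notin> f \<longrightarrow> \<omega> x = 0) \<and>
     (\<forall>vs. \<exists>p\<in>polys r. \<forall>x\<in>f. \<omega> x vs = p x)}"

definition koszul :: "'a::euclidean_space \<Rightarrow> 'a form \<Rightarrow> 'a form" where
  "koszul z \<omega> = (\<lambda>x vs. \<omega> x ((x - z) # vs))"

text \<open>The space does not depend on the choice of the origin \<open>z\<close>.\<close>

definition poly_minus_forms :: "nat \<Rightarrow> nat \<Rightarrow> 'a::euclidean_space set \<Rightarrow> 'a form set" where
  "poly_minus_forms r k f =
     (let z = (SOME z. z \<in> affine hull f) in
      {\<omega> + koszul z \<eta> |\<omega> \<eta>.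
         \<omega> \<in> poly_forms (int r - 1) k f \<and> \<eta> \<in> poly_forms (int r - 1) (k + 1) f})"

text \<open>Pullback to \<open>f\<close> under the inclusion into a larger simplex.\<close>

definition trace_form :: "'a::euclidean_space set \<Rightarrow> 'a form \<Rightarrow> 'a form" where
  "trace_form f \<omega> = (\<lambda>x vs. if x \<in> f \<and> set vs \<subseteq> tangent f then \<omega> x vs else 0)"

definition simplex_faces :: "'a::euclidean_space set \<Rightarrow> 'a set set" where
  "simplex_faces T = {f. f face_of T \<and> f \<noteq> {}}"

definition poly_minus_forms0 :: "nat \<Rightarrow> nat \<Rightarrow> 'a::euclidean_space set \<Rightarrow> 'a form set" where
  "poly_minus_forms0 r k f =
     {\<omega> \<in> poly_minus_forms r k f. \<forall>e\<in>simplex_faces f. e \<noteq> f \<longrightarrow> trace_form e \<omega> = 0}"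


section \<open>Triangulations, barycentric coordinates and Whitney forms\<close>

text \<open>No regularity of the boundary beyond flatness is required of a polyhedral domain; cracks,
  for instance, are allowed.\<close>

definition bounded_polyhedral_domain :: "'a::euclidean_space set \<Rightarrow> bool" where
  "bounded_polyhedral_domain \<Omega> \<longleftrightarrow>
     open \<Omega> \<and> connected \<Omega> \<and> \<Omega> \<noteq> {} \<and> bounded \<Omega> \<and>
     (\<exists>P. finite P \<and> (\<forall>p\<in>P. polytope p) \<and> frontier \<Omega> = \<Union>P)"

definition simplicial_triangulation :: "'a::euclidean_space set set \<Rightarrow> 'a set \<Rightarrow> bool" where
  "simplicial_triangulation \<T> \<Omega> \<longleftrightarrow>
     triangulation \<T> \<and> (\<forall>T\<in>\<T>. int DIM('a) simplex T) \<and> \<Union>\<T> = closure \<Omega>"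

definition mesh_faces :: "'a::euclidean_space set set \<Rightarrow> 'a set set" where
  "mesh_faces \<T> = (\<Union>T\<in>\<T>. simplex_faces T)"

text \<open>The vertices are \<open>x 0, \<dots>, x N\<close>.\<close>

definition vertex_numbering ::
    "'a::euclidean_space set set \<Rightarrow> (nat \<Rightarrow> 'a) \<Rightarrow> nat \<Rightarrow> bool" where
  "vertex_numbering \<T> x N \<longleftrightarrow>
     bij_betw x {0..N} {v. \<exists>T\<in>\<T>. v extreme_point_of T}"

definition vertex_indices :: "(nat \<Rightarrow> 'a::euclidean_space) \<Rightarrow> nat \<Rightarrow> 'a set \<Rightarrow> nat set" where
  "vertex_indices x N f = {i \<in> {0..N}. x i extreme_point_of f}"

text \<open>The barycentric coordinate \<open>i\<close> of \<open>f\<close>, as an affine function on the affine hull of \<open>f\<close>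
  (and \<open>0\<close> elsewhere).\<close>

definition bary :: "(nat \<Rightarrow> 'a::euclidean_space) \<Rightarrow> nat \<Rightarrow> 'a set \<Rightarrow> nat \<Rightarrow> 'a \<Rightarrow> real" where
  "bary x N f i = (THE l.
     (\<forall>u\<in>affine hull f. \<forall>w\<in>affine hull f. \<forall>t.
        l ((1 - t) *\<^sub>R u + t *\<^sub>R w) = (1 - t) * l u + t * l w) \<and>
     (\<forall>u. u \<notin> affine hull f \<longrightarrow> l u = 0) \<and>
     (\<forall>j\<in>vertex_indices x N f. l (x j) = (if i = j then 1 else 0)))"

definition bary_diff ::
    "(nat \<Rightarrow> 'a::euclidean_space) \<Rightarrow> nat \<Rightarrow> 'a set \<Rightarrow> nat \<Rightarrow> 'a \<Rightarrow> 'a \<Rightarrow> real" where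
  "bary_diff x N f i y v = deriv (\<lambda>t. bary x N f i (y + t *\<^sub>R v)) 0"

text \<open>The exterior product of a list of covectors, normalised so that
  \<open>(a\<^sub>1 \<and> \<dots> \<and> a\<^sub>k)(v\<^sub>1, \<dots>, v\<^sub>k) = det (a\<^sub>i(v\<^sub>j))\<close>.\<close>

definition wedge :: "('a \<Rightarrow> real) list \<Rightarrow> 'a list \<Rightarrow> real" where
  "wedge as vs =
     (if length vs = length as
      then \<Sum>\<pi> | \<pi> permutes {..<length as}.
             of_int (sign \<pi>) * (\<Prod>i<length as. (as ! i) (vs ! \<pi> i))
      else 0)"

definition whitney ::
    "(nat \<Rightarrow> 'a::euclidean_space) \<Rightarrow> nat \<Rightarrow> nat \<Rightarrow> 'a set \<Rightarrow> (nat \<Rightarrow> nat) \<Rightarrow> 'a form" where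
  "whitney x N k f \<sigma> = (\<lambda>y vs.
     if y \<in> f \<and> set vs \<subseteq> tangent f
     then \<Sum>i\<le>k. (- 1) ^ i * bary x N f (\<sigma> i) y *
            wedge (map (\<lambda>j. bary_diff x N f (\<sigma> j) y) (filter (\<lambda>j. j \<noteq> i) [0..<Suc k])) vs
     else 0)"

text \<open>\<open>(\<lambda>\<^sup>g)\<^sup>\<alpha> \<phi>\<^sup>g\<^sub>\<sigma>\<close> for a multi-index \<open>\<alpha>\<close> on \<open>J\<close>.\<close>

definition bary_whitney ::
    "(nat \<Rightarrow> 'a::euclidean_space) \<Rightarrow> nat \<Rightarrow> nat \<Rightarrow> nat set \<Rightarrow> 'a set \<Rightarrow> (nat \<Rightarrow> nat) \<Rightarrow>
     (nat \<Rightarrow> nat) \<Rightarrow> 'a form" where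
  "bary_whitney x N k J g \<alpha> \<sigma> =
     (\<lambda>y vs. (\<Prod>i\<in>J. bary x N g i y ^ \<alpha> i) * whitney x N k g \<sigma> y vs)"


section \<open>Barycentric extension\<close>

text \<open>The condition outside \<open>poly_minus_forms r k f\<close> only makes the map unique as a function on
  the whole type.\<close>

definition bary_ext ::
    "(nat \<Rightarrow> 'a::euclidean_space) \<Rightarrow> nat \<Rightarrow> nat \<Rightarrow> nat \<Rightarrow> 'a set \<Rightarrow> 'a set \<Rightarrow> 'a form \<Rightarrow> 'a form" where
  "bary_ext x N r k f g = (THE E.
     (\<forall>\<omega>\<in>poly_minus_forms r k f. E \<omega> \<in> poly_minus_forms r k g) \<and>
     linear_on_subspace (poly_minus_forms r k f) E \<and>
     (\<forall>\<alpha> \<sigma>. (\<Sum>i\<in>vertex_indices x N f. \<alpha> i) + 1 = r \<and>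
        strict_mono_on {0..k} \<sigma> \<and> \<sigma> ` {0..k} \<subseteq> vertex_indices x N f \<longrightarrow>
        E (bary_whitney x N k (vertex_indices x N f) f \<alpha> \<sigma>) =
          bary_whitney x N k (vertex_indices x N f) g \<alpha> \<sigma>) \<and>
     (\<forall>\<omega>. \<omega> \<notin> poly_minus_forms r k f \<longrightarrow> E \<omega> = 0))"


section \<open>Square integrable forms modulo equality almost everywhere\<close>

quotient_type (overloaded) 'a ae_form = "'a::euclidean_space \<Rightarrow> 'a list \<Rightarrow> real" /
  "\<lambda>\<omega> \<eta>. AE x in (lebesgue :: 'a measure). \<omega> x = \<eta> x"
  morphisms rep_ae_form ae_class
proof (rule equivpI)
  show "reflp (\<lambda>\<omega> \<eta>. AE x in (lebesgue :: 'a measure). \<omega> x = (\<eta> x :: 'a list \<Rightarrow> real))"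
    by (auto intro: reflpI)
  show "symp (\<lambda>\<omega> \<eta>. AE x in (lebesgue :: 'a measure). \<omega> x = (\<eta> x :: 'a list \<Rightarrow> real))"
    by (auto intro!: sympI elim: eventually_mono)
  show "transp (\<lambda>\<omega> \<eta>. AE x in (lebesgue :: 'a measure). \<omega> x = (\<eta> x :: 'a list \<Rightarrow> real))"
    by (rule transpI) (erule (1) eventually_elim2, simp)
qed

instantiation ae_form :: (euclidean_space) real_vector
begin

lift_definition zero_ae_form :: "'a ae_form" is "0" .

lift_definition plus_ae_form :: "'a ae_form \<Rightarrow> 'a ae_form \<Rightarrow> 'a ae_form" is "(+)"
  by (erule (1) eventually_elim2) simp

lift_definition minus_ae_form :: "'a ae_form \<Rightarrow> 'a ae_form \<Rightarrow> 'a ae_form" is "(-)"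
  by (erule (1) eventually_elim2) simp

lift_definition uminus_ae_form :: "'a ae_form \<Rightarrow> 'a ae_form" is "uminus"
  by (erule eventually_mono) simp

lift_definition scaleR_ae_form :: "real \<Rightarrow> 'a ae_form \<Rightarrow> 'a ae_form" is "scaleR"
  by (erule eventually_mono) (simp add: scaleR_fun_def)

instance
  by standard (transfer, auto simp: algebra_simps)+

end

text \<open>Forms on \<open>\<Omega>\<close> are extended by \<open>0\<close> to the whole space. Square integrability of the values at
  all argument lists is that of all coefficients.\<close>

definition L2_forms :: "nat \<Rightarrow> 'a::euclidean_space set \<Rightarrow> 'a ae_form set" where
  "L2_forms k \<Omega> = {ae_class \<omega> |\<omega>.
     (\<forall>x\<in>\<Omega>. alt_multilinear UNIV k (\<omega> x)) \<and>
     (\<forall>x. x \<notin> \<Omega> \<longrightarrow> \<omega> x = 0) \<and>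
     (\<forall>vs. (\<lambda>x. \<omega> x vs) \<in> borel_measurable lebesgue \<and> integrable lebesgue (\<lambda>x. (\<omega> x vs)\<^sup>2))}"

text \<open>\<open>restricts_to W T p\<close> says that the restriction of \<open>W\<close> to \<open>T\<close> is (the class of) \<open>p\<close>.\<close>

lift_definition restricts_to ::
    "'a::euclidean_space ae_form \<Rightarrow> 'a set \<Rightarrow> 'a form \<Rightarrow> bool"
  is "\<lambda>\<omega> T p. AE x in lebesgue. x \<in> T \<longrightarrow> \<omega> x = p x"
  by (intro ext iffI; erule (1) eventually_elim2; simp)

definition poly_minus_mesh ::
    "'a::euclidean_space set \<Rightarrow> 'a set set \<Rightarrow> nat \<Rightarrow> nat \<Rightarrow> 'a ae_form set" where
  "poly_minus_mesh \<Omega> \<T> r k = {W \<in> L2_forms k \<Omega>. \<exists>p.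
     (\<forall>T\<in>\<T>. p T \<in> poly_minus_forms r k T \<and> restricts_to W T (p T)) \<and>
     (\<forall>f\<in>mesh_faces \<T>. int k \<le> aff_dim f \<and> aff_dim f \<le> int DIM('a) - 1 \<longrightarrow>
        (\<forall>T\<in>\<T>. \<forall>T'\<in>\<T>. f \<subseteq> T \<and> f \<subseteq> T' \<longrightarrow> trace_form f (p T) = trace_form f (p T')))}"

definition global_ext ::
    "'a::euclidean_space set \<Rightarrow> 'a set set \<Rightarrow> (nat \<Rightarrow> 'a) \<Rightarrow> nat \<Rightarrow> nat \<Rightarrow> nat \<Rightarrow> 'a set \<Rightarrow>
     'a form \<Rightarrow> 'a ae_form" where
  "global_ext \<Omega> \<T> x N r k f \<mu> = (THE W. W \<in> L2_forms k \<Omega> \<and>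
     (\<forall>T\<in>\<T>. restricts_to W T (if f \<subseteq> T then bary_ext x N r k f T \<mu> else 0)))"

end

theory Submission
  imports Defs "Jordan_Normal_Form.Determinant"
begin

text \<open>In homogeneous barycentric coordinates \<open>\<P>\<^sup>-\<^sub>r\<Lambda>\<^sup>k(f)\<close> consists of the contractions of
  homogeneous forms of coefficient degree \<open>r - 1\<close> with the radial vector field; this makes it the
  span of the forms \<open>\<lambda>\<^sup>\<alpha>\<phi>\<^sub>\<sigma>\<close> and shows that barycentric extension is pullback under a projection
  onto \<open>f\<close>, up to a power of the sum of the coordinates belonging to \<open>f\<close>. From this explicit
  formula the trace on a face \<open>g\<close> of the extension of a form \<open>\<mu>\<close> with vanishing boundary traces is
  \<open>0\<close> unless \<open>f \<subseteq> g\<close>, and it is \<open>\<mu>\<close> for \<open>g = f\<close>. Hence the sum is direct, and a given piecewise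
  form is reduced to \<open>0\<close> by removing its traces on the faces in order of increasing dimension.\<close>

text \<open>For \<open>r \<ge> 2\<close> the forms
  \<open>\<lambda>\<^sup>\<alpha>\<phi>\<^sub>\<sigma>\<close> generally satisfy linear relations,
  so prescribing values on them does not by itself define a map. A closed formula that is visibly
  linear avoids any study of these relations: it only has to be checked on generators. Homogeneity
  dictates it. The projection onto f divides the coordinates belonging to f by their sum s; a
  generator has \<open>r - 1\<close> coordinates in its monomial and \<open>k + 1\<close> factors in
  its determinant, hence the power \<open>r + k\<close> of s. The terms with the differential of s
  are multiples of the radial vector, and they vanish because that vector is already an argument of
  the determinant. Mesh forms are classes modulo null sets, so a trace on a face is taken from the
  polynomial representative on a simplex; it is unique because a simplex is the closure of its
  interior. Faces of dimension below k carry only the form 0, so their traces impose nothing.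
  Finally \<open>k \<le> n\<close> makes the simplices themselves members of the index set, so that
  a form all of whose traces vanish is 0.\<close>

no_notation scalar_prod (infix "\<bullet>" 70)

subsection \<open>Exterior products\<close>

text \<open>Determinants supply Laplace expansion, transposition and the vanishing for equal
  columns; the facts on \<open>wedge\<close> below are these, translated.\<close>

lemma wedge_eq_det:
  assumes "length vs = length as"
  shows "wedge as vs = Determinant.det (mat (length as) (length as) (\<lambda>(i, j). (as ! i) (vs ! j)))"
proof -
  have "(\<Prod>i<length as. (as ! i) (vs ! p i)) =
      (\<Prod>i = 0..<length as. mat (length as) (length as) (\<lambda>(i, j). (as ! i) (vs ! j)) $$ (i, p i))"
    if "p permutes {..<length as}" for p
    using permutes_in_image[OF that] by (auto simp: atLeast0LessThan intro!: prod.cong)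
  then show ?thesis
    using assms by (auto simp: wedge_def det_def' [of _ "length as"] atLeast0LessThan intro!: sum.cong)
qed

lemma wedge_length: "length vs \<noteq> length as \<Longrightarrow> wedge as vs = 0"
  by (simp add: wedge_def)

lemma wedge_cong:
  assumes "length as = length bs" "length vs = length ws"
    and "\<And>i j. i < length as \<Longrightarrow> j < length vs \<Longrightarrow> (as ! i) (vs ! j) = (bs ! i) (ws ! j)"
  shows "wedge as vs = wedge bs ws"
proof (cases "length vs = length as")
  case True
  have "(\<Prod>i<length bs. (as ! i) (vs ! p i)) = (\<Prod>i<length bs. (bs ! i) (ws ! p i))"
    if "p permutes {..<length bs}" for p
    using permutes_in_image[OF that] assms True by (auto intro!: prod.cong)
  then show ?thesis
    using assms True by (auto simp: wedge_def intro!: sum.cong)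
qed (use assms in \<open>simp add: wedge_length\<close>)

text \<open>Transposition of the matrix: the evaluations \<open>\<lambda>a. a v\<close> act as
  covectors on the covectors \<open>as\<close>, so every fact about arguments yields one about
  factors.\<close>

lemma wedge_dual: "wedge as vs = wedge (map (\<lambda>v a. a v) vs) as"
proof (cases "length vs = length as")
  case True
  have "transpose_mat (mat (length as) (length as) (\<lambda>(i, j). (as ! i) (vs ! j))) =
      mat (length as) (length as) (\<lambda>(i, j). (map (\<lambda>v a. a v) vs ! i) (as ! j))"
    using True by (intro eq_matI) auto
  then show ?thesis
    using True by (simp add: wedge_eq_det) (metis det_transpose mat_carrier)
qed (simp add: wedge_length)

lemma nth_take_drop_Suc:
  "i < length xs \<Longrightarrow> j < length xs - 1 \<Longrightarrow>
    (take i xs @ drop (Suc i) xs) ! j = xs ! (if j < i then j else Suc j)"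
  by (auto simp: nth_append)

text \<open>Laplace expansion along the column of \<open>v\<close>, that is, contraction with
  \<open>v\<close>. For the radial vector this alternating sum is the Whitney form.\<close>

lemma wedge_Cons_right:
  "wedge as (v # vs) =
    (\<Sum>i<length as. (- 1) ^ i * (as ! i) v * wedge (take i as @ drop (Suc i) as) vs)"
proof (cases "length as = Suc (length vs)")
  case True
  define n where "n = length vs"
  define M where "M = mat (Suc n) (Suc n) (\<lambda>(i, j). (as ! i) ((v # vs) ! j))"
  have M: "M \<in> carrier_mat (Suc n) (Suc n)" by (simp add: M_def)
  have del: "Determinant.det (mat_delete M i 0) = wedge (take i as @ drop (Suc i) as) vs"
    if "i < Suc n" for i
  proof -
    have "mat_delete M i 0 = mat n n (\<lambda>(j, l). ((take i as @ drop (Suc i) as) ! j) (vs ! l))"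
      unfolding mat_delete_def
      using that True by (intro eq_matI) (auto simp: M_def n_def nth_take_drop_Suc)
    then show ?thesis
      using that True by (simp add: wedge_eq_det n_def min_def)
  qed
  have "wedge as (v # vs) = Determinant.det M"
    using True by (simp add: wedge_eq_det M_def n_def)
  also have "\<dots> = (\<Sum>i<Suc n. M $$ (i, 0) * cofactor M i 0)"
    by (rule laplace_expansion_column[OF M]) simp
  also have "\<dots> = (\<Sum>i<Suc n. (- 1) ^ i * (as ! i) v * wedge (take i as @ drop (Suc i) as) vs)"
    by (rule sum.cong) (simp_all add: cofactor_def del, simp add: M_def)
  finally show ?thesis
    using True by (simp add: n_def)
next
  case False
  then have "length (take i as @ drop (Suc i) as) \<noteq> length vs" if "i < length as" for i
    using that by (auto simp: min_def)
  then show ?thesis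
    using False by (simp add: wedge_length)
qed

lemma wedge_Cons_left:
  "wedge (a # as) vs =
    (\<Sum>j<length vs. (- 1) ^ j * a (vs ! j) * wedge as (take j vs @ drop (Suc j) vs))"
  by (subst wedge_dual, subst wedge_Cons_right)
    (simp add: take_map drop_map wedge_dual[of as] flip: map_append)

lemma wedge_not_distinct_right:
  assumes "\<not> distinct vs" shows "wedge as vs = 0"
proof (cases "length vs = length as")
  case True
  from assms obtain i j where ij: "i < length vs" "j < length vs" "i \<noteq> j" "vs ! i = vs ! j"
    by (auto simp: distinct_conv_nth)
  let ?M = "mat (length as) (length as) (\<lambda>(i, j). (as ! i) (vs ! j))"
  have "col ?M i = col ?M j"
    using ij True by (intro eq_vecI) auto
  then show ?thesis
    using True ij det_identical_columns[of ?M "length as" i j] by (simp add: wedge_eq_det)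
qed (simp add: wedge_length)

lemma wedge_not_distinct_left: "\<not> distinct as \<Longrightarrow> wedge as vs = 0"
  by (subst wedge_dual) (rule wedge_not_distinct_right)

lemma wedge_zero_left:
  assumes "a \<in> set as" "\<And>v. v \<in> set vs \<Longrightarrow> a v = 0"
  shows "wedge as vs = 0"
proof (cases "length vs = length as")
  case True
  from assms obtain i where i: "i < length as" "as ! i = a"
    by (auto simp: in_set_conv_nth)
  have "(\<Prod>i<length as. (as ! i) (vs ! p i)) = 0" if "p permutes {..<length as}" for p
    using permutes_in_image[OF that, of i] i True assms(2) by (intro prod_zero) (auto intro!: bexI[of _ i])
  then show ?thesis by (auto simp: wedge_def intro!: sum.neutral)
qed (simp add: wedge_length)

lemma wedge_permute_left:
  assumes "p permutes {..<length as}"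
  shows "wedge (map (\<lambda>i. as ! p i) [0..<length as]) vs = of_int (sign p) * wedge as vs"
proof (cases "length vs = length as")
  case True
  let ?n = "length as"
  let ?M = "mat ?n ?n (\<lambda>(i, j). (as ! i) (vs ! j))"
  have p: "p permutes {0..<?n}" using assms by (simp add: atLeast0LessThan)
  have "mat ?n ?n (\<lambda>(i, j). (map (\<lambda>i. as ! p i) [0..<?n] ! i) (vs ! j)) =
      mat ?n ?n (\<lambda>(i, j). ?M $$ (p i, j))"
    using permutes_in_image[OF assms] by (intro eq_matI) auto
  then show ?thesis
    using True det_permute_rows[OF _ p, of ?M] by (simp add: wedge_eq_det)
qed (simp add: wedge_length)

section \<open>Alternating multilinear maps\<close>

lemma linear_on_subspace_combination:
  fixes F :: "'i \<Rightarrow> 'b::real_vector \<Rightarrow> real"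
  assumes "\<And>i. i \<in> S \<Longrightarrow> linear_on_subspace V (F i)"
  shows "linear_on_subspace V (\<lambda>v. \<Sum>i\<in>S. c i * F i v)"
  using assms
  by (simp add: linear_on_subspace_def distrib_left sum.distrib sum_distrib_left mult.left_commute)

text \<open>Expanding along the first argument removes \<open>us\<close> step by step until the free
  slot stands in front, where linearity is that of the factors. The list of factors shrinks along
  the way, hence \<open>arbitrary: as\<close>.\<close>

lemma linear_on_subspace_wedge:
  assumes "\<And>a. a \<in> set as \<Longrightarrow> linear_on_subspace V a"
  shows "linear_on_subspace V (\<lambda>v. wedge as (us @ v # ws))"
  using assms
proof (induction us arbitrary: as)
  case Nil
  then have "linear_on_subspace V (\<lambda>v. \<Sum>i<length as.
      ((- 1) ^ i * wedge (take i as @ drop (Suc i) as) ws) * (as ! i) v)"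
    by (intro linear_on_subspace_combination) simp
  then show ?case by (simp add: wedge_Cons_right mult_ac)
next
  case (Cons u us)
  have "linear_on_subspace V (\<lambda>v. wedge (take i as @ drop (Suc i) as) (us @ v # ws))" for i
    by (rule Cons.IH) (auto intro: Cons.prems dest: in_set_takeD in_set_dropD)
  then have "linear_on_subspace V (\<lambda>v. \<Sum>i<length as.
      ((- 1) ^ i * (as ! i) u) * wedge (take i as @ drop (Suc i) as) (us @ v # ws))"
    by (intro linear_on_subspace_combination)
  then show ?case by (simp add: wedge_Cons_right)
qed

lemma alt_multilinear_wedge:
  assumes "\<And>a. a \<in> set as \<Longrightarrow> linear_on_subspace V a" and V: "subspace V"
  shows "alt_multilinear V (length as) (\<lambda>vs. if set vs \<subseteq> V then wedge as vs else 0)"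
  using linear_on_subspace_wedge[OF assms(1)] V unfolding alt_multilinear_def
  by (auto simp: wedge_length wedge_not_distinct_right linear_on_subspace_def subspace_add
      subspace_scale)

lemma alt_multilinear_linear:
  "alt_multilinear V k a \<Longrightarrow> length us + 1 + length ws = k \<Longrightarrow> set us \<subseteq> V \<Longrightarrow> set ws \<subseteq> V \<Longrightarrow>
    linear_on_subspace V (\<lambda>v. a (us @ v # ws))"
  by (simp add: alt_multilinear_def)

text \<open>Alternation is defined by vanishing at repeated arguments, so the sign rule has to be
  derived: polarisation gives it for a transposition, and transpositions generate all
  permutations.\<close>

lemma alt_multilinear_permute:
  assumes a: "alt_multilinear V k a" and V: "subspace V"
    and f: "\<And>i. i < k \<Longrightarrow> f i \<in> V" and p: "p permutes {..<k}"
  shows "a (map (f \<circ> p) [0..<k]) = of_int (sign p) * a (map f [0..<k])"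
proof -
  define F where "F g = a (map g [0..<k])" for g :: "nat \<Rightarrow> 'a"
  have lin: "F (g(i := u + w)) = F (g(i := u)) + F (g(i := w))"
    if "i < k" "\<And>i. i < k \<Longrightarrow> g i \<in> V" "u \<in> V" "w \<in> V" for g i u w
  proof -
    have "map (g(i := v)) [0..<k] = map g [0..<i] @ v # map g [Suc i..<k]" for v
      using that by (intro nth_equalityI) (auto simp: nth_append nth_Cons' simp flip: upt_conv_Cons)
    moreover have "linear_on_subspace V (\<lambda>v. a (map g [0..<i] @ v # map g [Suc i..<k]))"
      using that by (intro alt_multilinear_linear[OF a]) auto
    ultimately show ?thesis
      using that by (simp add: F_def linear_on_subspace_def)
  qed
  have alt: "F g = 0" if "i < k" "j < k" "i \<noteq> j" "g i = g j" for g i j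
  proof -
    have "\<not> distinct (map g [0..<k])"
      using that by (auto simp: distinct_map dest!: inj_onD[of _ _ i j])
    with a have "a (map g [0..<k]) = 0"
      by (cases "set (map g [0..<k]) \<subseteq> V") (auto simp: alt_multilinear_def)
    then show ?thesis by (simp add: F_def)
  qed
  have F_swap: "F (g \<circ> Transposition.transpose i j) = - F g"
    if ij: "i < k" "j < k" "i \<noteq> j" and g: "\<And>i. i < k \<Longrightarrow> g i \<in> V" for g i j
  proof -
    let ?G = "\<lambda>u w. F (g(i := u, j := w))"
    let ?s = "g i + g j"
    have s: "?s \<in> V" using g ij V by (auto intro: subspace_add)
    have split: "?G ?s w = ?G (g i) w + ?G (g j) w" if "w \<in> V" for w
    proof -
      have "F ((g(j := w))(i := ?s)) = F ((g(j := w))(i := g i)) + F ((g(j := w))(i := g j))"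
        using that ij g by (intro lin) auto
      then show ?thesis using fun_upd_twist[OF ij(3)] by metis
    qed
    \<comment> \<open>Polarisation: both slots receive the sum \<open>g i + g j\<close>. Of the four
      terms of the expansion the two with a repeated argument vanish.\<close>
    have "0 = ?G ?s ?s" using ij by (intro alt[symmetric, of i j]) auto
    also have "\<dots> = ?G ?s (g i) + ?G ?s (g j)"
      using ij g s by (intro lin) auto
    also have "\<dots> = ?G (g i) (g i) + ?G (g j) (g i) + (?G (g i) (g j) + ?G (g j) (g j))"
      using split g ij by simp
    also have "?G (g i) (g i) = 0" using ij by (intro alt[of i j]) auto
    also have "?G (g j) (g j) = 0" using ij by (intro alt[of i j]) auto
    also have "g(i := g i, j := g j) = g" by auto
    also have "g(i := g j, j := g i) = g \<circ> Transposition.transpose i j"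
      using ij by (auto simp: fun_eq_iff Transposition.transpose_def)
    finally show ?thesis by linarith
  qed
  have "finite {..<k}" by simp
  from this p have "F (f \<circ> p) = of_int (sign p) * F f"
  proof (induction rule: permutes_rev_induct)
    case id
    then show ?case by simp
  next
    case (swap a b p)
    have "F (f \<circ> p \<circ> Transposition.transpose a b) = - F (f \<circ> p)"
      using swap.hyps f permutes_in_image[OF swap.hyps(4)] by (intro F_swap) auto
    then have "F (f \<circ> (p \<circ> Transposition.transpose a b)) = - F (f \<circ> p)"
      by (simp only: o_assoc)
    moreover have "sign (p \<circ> Transposition.transpose a b) = - sign p"
      using swap.hyps permutation_permutes[of p]
      by (subst sign_compose) (auto simp: sign_swap_id permutation_swap_id)
    ultimately show ?case by (simp only: swap.IH)
  qed
  then show ?thesis by (simp add: F_def)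
qed

lemma linear_on_subspace_linear_combination:
  assumes "linear_on_subspace V F" "subspace V" "finite I" "\<And>i. i \<in> I \<Longrightarrow> e i \<in> V"
  shows "F (\<Sum>i\<in>I. c i *\<^sub>R e i) = (\<Sum>i\<in>I. c i *\<^sub>R F (e i))"
  using assms(3,4)
proof (induction I)
  case empty
  have "F (0 *\<^sub>R 0) = 0 *\<^sub>R F 0"
    using assms(1,2) subspace_0 unfolding linear_on_subspace_def by blast
  then show ?case by simp
next
  case (insert i I)
  moreover have "(\<Sum>i\<in>I. c i *\<^sub>R e i) \<in> V"
    using insert assms(2) by (intro subspace_sum subspace_scale) auto
  moreover have "c i *\<^sub>R e i \<in> V"
    using insert assms(2) by (intro subspace_scale) auto
  ultimately show ?case
    using assms(1) unfolding linear_on_subspace_def by simp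
qed

text \<open>Multilinear expansion with respect to a reproducing family \<open>e\<close>, which may
  be linearly dependent. The prefix \<open>us\<close> holds the arguments already replaced and makes
  the induction go through.\<close>

lemma alt_multilinear_expand:
  assumes a: "alt_multilinear V k a" and V: "subspace V" and I: "finite I"
    and e: "\<And>i. i \<in> I \<Longrightarrow> e i \<in> V" and D: "\<And>v. v \<in> V \<Longrightarrow> (\<Sum>i\<in>I. D i v *\<^sub>R e i) = v"
    and "set us \<subseteq> V" "set vs \<subseteq> V" "length us + length vs = k"
  shows "a (us @ vs) = (\<Sum>\<tau> | set \<tau> \<subseteq> I \<and> length \<tau> = length vs.
           (\<Prod>j<length vs. D (\<tau> ! j) (vs ! j)) * a (us @ map e \<tau>))"
  using assms(6-)
proof (induction vs arbitrary: us)
  case Nil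
  have "{\<tau>. set \<tau> \<subseteq> I \<and> length \<tau> = 0} = {[]}" by auto
  then show ?case by simp
next
  case (Cons v vs)
  have "linear_on_subspace V (\<lambda>v. a (us @ v # vs))"
    using Cons.prems by (intro alt_multilinear_linear[OF a]) auto
  from linear_on_subspace_linear_combination[OF this V I, of e "\<lambda>i. D i v"] e D[of v] Cons.prems
  have "a (us @ v # vs) = (\<Sum>i\<in>I. D i v * a ((us @ [e i]) @ vs))"
    by simp
  also have "\<dots> = (\<Sum>i\<in>I. \<Sum>\<tau> | set \<tau> \<subseteq> I \<and> length \<tau> = length vs.
      D i v * ((\<Prod>j<length vs. D (\<tau> ! j) (vs ! j)) * a (us @ e i # map e \<tau>)))"
    using Cons.prems e by (intro sum.cong refl, subst Cons.IH) (auto simp: sum_distrib_left)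
  also have "\<dots> = (\<Sum>(\<tau>, i)\<in>{\<tau>. set \<tau> \<subseteq> I \<and> length \<tau> = length vs} \<times> I.
      D i v * ((\<Prod>j<length vs. D (\<tau> ! j) (vs ! j)) * a (us @ e i # map e \<tau>)))"
    by (subst sum.swap, subst sum.cartesian_product) simp
  also have "\<dots> = (\<Sum>\<tau> | set \<tau> \<subseteq> I \<and> length \<tau> = Suc (length vs).
      (\<Prod>j<Suc (length vs). D (\<tau> ! j) ((v # vs) ! j)) * a (us @ map e \<tau>))"
    unfolding lists_length_Suc_eq
    by (subst sum.reindex)
      (auto simp: inj_on_def prod.lessThan_Suc_shift mult.assoc intro!: sum.cong simp del: prod.lessThan_Suc)
  finally show ?case by simp
qed

text \<open>Averaging the multilinear expansion over all permutations of the arguments turns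
  products of coordinates into determinants. The sum runs over all index lists instead of increasing
  ones, so each index set occurs in all its orders; this is the origin of
  \<open>fact k\<close>.\<close>

lemma alt_multilinear_eq_sum_wedge:
  assumes a: "alt_multilinear V k a" and V: "subspace V" and I: "finite I"
    and e: "\<And>i. i \<in> I \<Longrightarrow> e i \<in> V" and D: "\<And>v. v \<in> V \<Longrightarrow> (\<Sum>i\<in>I. D i v *\<^sub>R e i) = v"
    and vs: "set vs \<subseteq> V" "length vs = k"
  shows "a vs = (\<Sum>\<tau> | set \<tau> \<subseteq> I \<and> length \<tau> = k. a (map e \<tau>) / fact k * wedge (map D \<tau>) vs)"
proof -
  let ?T = "{\<tau>. set \<tau> \<subseteq> I \<and> length \<tau> = k}"
  let ?P = "{p. p permutes {..<k}}"
  have "fact k * a vs = (\<Sum>p\<in>?P. a vs)"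
    by (simp add: card_permutations[of "{..<k}" k])
  also have "\<dots> = (\<Sum>p\<in>?P. of_int (sign p) * a (map (\<lambda>i. vs ! p i) [0..<k]))"
  proof (rule sum.cong)
    fix p assume "p \<in> ?P"
    then have p: "p permutes {..<k}" by simp
    have "a (map ((!) vs \<circ> p) [0..<k]) = of_int (sign p) * a (map ((!) vs) [0..<k])"
      using vs by (intro alt_multilinear_permute[OF a V _ p]) auto
    moreover have "map ((!) vs) [0..<k] = vs" using vs map_nth by blast
    moreover have "of_int (sign p) * of_int (sign p) = (1::real)"
      by (simp add: sign_def)
    ultimately show "a vs = of_int (sign p) * a (map (\<lambda>i. vs ! p i) [0..<k])"
      by (simp add: o_def flip: mult.assoc)
  qed simp
  also have "\<dots> = (\<Sum>p\<in>?P. \<Sum>\<tau>\<in>?T.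
      of_int (sign p) * ((\<Prod>j<k. D (\<tau> ! j) (vs ! p j)) * a (map e \<tau>)))"
  proof (rule sum.cong)
    fix p assume "p \<in> ?P"
    then have p: "p permutes {..<k}" by simp
    have "set (map (\<lambda>i. vs ! p i) [0..<k]) \<subseteq> V"
      using vs permutes_in_image[OF p] by (auto simp: subset_iff)
    from alt_multilinear_expand[OF a V I e D, of "[]" "map (\<lambda>i. vs ! p i) [0..<k]"] this
    show "of_int (sign p) * a (map (\<lambda>i. vs ! p i) [0..<k]) = (\<Sum>\<tau>\<in>?T.
      of_int (sign p) * ((\<Prod>j<k. D (\<tau> ! j) (vs ! p j)) * a (map e \<tau>)))"
      by (simp add: sum_distrib_left)
  qed simp
  also have "\<dots> = (\<Sum>\<tau>\<in>?T. a (map e \<tau>) * wedge (map D \<tau>) vs)"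
    using vs by (subst sum.swap) (auto simp: wedge_def sum_distrib_left mult_ac intro!: sum.cong prod.cong)
  finally have "a vs = (\<Sum>\<tau>\<in>?T. a (map e \<tau>) * wedge (map D \<tau>) vs) / fact k"
    by (simp add: field_simps)
  then show ?thesis by (simp add: sum_divide_distrib)
qed

subsection \<open>Barycentric coordinates\<close>

text \<open>A simplex with numbered vertices, described without a surrounding mesh, so that the
  theory on one simplex or on a pair of simplices can be developed separately. The faces of a mesh
  qualify by \<open>mesh_nondegenerate\<close>.\<close>

definition nondegenerate :: "(nat \<Rightarrow> 'a::euclidean_space) \<Rightarrow> nat \<Rightarrow> 'a set \<Rightarrow> bool" where
  "nondegenerate x N f \<longleftrightarrow> vertex_indices x N f \<noteq> {} \<and> inj_on x (vertex_indices x N f) \<and>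
     \<not> affine_dependent (x ` vertex_indices x N f) \<and> convex hull (x ` vertex_indices x N f) = f"

lemma finite_vertex_indices [simp]: "finite (vertex_indices x N f)"
  by (simp add: vertex_indices_def)

lemma subspace_tangent [simp]: "subspace (tangent f)"
  by (simp add: tangent_def)

lemma affine_hull_plus_tangent:
  assumes "v \<in> tangent f" "y \<in> affine hull f"
  shows "y + v \<in> affine hull f"
  using assms unfolding tangent_def
proof (induction arbitrary: y rule: span_induct_alt)
  case (step c u z)
  then obtain a b where ab: "u = a - b" "a \<in> f" "b \<in> f" by auto
  then have "y + c *\<^sub>R (a - b) \<in> affine hull f"
    using step.prems by (intro mem_affine_3_minus) (auto simp: hull_inc)
  from step.IH[OF this] ab show ?case by (simp add: add_ac)
qed simp

lemma diff_affine_hull_tangent: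
  assumes "u \<in> affine hull f" "w \<in> affine hull f"
  shows "u - w \<in> tangent f"
proof -
  obtain a where a: "a \<in> f" using assms by (metis affine_hull_empty ex_in_conv)
  have *: "u - a \<in> tangent f" if "u \<in> affine hull f" for u
  proof -
    have "u - a \<in> span {z - a |z. z \<in> f - {a}}"
      using that unfolding affine_hull_span[OF a] by auto
    then show ?thesis
      unfolding tangent_def by (rule subsetD[OF span_mono, rotated]) (use a in auto)
  qed
  have "u - w = (u - a) - (w - a)" by simp
  then show ?thesis using * assms by (metis subspace_diff subspace_tangent)
qed

lemma tangent_mono: "e \<subseteq> f \<Longrightarrow> tangent e \<subseteq> tangent f"
  unfolding tangent_def by (intro span_mono) auto

lemma nondegenerate_affine_hull:
  "nondegenerate x N f \<Longrightarrow> affine hull f = affine hull (x ` vertex_indices x N f)"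
  using affine_hull_convex_hull[of "x ` vertex_indices x N f"] unfolding nondegenerate_def by simp

text \<open>Relative to a base vertex \<open>x k\<close> with \<open>k \<noteq> i\<close> the
  differences of the vertices are independent, so a linear functional may be prescribed as 1 at
  \<open>x i - x k\<close> and 0 at the others; the base vertex then has coordinate 0. With a single
  vertex there is no such base, and the constant 1 serves.\<close>

lemma affine_coordinate_exists:
  fixes x :: "nat \<Rightarrow> 'a::euclidean_space"
  assumes "inj_on x I" "\<not> affine_dependent (x ` I)" "i \<in> I"
  shows "\<exists>a c. \<forall>j\<in>I. a \<bullet> x j + c = (if i = j then 1 else 0)"
proof (cases "I = {i}")
  case True
  then show ?thesis by (intro exI[of _ 0] exI[of _ 1]) auto
next
  case False
  then obtain k where k: "k \<in> I" "k \<noteq> i" using assms(3) by auto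
  let ?B = "(\<lambda>v. - x k + v) ` (x ` I - {x k})"
  have indep: "independent ?B"
    using assms(2) k affine_dependent_iff_dependent2[of "x k" "x ` I"]
    by (simp add: insert_absorb)
  obtain g where g: "linear g" "\<forall>b\<in>?B. g b = (if b = - x k + x i then 1 else (0::real))"
    using linear_independent_extend[OF indep, of "\<lambda>b. if b = - x k + x i then 1 else 0"] by auto
  have "g (x j) - g (x k) = (if i = j then 1 else 0)" if j: "j \<in> I" for j
  proof (cases "j = k")
    case True
    then show ?thesis using k by simp
  next
    case False
    then have "- x k + x j \<in> ?B" using assms(1) j k by (auto simp: inj_on_def)
    then have "g (- x k + x j) = (if x j = x i then 1 else 0)" using g(2) by auto
    moreover have "x j = x i \<longleftrightarrow> i = j" using assms(1,3) j by (auto simp: inj_on_def)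
    ultimately show ?thesis using linear_diff[OF g(1), of "x j" "x k"] by simp
  qed
  moreover have "(\<Sum>b\<in>Basis. g b *\<^sub>R b) \<bullet> v = g v" for v
    using Linear_Algebra.linear_componentwise[OF g(1), of v 1]
    by (simp add: inner_sum_left mult.commute inner_commute[of v])
  ultimately show ?thesis
    by (intro exI[of _ "\<Sum>b\<in>Basis. g b *\<^sub>R b"] exI[of _ "- g (x k)"]) auto
qed

lemma affine_on_eqI:
  fixes l l' :: "'a::euclidean_space \<Rightarrow> 'b::real_vector"
  assumes "\<forall>u\<in>affine hull S. \<forall>w\<in>affine hull S. \<forall>t.
      l ((1 - t) *\<^sub>R u + t *\<^sub>R w) = (1 - t) *\<^sub>R l u + t *\<^sub>R l w"
    and "\<forall>u\<in>affine hull S. \<forall>w\<in>affine hull S. \<forall>t.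
      l' ((1 - t) *\<^sub>R u + t *\<^sub>R w) = (1 - t) *\<^sub>R l' u + t *\<^sub>R l' w"
    and "\<forall>s\<in>S. l s = l' s" "y \<in> affine hull S"
  shows "l y = l' y"
proof -
  let ?E = "{y \<in> affine hull S. l y = l' y}"
  have "(1 - t) *\<^sub>R u + t *\<^sub>R w \<in> affine hull S" if "u \<in> affine hull S" "w \<in> affine hull S" for u w t
    using that by (intro mem_affine[OF affine_affine_hull]) auto
  then have "affine ?E"
    by (intro affine_alt[THEN iffD2]) (simp add: assms(1,2))
  then have "affine hull S \<subseteq> ?E"
    using assms(3) by (intro hull_minimal) (auto simp: hull_inc)
  then show ?thesis using assms(4) by auto
qed

text \<open>Resolves the description operator in \<open>bary\<close>: an affine function on the hull
  is determined by its values at the vertices, and off the hull the value is fixed as 0.\<close>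

lemma bary_eq_affine:
  assumes f: "nondegenerate x N f"
    and a: "\<forall>j\<in>vertex_indices x N f. a \<bullet> x j + c = (if i = j then 1 else 0)"
    and y: "y \<in> affine hull f"
  shows "bary x N f i y = a \<bullet> y + c"
proof -
  have hull: "affine hull f = affine hull (x ` vertex_indices x N f)"
    using nondegenerate_affine_hull[OF f] .
  have mem: "(1 - t) *\<^sub>R u + t *\<^sub>R w \<in> affine hull f" if "u \<in> affine hull f" "w \<in> affine hull f" for u w t
    using that by (intro mem_affine[OF affine_affine_hull]) auto
  have vert: "x j \<in> affine hull f" if "j \<in> vertex_indices x N f" for j
    using that by (simp add: hull hull_inc)
  define l where "l y = (if y \<in> affine hull f then a \<bullet> y + c else 0)" for y
  let ?P = "\<lambda>l. (\<forall>u\<in>affine hull f. \<forall>w\<in>affine hull f. \<forall>t.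
        l ((1 - t) *\<^sub>R u + t *\<^sub>R w) = (1 - t) * l u + t * l w) \<and>
     (\<forall>u. u \<notin> affine hull f \<longrightarrow> l u = 0) \<and>
     (\<forall>j\<in>vertex_indices x N f. l (x j) = (if i = j then 1 else 0))"
  have P: "?P l"
    using a by (simp add: l_def mem vert) (simp add: inner_add_right algebra_simps)
  have "bary x N f i = l"
    unfolding bary_def
  proof (rule the_equality, rule P)
    fix l' assume P': "?P l'"
    have "l' y = l y" if "y \<in> affine hull f" for y
      by (rule affine_on_eqI[of "x ` vertex_indices x N f"])
        (use P P' that in \<open>auto simp flip: hull\<close>)
    then show "l' = l" using P' by (intro ext) (auto simp: l_def)
  qed
  then show ?thesis using y by (simp add: l_def)
qed

text \<open>The barycentric coordinates as linear functionals on the homogenised space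
  \<open>'a \<times> real\<close>: \<open>(y, 1)\<close> is the point \<open>y\<close> and \<open>(v, 0)\<close> the vector \<open>v\<close>.\<close>

definition hcoord ::
    "(nat \<Rightarrow> 'a::euclidean_space) \<Rightarrow> nat \<Rightarrow> 'a set \<Rightarrow> nat \<Rightarrow> 'a \<times> real \<Rightarrow> real" where
  "hcoord x N f i p = (SOME b. \<forall>j\<in>vertex_indices x N f.
      b \<bullet> (x j, 1) = (if i = j then 1 else 0)) \<bullet> p"

text \<open>The subspace on which \<open>hcoord\<close> is independent of the choice made in its
  definition. It contains \<open>(y, 1)\<close> for points of the affine hull and
  \<open>(v, 0)\<close> for tangent vectors.\<close>

definition hspace :: "(nat \<Rightarrow> 'a::euclidean_space) \<Rightarrow> nat \<Rightarrow> 'a set \<Rightarrow> ('a \<times> real) set" where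
  "hspace x N f = span ((\<lambda>i. (x i, 1)) ` vertex_indices x N f)"

lemma linear_hcoord: "linear (hcoord x N f i)"
  unfolding hcoord_def by (intro linearI) (auto simp: inner_add_right)

lemmas hcoord_add = linear_add[OF linear_hcoord]
  and hcoord_diff = linear_diff[OF linear_hcoord]
  and hcoord_scale = linear_scale[OF linear_hcoord]
  and hcoord_sum = linear_sum[OF linear_hcoord]

lemma hcoord_vertex:
  assumes f: "nondegenerate x N f" and ij: "i \<in> vertex_indices x N f" "j \<in> vertex_indices x N f"
  shows "hcoord x N f i (x j, 1) = (if i = j then 1 else 0)"
proof -
  obtain a c where "\<forall>j\<in>vertex_indices x N f. a \<bullet> x j + c = (if i = j then 1 else 0)"
    using affine_coordinate_exists[of x "vertex_indices x N f" i] f ij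
    unfolding nondegenerate_def by blast
  then have "\<exists>b. \<forall>j\<in>vertex_indices x N f. b \<bullet> (x j, 1::real) = (if i = j then 1 else 0)"
    by (intro exI[of _ "(a, c)"]) simp
  from someI_ex[OF this] ij show ?thesis unfolding hcoord_def by blast
qed

lemma bary_eq_hcoord:
  assumes f: "nondegenerate x N f" and "i \<in> vertex_indices x N f" "y \<in> affine hull f"
  shows "bary x N f i y = hcoord x N f i (y, 1)"
proof -
  obtain b c where bc: "hcoord x N f i = (\<lambda>p. (b, c) \<bullet> p)"
    by (cases "SOME b. \<forall>j\<in>vertex_indices x N f. b \<bullet> (x j, 1::real) = (if i = j then 1 else 0)")
      (auto simp: hcoord_def fun_eq_iff)
  then show ?thesis
    using bary_eq_affine[OF f _ assms(3), of b c i] hcoord_vertex[OF f assms(2)] by simp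
qed

text \<open>\<open>bary\<close> is affine only on the affine hull; tangency of \<open>v\<close>
  keeps the line through \<open>y\<close> inside it, and the derivative is then the linear
  part.\<close>

lemma bary_diff_eq_hcoord:
  assumes f: "nondegenerate x N f" and "i \<in> vertex_indices x N f"
    and y: "y \<in> affine hull f" and v: "v \<in> tangent f"
  shows "bary_diff x N f i y v = hcoord x N f i (v, 0)"
proof -
  have "bary x N f i (y + t *\<^sub>R v) = hcoord x N f i (y, 1) + t * hcoord x N f i (v, 0)" for t
  proof -
    have "y + t *\<^sub>R v \<in> affine hull f"
      using y v by (intro affine_hull_plus_tangent subspace_scale) auto
    then show ?thesis
      using bary_eq_hcoord[OF assms(1,2)] hcoord_add[of x N f i "(y, 1)" "t *\<^sub>R (v, 0)"]
        hcoord_scale[of x N f i t "(v, 0)"]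
      by simp
  qed
  then show ?thesis
    unfolding bary_diff_def
    by (simp, intro DERIV_imp_deriv) (auto intro!: derivative_eq_intros)
qed

text \<open>Both sides are linear in \<open>p\<close> and agree at the lifted vertices. The two
  components of this single identity are the reproduction of a point or vector from the vertices and
  the normalisation of the coordinates: sum 1 for points, 0 for tangent vectors.\<close>

lemma hspace_hcoord:
  assumes f: "nondegenerate x N f" and p: "p \<in> hspace x N f"
  shows "(\<Sum>i\<in>vertex_indices x N f. hcoord x N f i p *\<^sub>R (x i, 1)) = p"
  using p unfolding hspace_def
proof (induction rule: span_induct_alt)
  case base
  then show ?case by (simp add: linear_0[OF linear_hcoord] flip: zero_prod_def)
next
  case (step c p q)
  then obtain j where j: "j \<in> vertex_indices x N f" "p = (x j, 1)" by auto
  have "(\<Sum>i\<in>vertex_indices x N f. hcoord x N f i p *\<^sub>R (x i, 1)) =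
      (\<Sum>i\<in>vertex_indices x N f. if i = j then p else 0)"
    using hcoord_vertex[OF f] j by (intro sum.cong) (auto simp flip: zero_prod_def)
  then have *: "(\<Sum>i\<in>vertex_indices x N f. hcoord x N f i p *\<^sub>R (x i, 1)) = p" using j by simp
  have "(\<Sum>i\<in>vertex_indices x N f. hcoord x N f i (c *\<^sub>R p + q) *\<^sub>R (x i, 1::real)) =
      c *\<^sub>R (\<Sum>i\<in>vertex_indices x N f. hcoord x N f i p *\<^sub>R (x i, 1)) +
      (\<Sum>i\<in>vertex_indices x N f. hcoord x N f i q *\<^sub>R (x i, 1))"
    by (simp only: hcoord_add hcoord_scale scaleR_add_left sum.distrib scaleR_sum_right
        scaleR_scaleR real_scaleR_def)
  then show ?case by (simp only: * step.IH)
qed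

lemma hspace_point:
  assumes f: "nondegenerate x N f" and "y \<in> affine hull f"
  shows "(y, 1) \<in> hspace x N f"
proof -
  let ?E = "{y. (y, 1) \<in> hspace x N f}"
  have "affine ?E"
    unfolding affine_alt
  proof (intro ballI allI, simp)
    fix u w :: 'a and t :: real assume "(u, 1) \<in> hspace x N f" "(w, 1) \<in> hspace x N f"
    then have "(1 - t) *\<^sub>R (u, 1) + t *\<^sub>R (w, 1) \<in> hspace x N f"
      unfolding hspace_def by (intro span_add span_scale)
    then show "((1 - t) *\<^sub>R u + t *\<^sub>R w, 1) \<in> hspace x N f" by simp
  qed
  then have "affine hull (x ` vertex_indices x N f) \<subseteq> ?E"
    by (intro hull_minimal) (auto simp: hspace_def intro: span_base)
  then show ?thesis using assms nondegenerate_affine_hull by blast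
qed

lemma hspace_vector:
  assumes f: "nondegenerate x N f" and v: "v \<in> tangent f"
  shows "(v, 0) \<in> hspace x N f"
proof -
  obtain y where "y \<in> affine hull f"
    using f unfolding nondegenerate_def by (metis affine_hull_eq_empty convex_hull_eq_empty image_is_empty ex_in_conv)
  then have "(y + v, 1) - (y, 1) \<in> hspace x N f"
    unfolding hspace_def
    by (intro span_diff hspace_point[OF f, unfolded hspace_def] affine_hull_plus_tangent[OF v])
  then show ?thesis by simp
qed

lemma hcoord_expand_point:
  assumes f: "nondegenerate x N f" and y: "y \<in> affine hull f"
  shows "(\<Sum>i\<in>vertex_indices x N f. hcoord x N f i (y, 1) *\<^sub>R x i) = y"
    and "(\<Sum>i\<in>vertex_indices x N f. hcoord x N f i (y, 1)) = 1"
  using hspace_hcoord[OF f hspace_point[OF f y]] by (simp_all add: prod_eq_iff fst_sum snd_sum)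

lemma hcoord_expand_vector:
  assumes f: "nondegenerate x N f" and v: "v \<in> tangent f"
  shows "(\<Sum>i\<in>vertex_indices x N f. hcoord x N f i (v, 0) *\<^sub>R x i) = v"
    and "(\<Sum>i\<in>vertex_indices x N f. hcoord x N f i (v, 0)) = 0"
  using hspace_hcoord[OF f hspace_vector[OF f v]] by (simp_all add: prod_eq_iff fst_sum snd_sum)

lemma nondegenerate_subset:
  assumes "nondegenerate x N e" "nondegenerate x N g" "vertex_indices x N e \<subseteq> vertex_indices x N g"
  shows "e \<subseteq> g"
proof -
  have "convex hull (x ` vertex_indices x N e) \<subseteq> convex hull (x ` vertex_indices x N g)"
    using assms(3) by (intro hull_mono image_mono)
  then show ?thesis using assms(1,2) unfolding nondegenerate_def by auto
qed

text \<open>Linearity reduces this to the lifted vertices of \<open>e\<close>. It drives all trace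
  computations: a coordinate of a vertex outside \<open>e\<close> vanishes on \<open>e\<close>
  together with its differential.\<close>

lemma hcoord_restrict:
  assumes e: "nondegenerate x N e" and g: "nondegenerate x N g"
    and sub: "vertex_indices x N e \<subseteq> vertex_indices x N g"
    and p: "p \<in> hspace x N e" and i: "i \<in> vertex_indices x N g"
  shows "hcoord x N g i p = (if i \<in> vertex_indices x N e then hcoord x N e i p else 0)"
  using p unfolding hspace_def
proof (induction rule: span_induct_alt)
  case base
  then show ?case by (simp add: linear_0[OF linear_hcoord])
next
  case (step c p q)
  then obtain j where j: "j \<in> vertex_indices x N e" "p = (x j, 1)" by auto
  then have "hcoord x N g i p = (if i \<in> vertex_indices x N e then hcoord x N e i p else 0)"
    using hcoord_vertex[OF g i, of j] hcoord_vertex[OF e _ j(1), of i] sub by auto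
  then show ?case using step.IH by (simp add: hcoord_add hcoord_scale)
qed

lemma hcoord_nonneg:
  assumes f: "nondegenerate x N f" and y: "y \<in> f" and i: "i \<in> vertex_indices x N f"
  shows "0 \<le> hcoord x N f i (y, 1)"
proof -
  have "convex {y. 0 \<le> hcoord x N f i (y, 1)}"
    unfolding convex_alt
  proof (intro ballI allI impI, simp)
    fix u w :: 'a and t :: real
    assume *: "0 \<le> hcoord x N f i (u, 1)" "0 \<le> hcoord x N f i (w, 1)" "0 \<le> t \<and> t \<le> 1"
    have "hcoord x N f i ((1 - t) *\<^sub>R (u, 1) + t *\<^sub>R (w, 1)) =
        (1 - t) * hcoord x N f i (u, 1) + t * hcoord x N f i (w, 1)"
      by (simp only: hcoord_add hcoord_scale real_scaleR_def)
    then show "0 \<le> hcoord x N f i ((1 - t) *\<^sub>R u + t *\<^sub>R w, 1)" using * by simp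
  qed
  moreover have "x ` vertex_indices x N f \<subseteq> {y. 0 \<le> hcoord x N f i (y, 1)}"
    using hcoord_vertex[OF f i] by auto
  ultimately have "convex hull (x ` vertex_indices x N f) \<subseteq> {y. 0 \<le> hcoord x N f i (y, 1)}"
    by (intro hull_minimal)
  then show ?thesis using y f unfolding nondegenerate_def by auto
qed

lemma nondegenerate_memI:
  assumes "nondegenerate x N f" "\<And>i. i \<in> vertex_indices x N f \<Longrightarrow> 0 \<le> u i"
    "sum u (vertex_indices x N f) = 1"
  shows "(\<Sum>i\<in>vertex_indices x N f. u i *\<^sub>R x i) \<in> f"
proof -
  have "(\<Sum>i\<in>vertex_indices x N f. u i *\<^sub>R x i) \<in> convex hull (x ` vertex_indices x N f)"
    using assms by (intro convex_sum) (auto simp: hull_inc)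
  then show ?thesis using assms(1) unfolding nondegenerate_def by auto
qed

subsection \<open>Polynomials and polynomial forms\<close>

lemma form_apply_simps:
  fixes \<omega> \<eta> :: "'a form"
  shows "(\<omega> + \<eta>) y vs = \<omega> y vs + \<eta> y vs" "(\<omega> - \<eta>) y vs = \<omega> y vs - \<eta> y vs"
    "(c *\<^sub>R \<omega>) y vs = c * \<omega> y vs" "(0 :: 'a form) y vs = 0" "(- \<omega>) y vs = - \<omega> y vs"
  by (simp_all add: scaleR_fun_def)

lemma form_sum_apply: "(\<Sum>i\<in>S. F i :: 'a form) y vs = (\<Sum>i\<in>S. F i y vs)"
  by (induction S rule: infinite_finite_induct) auto

lemma span_mult:
  fixes A B C :: "('a \<Rightarrow> real) set"
  assumes "\<And>p q. p \<in> A \<Longrightarrow> q \<in> B \<Longrightarrow> (\<lambda>y. p y * q y) \<in> span C" "p \<in> span A" "q \<in> span B"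
  shows "(\<lambda>y. p y * q y) \<in> span C"
  using assms(2)
proof (induction rule: span_induct_alt)
  case base
  have "(\<lambda>y. 0 y * q y) = 0" by auto
  then show ?case by (simp add: span_zero)
next
  case (step c p p')
  have "(\<lambda>y. p y * q y) \<in> span C"
    using assms(3)
  proof (induction rule: span_induct_alt)
    case base
    have "(\<lambda>y. p y * 0 y) = 0" by auto
    then show ?case by (simp add: span_zero)
  next
    case (step c q q')
    have "(\<lambda>y. p y * (c *\<^sub>R q + q') y) = c *\<^sub>R (\<lambda>y. p y * q y) + (\<lambda>y. p y * q' y)"
      by (auto simp: scaleR_fun_def algebra_simps)
    then show ?case using step assms(1) \<open>p \<in> A\<close> by (simp add: span_add span_scale)
  qed
  moreover have "(\<lambda>y. (c *\<^sub>R p + p') y * q y) = c *\<^sub>R (\<lambda>y. p y * q y) + (\<lambda>y. p' y * q y)"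
    by (auto simp: scaleR_fun_def algebra_simps)
  ultimately show ?case using step by (simp add: span_add span_scale)
qed

lemma polys_mult:
  assumes "p \<in> polys a" "q \<in> polys b"
  shows "(\<lambda>y. p y * q y) \<in> polys (a + b)"
  unfolding polys_def
proof (rule span_mult[OF _ assms[unfolded polys_def]])
  fix p q :: "'a \<Rightarrow> real"
  assume "p \<in> {\<lambda>x. \<Prod>b\<in>Basis. (x \<bullet> b) ^ \<alpha> b |\<alpha>. int (sum \<alpha> Basis) \<le> a}"
    and "q \<in> {\<lambda>x. \<Prod>b\<in>Basis. (x \<bullet> b) ^ \<alpha> b |\<alpha>. int (sum \<alpha> Basis) \<le> b}"
  then obtain \<alpha> \<beta> where p: "p = (\<lambda>x. \<Prod>b\<in>Basis. (x \<bullet> b) ^ \<alpha> b)" "int (sum \<alpha> Basis) \<le> a"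
    and q: "q = (\<lambda>x. \<Prod>b\<in>Basis. (x \<bullet> b) ^ \<beta> b)" "int (sum \<beta> Basis) \<le> b" by blast
  have "(\<lambda>y. p y * q y) = (\<lambda>x. \<Prod>b\<in>Basis. (x \<bullet> b) ^ (\<alpha> b + \<beta> b))"
    by (simp add: p q power_add prod.distrib)
  moreover have "int (\<Sum>b\<in>Basis. \<alpha> b + \<beta> b) \<le> a + b"
    using p q by (simp add: sum.distrib)
  ultimately show "(\<lambda>y. p y * q y) \<in>
      span {\<lambda>x. \<Prod>b\<in>Basis. (x \<bullet> b) ^ \<alpha> b |\<alpha>. int (sum \<alpha> Basis) \<le> a + b}"
    by (intro span_base CollectI exI[of _ "\<lambda>b. \<alpha> b + \<beta> b"]) simp
qed

lemma subspace_polys [simp]: "subspace (polys d)"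
  by (simp add: polys_def)

lemma const_polys: "0 \<le> d \<Longrightarrow> (\<lambda>y. c) \<in> polys d"
proof -
  assume "0 \<le> d"
  then have "(\<lambda>y. 1) \<in> polys d"
    unfolding polys_def by (intro span_base CollectI exI[of _ "\<lambda>_. 0"]) auto
  then have "c *\<^sub>R (\<lambda>y. 1) \<in> polys d" by (rule subspace_scale[OF subspace_polys])
  then show ?thesis by (simp add: scaleR_fun_def)
qed

lemma affine_polys: "(\<lambda>y. a \<bullet> y + c) \<in> polys 1"
proof -
  have "(\<lambda>y. y \<bullet> b) \<in> polys 1" if b: "b \<in> Basis" for b :: 'a
  proof -
    have "(\<Prod>b'\<in>Basis. (y \<bullet> b') ^ (if b' = b then 1 else 0)) = y \<bullet> b" for y
    proof -
      have "(\<Prod>b'\<in>Basis. (y \<bullet> b') ^ (if b' = b then 1 else 0)) =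
          (\<Prod>b'\<in>Basis. if b' = b then y \<bullet> b' else 1)"
        by (intro prod.cong) auto
      then show ?thesis using b by simp
    qed
    then show ?thesis
      unfolding polys_def
      by (intro span_base CollectI exI[of _ "\<lambda>b'. if b' = b then 1 else 0"]) (use b in auto)
  qed
  then have "(\<Sum>b\<in>Basis. (a \<bullet> b) *\<^sub>R (\<lambda>y. y \<bullet> b)) + (\<lambda>y. c) \<in> polys 1"
    by (intro subspace_add[OF subspace_polys] subspace_sum[OF subspace_polys]
        subspace_scale[OF subspace_polys] const_polys) auto
  moreover have "(\<Sum>b\<in>Basis. (a \<bullet> b) *\<^sub>R (\<lambda>y. y \<bullet> b)) y = a \<bullet> y" for y
  proof -
    have "(\<Sum>b\<in>S. (a \<bullet> b) *\<^sub>R (\<lambda>y. y \<bullet> b)) y = (\<Sum>b\<in>S. (a \<bullet> b) * (y \<bullet> b))" for S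
      by (induction S rule: infinite_finite_induct) (auto simp: scaleR_fun_def)
    then show ?thesis by (simp add: euclidean_inner[of a y])
  qed
  then have "(\<Sum>b\<in>Basis. (a \<bullet> b) *\<^sub>R (\<lambda>y. y \<bullet> b)) + (\<lambda>y. c) = (\<lambda>y. a \<bullet> y + c)"
    by (auto simp: fun_eq_iff)
  ultimately show ?thesis by simp
qed

lemma prod_power_polys:
  assumes "\<And>i. i \<in> S \<Longrightarrow> h i \<in> polys 1"
  shows "(\<lambda>y. \<Prod>i\<in>S. h i y ^ \<alpha> i) \<in> polys (int (sum \<alpha> S))"
  using assms
proof (induction S rule: infinite_finite_induct)
  case (insert i S)
  have pow: "(\<lambda>y. h i y ^ n) \<in> polys (int n)" for n
  proof (induction n)
    case (Suc n)
    then show ?case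
      using polys_mult[of "h i" 1 "\<lambda>y. h i y ^ n" "int n"] insert.prems by simp
  qed (simp add: const_polys)
  show ?case
    using polys_mult[OF pow[of "\<alpha> i"] insert.IH] insert by simp
qed (auto simp: const_polys)

lemma continuous_on_polys: "p \<in> polys d \<Longrightarrow> continuous_on S p"
  unfolding polys_def
proof (induction rule: span_induct_alt)
  case base
  then show ?case by (simp add: zero_fun_def)
next
  case (step c p q)
  then have "continuous_on S (\<lambda>y. c *\<^sub>R p y + q y)" by (auto intro!: continuous_intros)
  then show ?case by (simp add: scaleR_fun_def plus_fun_def)
qed

section \<open>Polynomials in barycentric coordinates\<close>

definition bary_monom ::
    "(nat \<Rightarrow> 'a::euclidean_space) \<Rightarrow> nat \<Rightarrow> 'a set \<Rightarrow> (nat \<Rightarrow> nat) \<Rightarrow> 'a \<Rightarrow> real" where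
  "bary_monom x N f \<alpha> y = (\<Prod>i\<in>vertex_indices x N f. hcoord x N f i (y, 1) ^ \<alpha> i)"

text \<open>Homogeneous polynomials of degree exactly \<open>d\<close> in the barycentric
  coordinates; on \<open>f\<close> these are all polynomials of degree at most
  \<open>d\<close>.\<close>

definition bary_polys :: "(nat \<Rightarrow> 'a::euclidean_space) \<Rightarrow> nat \<Rightarrow> 'a set \<Rightarrow> nat \<Rightarrow> ('a \<Rightarrow> real) set" where
  "bary_polys x N f d = span {bary_monom x N f \<alpha> |\<alpha>. sum \<alpha> (vertex_indices x N f) = d}"

lemma hcoord_polys: "(\<lambda>y. hcoord x N f i (y, 1)) \<in> polys 1"
proof -
  obtain b c where "hcoord x N f i = (\<lambda>p. (b, c) \<bullet> p)"
    by (cases "SOME b. \<forall>j\<in>vertex_indices x N f. b \<bullet> (x j, 1::real) = (if i = j then 1 else 0)")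
      (auto simp: hcoord_def fun_eq_iff)
  then show ?thesis using affine_polys[of b c] by simp
qed

lemma bary_monom_polys:
  "bary_monom x N f \<alpha> \<in> polys (int (sum \<alpha> (vertex_indices x N f)))"
  unfolding bary_monom_def[abs_def] by (rule prod_power_polys) (rule hcoord_polys)

lemma bary_polys_mult:
  assumes "p \<in> bary_polys x N f a" "q \<in> bary_polys x N f b"
  shows "(\<lambda>y. p y * q y) \<in> bary_polys x N f (a + b)"
  unfolding bary_polys_def
proof (rule span_mult[OF _ assms[unfolded bary_polys_def]])
  fix p q
  assume "p \<in> {bary_monom x N f \<alpha> |\<alpha>. sum \<alpha> (vertex_indices x N f) = a}"
    and "q \<in> {bary_monom x N f \<alpha> |\<alpha>. sum \<alpha> (vertex_indices x N f) = b}"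
  then obtain \<alpha> \<beta> where p: "p = bary_monom x N f \<alpha>" "sum \<alpha> (vertex_indices x N f) = a"
    and q: "q = bary_monom x N f \<beta>" "sum \<beta> (vertex_indices x N f) = b" by blast
  have "(\<lambda>y. p y * q y) = bary_monom x N f (\<lambda>i. \<alpha> i + \<beta> i)"
    by (simp add: p q bary_monom_def fun_eq_iff power_add prod.distrib)
  moreover have "(\<Sum>i\<in>vertex_indices x N f. \<alpha> i + \<beta> i) = a + b"
    using p q by (simp add: sum.distrib)
  ultimately show "(\<lambda>y. p y * q y) \<in>
      span {bary_monom x N f \<alpha> |\<alpha>. sum \<alpha> (vertex_indices x N f) = a + b}"
    by (intro span_base) blast
qed

lemma bary_polys_linear:
  "(\<lambda>y. \<Sum>i\<in>vertex_indices x N f. c i * hcoord x N f i (y, 1)) \<in> bary_polys x N f 1"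
proof -
  let ?I = "vertex_indices x N f"
  have "(\<lambda>y. hcoord x N f i (y, 1)) \<in> bary_polys x N f 1" if i: "i \<in> ?I" for i
  proof -
    have "bary_monom x N f (\<lambda>j. if j = i then 1 else 0) = (\<lambda>y. hcoord x N f i (y, 1))"
    proof
      fix y
      have "bary_monom x N f (\<lambda>j. if j = i then 1 else 0) y =
          (\<Prod>j\<in>?I. if j = i then hcoord x N f j (y, 1) else 1)"
        unfolding bary_monom_def by (intro prod.cong) auto
      then show "bary_monom x N f (\<lambda>j. if j = i then 1 else 0) y = hcoord x N f i (y, 1)"
        using i by simp
    qed
    moreover have "(\<Sum>j\<in>?I. if j = i then 1 else 0) = (1::nat)" using i by simp
    ultimately show ?thesis
      unfolding bary_polys_def
      by (intro span_base CollectI exI[of _ "\<lambda>j. if j = i then 1 else 0"]) simp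
  qed
  then have "(\<Sum>i\<in>?I. c i *\<^sub>R (\<lambda>y. hcoord x N f i (y, 1))) \<in> bary_polys x N f 1"
    unfolding bary_polys_def by (intro span_sum span_scale)
  moreover have "(\<Sum>i\<in>S. c i *\<^sub>R (\<lambda>y. hcoord x N f i (y, 1))) =
      (\<lambda>y. \<Sum>i\<in>S. c i * hcoord x N f i (y, 1))" for S
    by (induction S rule: infinite_finite_induct) (auto simp: scaleR_fun_def)
  ultimately show ?thesis by simp
qed

text \<open>Homogenisation: Cartesian coordinates are linear combinations of barycentric ones, and
  since the barycentric coordinates sum to 1, a missing degree is supplied by a power of that
  sum.\<close>

lemma polys_imp_bary_polys:
  assumes f: "nondegenerate x N f" and p: "p \<in> polys (int d)"
  shows "\<exists>q\<in>bary_polys x N f d. \<forall>y\<in>f. p y = q y"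
proof -
  let ?I = "vertex_indices x N f"
  define R where "R d = {p. \<exists>q\<in>bary_polys x N f d. \<forall>y\<in>f. p y = q y}" for d
  have R_mult: "(\<lambda>y. p y * q y) \<in> R (a + b)" if pq: "p \<in> R a" "q \<in> R b" for p q a b
  proof -
    obtain p' q' where "p' \<in> bary_polys x N f a" "\<forall>y\<in>f. p y = p' y"
      "q' \<in> bary_polys x N f b" "\<forall>y\<in>f. q y = q' y" using pq unfolding R_def by auto
    then show ?thesis unfolding R_def by (auto intro!: bexI[OF _ bary_polys_mult])
  qed
  have R_coord: "(\<lambda>y. y \<bullet> b) \<in> R 1" for b
    unfolding R_def
  proof (intro CollectI bexI[OF _ bary_polys_linear] ballI)
    fix y assume y: "y \<in> f"
    have "y \<bullet> b = (\<Sum>i\<in>?I. hcoord x N f i (y, 1) *\<^sub>R x i) \<bullet> b"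
      using hcoord_expand_point(1)[OF f hull_inc[OF y]] by simp
    then show "y \<bullet> b = (\<Sum>i\<in>?I. (x i \<bullet> b) * hcoord x N f i (y, 1))"
      by (simp add: inner_sum_left mult.commute)
  qed
  have R_one: "(\<lambda>y. 1) \<in> R 1"
    unfolding R_def
  proof (intro CollectI bexI[OF _ bary_polys_linear] ballI)
    fix y assume y: "y \<in> f"
    then show "1 = (\<Sum>i\<in>?I. 1 * hcoord x N f i (y, 1))"
      using hcoord_expand_point(2)[OF f hull_inc[OF y]] by simp
  qed
  have "bary_monom x N f (\<lambda>_. 0) \<in> bary_polys x N f 0"
    unfolding bary_polys_def by (intro span_base) auto
  then have R_0: "(\<lambda>y. 1) \<in> R 0"
    unfolding R_def
    by (intro CollectI bexI[of _ "bary_monom x N f (\<lambda>_. 0)"]) (auto simp: bary_monom_def)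
  have R_const: "(\<lambda>y. 1) \<in> R n" for n
  proof (induction n)
    case (Suc n)
    then show ?case using R_mult[OF R_one Suc] by simp
  qed (rule R_0)
  have R_pow: "(\<lambda>y. (y \<bullet> b) ^ n) \<in> R n" for b n
  proof (induction n)
    case (Suc n)
    then show ?case using R_mult[OF R_coord Suc] by simp
  qed (simp add: R_0)
  have R_prod: "(\<lambda>y. \<Prod>b\<in>S. (y \<bullet> b) ^ \<beta> b) \<in> R (sum \<beta> S)" if "finite S" for S \<beta>
    using that
  proof induction
    case (insert b S)
    then show ?case using R_mult[OF R_pow insert.IH] by simp
  qed (simp add: R_0)
  have "p \<in> R d"
    using p unfolding polys_def
  proof (induction rule: span_induct_alt)
    case base
    show ?case unfolding R_def bary_polys_def by (auto intro!: bexI[OF _ span_zero])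
  next
    case (step c p q)
    then obtain \<beta> where \<beta>: "p = (\<lambda>y. \<Prod>b\<in>Basis. (y \<bullet> b) ^ \<beta> b)" "int (sum \<beta> Basis) \<le> int d" by blast
    have "p \<in> R (sum \<beta> Basis)" using R_prod[of Basis \<beta>] \<beta> by simp
    \<comment> \<open>The monomial has degree at most \<open>d\<close>; the constant 1, written as a
      homogeneous polynomial of the complementary degree, raises it to exactly
      \<open>d\<close>.\<close>
    from R_mult[OF this R_const[of "d - sum \<beta> Basis"]] \<beta>(2) have "p \<in> R d" by simp
    then obtain p' q' where "p' \<in> bary_polys x N f d" "\<forall>y\<in>f. p y = p' y"
      "q' \<in> bary_polys x N f d" "\<forall>y\<in>f. q y = q' y" using step.IH unfolding R_def by auto
    then show ?case
      unfolding R_def bary_polys_def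
      by (intro CollectI bexI[of _ "c *\<^sub>R p' + q'"] span_add span_scale) (auto simp: scaleR_fun_def)
  qed
  then show ?thesis by (simp add: R_def)
qed

section \<open>Vector space structure of the spaces of polynomial forms\<close>

lemma alt_multilinear_closed:
  assumes "alt_multilinear V k a" "alt_multilinear V k b"
  shows "alt_multilinear V k (a + b)" and "alt_multilinear V k (c *\<^sub>R a)"
  using assms unfolding alt_multilinear_def linear_on_subspace_def
  by (auto simp: scaleR_fun_def algebra_simps)

lemma alt_multilinear_0: "alt_multilinear V k 0"
  by (simp add: alt_multilinear_def linear_on_subspace_def)

lemma subspace_poly_forms: "subspace (poly_forms d k f)"
  unfolding subspace_def
proof (intro conjI ballI allI)
  show "0 \<in> poly_forms d k f"
    using subspace_0[OF subspace_polys[of d]]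
    by (auto simp: poly_forms_def alt_multilinear_0 intro!: bexI[of _ 0])
next
  fix \<omega> \<eta> assume *: "\<omega> \<in> poly_forms d k f" "\<eta> \<in> poly_forms d k f"
  have "\<exists>p\<in>polys d. \<forall>y\<in>f. (\<omega> + \<eta>) y vs = p y" for vs
  proof -
    obtain p q where "p \<in> polys d" "\<forall>y\<in>f. \<omega> y vs = p y" "q \<in> polys d" "\<forall>y\<in>f. \<eta> y vs = q y"
      using * unfolding poly_forms_def by blast
    then show ?thesis by (intro bexI[of _ "p + q"]) (auto intro: subspace_add)
  qed
  then show "\<omega> + \<eta> \<in> poly_forms d k f"
    using * by (auto simp: poly_forms_def intro: alt_multilinear_closed)
next
  fix c \<omega> assume *: "\<omega> \<in> poly_forms d k f"
  have "\<exists>p\<in>polys d. \<forall>y\<in>f. (c *\<^sub>R \<omega>) y vs = p y" for vs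
  proof -
    obtain p where "p \<in> polys d" "\<forall>y\<in>f. \<omega> y vs = p y"
      using * unfolding poly_forms_def by blast
    then show ?thesis
      using subspace_scale[OF subspace_polys, of p d c]
      by (intro bexI[of _ "c *\<^sub>R p"]) (auto simp: scaleR_fun_def)
  qed
  moreover have "alt_multilinear (tangent f) k ((c *\<^sub>R \<omega>) y)" if "y \<in> f" for y
    using * that alt_multilinear_closed(2)[of "tangent f" k "\<omega> y"]
    by (auto simp: poly_forms_def scaleR_fun_def)
  ultimately show "c *\<^sub>R \<omega> \<in> poly_forms d k f"
    using * by (auto simp: poly_forms_def scaleR_fun_def zero_fun_def)
qed

lemma koszul_add: "koszul z (\<omega> + \<eta>) = koszul z \<omega> + koszul z \<eta>"
  and koszul_scale: "koszul z (c *\<^sub>R \<omega>) = c *\<^sub>R koszul z \<omega>"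
  and koszul_0: "koszul z 0 = 0"
  by (simp_all add: koszul_def fun_eq_iff scaleR_fun_def)

lemma subspace_poly_minus_forms: "subspace (poly_minus_forms r k f)"
proof -
  define z where "z = (SOME z. z \<in> affine hull f)"
  have eq: "poly_minus_forms r k f = {\<omega> + koszul z \<eta> |\<omega> \<eta>.
         \<omega> \<in> poly_forms (int r - 1) k f \<and> \<eta> \<in> poly_forms (int r - 1) (k + 1) f}"
    by (simp add: poly_minus_forms_def z_def Let_def)
  note sub = subspace_poly_forms[of "int r - 1" k f] subspace_poly_forms[of "int r - 1" "k + 1" f]
  show ?thesis
    unfolding subspace_def
  proof (intro conjI ballI allI)
    have "0 = 0 + koszul z 0" by (simp add: koszul_0)
    then show "0 \<in> poly_minus_forms r k f"
      unfolding eq using sub[THEN subspace_0] by blast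
  next
    fix u w assume "u \<in> poly_minus_forms r k f" "w \<in> poly_minus_forms r k f"
    then obtain \<omega> \<eta> \<omega>' \<eta>' where *: "u = \<omega> + koszul z \<eta>" "w = \<omega>' + koszul z \<eta>'"
      "\<omega> \<in> poly_forms (int r - 1) k f" "\<eta> \<in> poly_forms (int r - 1) (k + 1) f"
      "\<omega>' \<in> poly_forms (int r - 1) k f" "\<eta>' \<in> poly_forms (int r - 1) (k + 1) f"
      unfolding eq by blast
    then have "u + w = (\<omega> + \<omega>') + koszul z (\<eta> + \<eta>')" by (simp add: koszul_add)
    then show "u + w \<in> poly_minus_forms r k f"
      unfolding eq using * sub[THEN subspace_add] by blast
  next
    fix c u assume "u \<in> poly_minus_forms r k f"
    then obtain \<omega> \<eta> where *: "u = \<omega> + koszul z \<eta>"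
      "\<omega> \<in> poly_forms (int r - 1) k f" "\<eta> \<in> poly_forms (int r - 1) (k + 1) f"
      unfolding eq by blast
    then have "c *\<^sub>R u = c *\<^sub>R \<omega> + koszul z (c *\<^sub>R \<eta>)"
      by (simp add: koszul_scale scaleR_add_right)
    then show "c *\<^sub>R u \<in> poly_minus_forms r k f"
      unfolding eq using * sub[THEN subspace_scale] by blast
  qed
qed

subsection \<open>Whitney forms\<close>

definition fmult :: "('a \<Rightarrow> real) \<Rightarrow> 'a form \<Rightarrow> 'a form" where
  "fmult q \<omega> = (\<lambda>y vs. q y * \<omega> y vs)"

definition dbary_form :: "(nat \<Rightarrow> 'a::euclidean_space) \<Rightarrow> nat \<Rightarrow> 'a set \<Rightarrow> nat list \<Rightarrow> 'a form" where
  "dbary_form x N f \<tau> = (\<lambda>y vs. if y \<in> f \<and> set vs \<subseteq> tangent f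
     then wedge (map (hcoord x N f) \<tau>) (map (\<lambda>v. (v, 0)) vs) else 0)"

text \<open>Whitney forms for arbitrary index lists; in homogeneous coordinates such a form is the
  contraction of a product of differentials with the radial vector \<open>(y, 1)\<close>.\<close>

definition whitney_list :: "(nat \<Rightarrow> 'a::euclidean_space) \<Rightarrow> nat \<Rightarrow> 'a set \<Rightarrow> nat list \<Rightarrow> 'a form" where
  "whitney_list x N f \<tau> = (\<lambda>y vs. if y \<in> f \<and> set vs \<subseteq> tangent f
     then wedge (map (hcoord x N f) \<tau>) ((y, 1) # map (\<lambda>v. (v, 0)) vs) else 0)"

lemma filter_neq_upt: "i < n \<Longrightarrow> filter (\<lambda>j. j \<noteq> i) [0..<n] = [0..<i] @ [Suc i..<n]"
proof -
  assume "i < n"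
  then have "[0..<n] = [0..<i] @ i # [Suc i..<n]"
    by (metis less_imp_le_nat upt_add_eq_append upt_conv_Cons le_add_diff_inverse zero_le plus_nat.add_0)
  then show ?thesis by simp
qed

text \<open>Laplace expansion along the column of the radial vector \<open>(y, 1)\<close> reproduces
  the defining alternating sum, since \<open>bary\<close> and \<open>bary_diff\<close> are the
  values of \<open>hcoord\<close> at \<open>(y, 1)\<close> and \<open>(v, 0)\<close>.\<close>

lemma whitney_eq_whitney_list:
  assumes f: "nondegenerate x N f" and \<sigma>: "\<sigma> ` {0..k} \<subseteq> vertex_indices x N f"
  shows "whitney x N k f \<sigma> = whitney_list x N f (map \<sigma> [0..<Suc k])"
proof (intro ext)
  fix y vs
  show "whitney x N k f \<sigma> y vs = whitney_list x N f (map \<sigma> [0..<Suc k]) y vs"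
  proof (cases "y \<in> f \<and> set vs \<subseteq> tangent f")
    case True
    then have y: "y \<in> affine hull f" by (simp add: hull_inc)
    let ?h = "\<lambda>j. hcoord x N f (\<sigma> j)"
    have \<sigma>': "\<sigma> j \<in> vertex_indices x N f" if "j < Suc k" for j using \<sigma> that by auto
    have "whitney x N k f \<sigma> y vs = (\<Sum>i<Suc k. (- 1) ^ i * bary x N f (\<sigma> i) y *
          wedge (map (\<lambda>j. bary_diff x N f (\<sigma> j) y) (filter (\<lambda>j. j \<noteq> i) [0..<Suc k])) vs)"
      using True by (simp add: whitney_def lessThan_Suc_atMost del: upt_Suc)
    also have "\<dots> = (\<Sum>i<Suc k. (- 1) ^ i * ?h i (y, 1) *
          wedge (map ?h ([0..<i] @ [Suc i..<Suc k])) (map (\<lambda>v. (v, 0)) vs))"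
    proof (rule sum.cong)
      fix i assume i: "i \<in> {..<Suc k}"
      have "wedge (map (\<lambda>j. bary_diff x N f (\<sigma> j) y) ([0..<i] @ [Suc i..<Suc k])) vs =
          wedge (map ?h ([0..<i] @ [Suc i..<Suc k])) (map (\<lambda>v. (v, 0)) vs)"
      proof (rule wedge_cong)
        fix l m
        assume l: "l < length (map (\<lambda>j. bary_diff x N f (\<sigma> j) y) ([0..<i] @ [Suc i..<Suc k]))"
          and m: "m < length vs"
        then have "([0..<i] @ [Suc i..<Suc k]) ! l \<in> set ([0..<i] @ [Suc i..<Suc k])"
          by (intro nth_mem) simp
        then have "([0..<i] @ [Suc i..<Suc k]) ! l < Suc k" using i by auto
        moreover have "vs ! m \<in> tangent f" using True m by auto
        ultimately show "(map (\<lambda>j. bary_diff x N f (\<sigma> j) y) ([0..<i] @ [Suc i..<Suc k]) ! l) (vs ! m) =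
            (map ?h ([0..<i] @ [Suc i..<Suc k]) ! l) (map (\<lambda>v. (v, 0)) vs ! m)"
          using l m bary_diff_eq_hcoord[OF f \<sigma>' y] by (simp only: nth_map length_map)
      qed simp_all
      then show "(- 1) ^ i * bary x N f (\<sigma> i) y *
          wedge (map (\<lambda>j. bary_diff x N f (\<sigma> j) y) (filter (\<lambda>j. j \<noteq> i) [0..<Suc k])) vs =
          (- 1) ^ i * ?h i (y, 1) *
          wedge (map ?h ([0..<i] @ [Suc i..<Suc k])) (map (\<lambda>v. (v, 0)) vs)"
        using i filter_neq_upt[of i "Suc k"] bary_eq_hcoord[OF f \<sigma>' y] by (simp only: lessThan_iff)
    qed simp
    also have "\<dots> = wedge (map ?h [0..<Suc k]) ((y, 1) # map (\<lambda>v. (v, 0)) vs)"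
    proof (subst wedge_Cons_right, intro sum.cong)
      fix i assume i: "i \<in> {..<length (map ?h [0..<Suc k])}"
      then show "(- 1) ^ i * ?h i (y, 1) *
          wedge (map ?h ([0..<i] @ [Suc i..<Suc k])) (map (\<lambda>v. (v, 0)) vs) =
          (- 1) ^ i * (map ?h [0..<Suc k] ! i) (y, 1) *
          wedge (take i (map ?h [0..<Suc k]) @ drop (Suc i) (map ?h [0..<Suc k])) (map (\<lambda>v. (v, 0)) vs)"
        by (simp add: take_map drop_map del: upt_Suc)
    qed simp
    finally show ?thesis using True by (simp add: whitney_list_def o_def del: upt_Suc)
  next
    case False
    then show ?thesis unfolding whitney_def whitney_list_def by (simp only: if_False)
  qed
qed

text \<open>The set \<open>J\<close> may be smaller than the index set of \<open>f\<close>, as for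
  the target of an extension; exponents are then padded by 0.\<close>

lemma bary_whitney_eq:
  assumes f: "nondegenerate x N f" and \<sigma>: "\<sigma> ` {0..k} \<subseteq> vertex_indices x N f"
    and J: "J \<subseteq> vertex_indices x N f"
  shows "bary_whitney x N k J f \<alpha> \<sigma> =
    fmult (bary_monom x N f (\<lambda>i. if i \<in> J then \<alpha> i else 0)) (whitney_list x N f (map \<sigma> [0..<Suc k]))"
proof (intro ext)
  fix y vs
  have "(\<Prod>i\<in>J. bary x N f i y ^ \<alpha> i) = bary_monom x N f (\<lambda>i. if i \<in> J then \<alpha> i else 0) y"
    if "y \<in> f"
    unfolding bary_monom_def using J bary_eq_hcoord[OF f _ hull_inc[OF that]]
    by (intro prod.mono_neutral_cong_left) auto
  moreover have "whitney_list x N f \<tau> y vs = 0" if "y \<notin> f" for \<tau>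
    using that by (simp add: whitney_list_def)
  ultimately show "bary_whitney x N k J f \<alpha> \<sigma> y vs =
      fmult (bary_monom x N f (\<lambda>i. if i \<in> J then \<alpha> i else 0))
        (whitney_list x N f (map \<sigma> [0..<Suc k])) y vs"
    unfolding bary_whitney_def fmult_def whitney_eq_whitney_list[OF f \<sigma>]
    by (cases "y \<in> f") simp_all
qed

text \<open>Since \<open>(y - z, 0) = (y, 1) - (z, 1)\<close>, the Koszul contraction is the radial
  one minus contraction with the fixed vector \<open>(z, 1)\<close>, and the latter yields products
  of differentials with constant coefficients.\<close>

lemma koszul_dbary_form:
  assumes z: "z \<in> affine hull f"
  shows "koszul z (dbary_form x N f \<tau>) = whitney_list x N f \<tau> -
    (\<Sum>i<length \<tau>. ((- 1) ^ i * hcoord x N f (\<tau> ! i) (z, 1)) *\<^sub>R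
      dbary_form x N f (take i \<tau> @ drop (Suc i) \<tau>))"
proof (intro ext)
  fix y :: 'a and vs :: "'a list"
  let ?ws = "map (\<lambda>v. (v, 0::real)) vs" and ?h = "hcoord x N f"
  show "koszul z (dbary_form x N f \<tau>) y vs = (whitney_list x N f \<tau> -
    (\<Sum>i<length \<tau>. ((- 1) ^ i * hcoord x N f (\<tau> ! i) (z, 1)) *\<^sub>R
      dbary_form x N f (take i \<tau> @ drop (Suc i) \<tau>))) y vs"
  proof (cases "y \<in> f \<and> set vs \<subseteq> tangent f")
    case True
    then have "y - z \<in> tangent f"
      using z by (intro diff_affine_hull_tangent) (auto simp: hull_inc)
    then have "koszul z (dbary_form x N f \<tau>) y vs = wedge (map ?h \<tau>) ((y - z, 0) # ?ws)"
      using True by (simp add: koszul_def dbary_form_def)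
    also have "\<dots> = wedge (map ?h \<tau>) ((y, 1) # ?ws) - wedge (map ?h \<tau>) ((z, 1) # ?ws)"
      unfolding wedge_Cons_right sum_subtractf[symmetric]
      using hcoord_diff[of x N f _ "(y, 1)" "(z, 1)", symmetric]
      by (intro sum.cong) (simp_all flip: left_diff_distrib right_diff_distrib)
    also have "wedge (map ?h \<tau>) ((z, 1) # ?ws) = (\<Sum>i<length \<tau>. ((- 1) ^ i * ?h (\<tau> ! i) (z, 1)) *
        wedge (map ?h (take i \<tau> @ drop (Suc i) \<tau>)) ?ws)"
      unfolding wedge_Cons_right by (intro sum.cong) (simp_all add: take_map drop_map)
    finally show ?thesis
      using True
      by (simp add: form_apply_simps form_sum_apply whitney_list_def dbary_form_def del: map_append)
  next
    case False
    then have "koszul z (dbary_form x N f \<tau>) y vs = 0"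
      by (auto simp: koszul_def dbary_form_def)
    moreover have "whitney_list x N f \<tau> y vs = 0" "dbary_form x N f \<tau>' y vs = 0" for \<tau>'
      using False by (auto simp: whitney_list_def dbary_form_def)
    ultimately show ?thesis by (simp add: form_apply_simps form_sum_apply)
  qed
qed

text \<open>This is where \<open>\<Sum>\<^sub>i \<lambda>\<^sub>i = 1\<close> and \<open>\<Sum>\<^sub>i d\<lambda>\<^sub>i = 0\<close> enter: summing the first row of the
  determinants leaves the row \<open>(1, 0, \<dots>, 0)\<close>.\<close>

lemma dbary_form_eq_sum_whitney:
  assumes f: "nondegenerate x N f"
  shows "dbary_form x N f \<tau> = (\<Sum>j\<in>vertex_indices x N f. whitney_list x N f (j # \<tau>))"
proof (intro ext)
  fix y :: 'a and vs :: "'a list"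
  let ?ws = "map (\<lambda>v. (v, 0::real)) vs" and ?h = "hcoord x N f" and ?I = "vertex_indices x N f"
  show "dbary_form x N f \<tau> y vs = (\<Sum>j\<in>?I. whitney_list x N f (j # \<tau>)) y vs"
  proof (cases "y \<in> f \<and> set vs \<subseteq> tangent f")
    case True
    let ?us = "(y, 1) # ?ws"
    have "(\<Sum>j\<in>?I. ?h j (?us ! l)) = (if l = 0 then 1 else 0)" if "l < length ?us" for l
    proof (cases l)
      case 0
      then show ?thesis using hcoord_expand_point(2)[OF f hull_inc] True by simp
    next
      case (Suc m)
      then have "vs ! m \<in> tangent f" using True that by auto
      then show ?thesis using Suc that hcoord_expand_vector(2)[OF f] by simp
    qed
    then have row: "(\<Sum>j\<in>?I. (- 1) ^ l * ?h j (?us ! l) * wedge (map ?h \<tau>) (take l ?us @ drop (Suc l) ?us)) =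
        (if l = 0 then wedge (map ?h \<tau>) ?ws else 0)" if "l < length ?us" for l
      using that by (subst sum_distrib_right[symmetric], subst sum_distrib_left[symmetric]) simp
    have "(\<Sum>j\<in>?I. wedge (map ?h (j # \<tau>)) ?us) =
        (\<Sum>j\<in>?I. \<Sum>l<length ?us. (- 1) ^ l * ?h j (?us ! l) * wedge (map ?h \<tau>) (take l ?us @ drop (Suc l) ?us))"
      unfolding list.map(2) by (intro sum.cong wedge_Cons_left) simp
    also have "\<dots> = (\<Sum>l<length ?us. if l = 0 then wedge (map ?h \<tau>) ?ws else 0)"
      by (subst sum.swap, intro sum.cong row) auto
    also have "\<dots> = wedge (map ?h \<tau>) ?ws" by (simp add: sum.delta)
    finally show ?thesis
      using True by (simp add: form_sum_apply whitney_list_def dbary_form_def)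
  next
    case False
    then have "whitney_list x N f (j # \<tau>) y vs = 0" "dbary_form x N f \<tau> y vs = 0" for j
      by (auto simp: whitney_list_def dbary_form_def)
    then show ?thesis by (simp add: form_sum_apply)
  qed
qed

definition whitney_span :: "(nat \<Rightarrow> 'a::euclidean_space) \<Rightarrow> nat \<Rightarrow> nat \<Rightarrow> nat \<Rightarrow> 'a set \<Rightarrow> 'a form set" where
  "whitney_span x N d k f = span {fmult (bary_monom x N f \<alpha>) (whitney_list x N f \<tau>) |\<alpha> \<tau>.
     sum \<alpha> (vertex_indices x N f) = d \<and> set \<tau> \<subseteq> vertex_indices x N f \<and> length \<tau> = Suc k}"

lemma fmult_linear:
  "fmult (p + q) \<omega> = fmult p \<omega> + fmult q \<omega>" "fmult (c *\<^sub>R p) \<omega> = c *\<^sub>R fmult p \<omega>" "fmult 0 \<omega> = 0"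
  "fmult p (\<omega> + \<eta>) = fmult p \<omega> + fmult p \<eta>" "fmult p (\<omega> - \<eta>) = fmult p \<omega> - fmult p \<eta>"
  "fmult p (c *\<^sub>R \<omega>) = c *\<^sub>R fmult p \<omega>"
  by (simp_all add: fmult_def fun_eq_iff scaleR_fun_def algebra_simps)

lemma fmult_sum: "fmult p (\<Sum>i\<in>S. F i) = (\<Sum>i\<in>S. fmult p (F i))"
  by (simp add: fun_eq_iff fmult_def form_sum_apply sum_distrib_left)

lemma fmult_whitney_list_in_span:
  assumes q: "q \<in> bary_polys x N f d" and \<tau>: "set \<tau> \<subseteq> vertex_indices x N f" "length \<tau> = Suc k"
  shows "fmult q (whitney_list x N f \<tau>) \<in> whitney_span x N d k f"
  using q unfolding bary_polys_def
proof (induction rule: span_induct_alt)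
  case base
  show ?case by (simp only: fmult_linear whitney_span_def span_zero)
next
  case (step c p q)
  then have "fmult p (whitney_list x N f \<tau>) \<in> whitney_span x N d k f"
    unfolding whitney_span_def using \<tau> by (intro span_base) blast
  then show ?case
    using step.IH by (simp only: fmult_linear whitney_span_def span_add span_scale)
qed

lemma fmult_dbary_form_in_span:
  assumes "nondegenerate x N f" "q \<in> bary_polys x N f d"
    and "set \<tau> \<subseteq> vertex_indices x N f" "length \<tau> = k"
  shows "fmult q (dbary_form x N f \<tau>) \<in> whitney_span x N d k f"
proof -
  have "(\<Sum>j\<in>vertex_indices x N f. fmult q (whitney_list x N f (j # \<tau>))) \<in> whitney_span x N d k f"
    unfolding whitney_span_def
    by (intro span_sum fmult_whitney_list_in_span[unfolded whitney_span_def]) (use assms in auto)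
  then show ?thesis by (simp add: dbary_form_eq_sum_whitney[OF assms(1)] fmult_sum)
qed

text \<open>The expansion of an alternating map into determinants, applied at every point; the
  values on the fixed vectors \<open>e i\<close> are polynomials, which are then
  homogenised.\<close>

lemma poly_forms_expand:
  assumes f: "nondegenerate x N f" and \<omega>: "\<omega> \<in> poly_forms (int d) k f"
  shows "\<exists>q. (\<forall>\<tau>. q \<tau> \<in> bary_polys x N f d) \<and>
    \<omega> = (\<Sum>\<tau> | set \<tau> \<subseteq> vertex_indices x N f \<and> length \<tau> = k. fmult (q \<tau>) (dbary_form x N f \<tau>))"
proof -
  let ?I = "vertex_indices x N f"
  obtain i0 where i0: "i0 \<in> ?I" using f unfolding nondegenerate_def by auto
  \<comment> \<open>\<open>e i0\<close> is 0, so this family is not a basis. It reproduces a tangent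
    vector because its coordinates sum to 0, which cancels the base vertex.\<close>
  define e where "e i = x i - x i0" for i
  have vert: "x i \<in> affine hull f" if "i \<in> ?I" for i
    using that by (simp add: nondegenerate_affine_hull[OF f] hull_inc)
  have e: "e i \<in> tangent f" if "i \<in> ?I" for i
    unfolding e_def using that i0 by (intro diff_affine_hull_tangent vert)
  have D: "(\<Sum>i\<in>?I. hcoord x N f i (v, 0) *\<^sub>R e i) = v" if "v \<in> tangent f" for v
    using hcoord_expand_vector[OF f that]
    by (simp add: e_def scaleR_diff_right sum_subtractf flip: scaleR_sum_left)
  have "\<exists>q\<in>bary_polys x N f d. \<forall>y\<in>f. \<omega> y (map e \<tau>) / fact k = q y" for \<tau>
  proof -
    obtain p where p: "p \<in> polys (int d)" "\<forall>y\<in>f. \<omega> y (map e \<tau>) = p y"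
      using \<omega> unfolding poly_forms_def by blast
    have "(1 / fact k) *\<^sub>R p \<in> polys (int d)" using p by (intro subspace_scale) auto
    from polys_imp_bary_polys[OF f this] p(2) show ?thesis by (simp add: scaleR_fun_def)
  qed
  then obtain q where q: "\<And>\<tau>. q \<tau> \<in> bary_polys x N f d"
    "\<And>\<tau> y. y \<in> f \<Longrightarrow> \<omega> y (map e \<tau>) / fact k = q \<tau> y" by metis
  have "\<omega> y vs = (\<Sum>\<tau> | set \<tau> \<subseteq> ?I \<and> length \<tau> = k. fmult (q \<tau>) (dbary_form x N f \<tau>)) y vs" for y vs
  proof (cases "y \<in> f \<and> set vs \<subseteq> tangent f \<and> length vs = k")
    case True
    then have "alt_multilinear (tangent f) k (\<omega> y)" using \<omega> by (auto simp: poly_forms_def)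
    from alt_multilinear_eq_sum_wedge[OF this subspace_tangent finite_vertex_indices e D, of vs] True
    have "\<omega> y vs = (\<Sum>\<tau> | set \<tau> \<subseteq> ?I \<and> length \<tau> = k.
        \<omega> y (map e \<tau>) / fact k * wedge (map (\<lambda>i v. hcoord x N f i (v, 0)) \<tau>) vs)" by simp
    also have "\<dots> = (\<Sum>\<tau> | set \<tau> \<subseteq> ?I \<and> length \<tau> = k.
        q \<tau> y * wedge (map (hcoord x N f) \<tau>) (map (\<lambda>v. (v, 0)) vs))"
      using True by (intro sum.cong refl arg_cong2[where f = "(*)"] q wedge_cong) auto
    finally show ?thesis using True by (simp add: form_sum_apply fmult_def dbary_form_def)
  next
    case False
    have "\<omega> y vs = 0"
    proof (cases "y \<in> f")
      case True
      then have "alt_multilinear (tangent f) k (\<omega> y)" using \<omega> by (auto simp: poly_forms_def)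
      then show ?thesis using False True unfolding alt_multilinear_def by blast
    qed (use \<omega> in \<open>simp add: poly_forms_def\<close>)
    moreover have "dbary_form x N f \<tau> y vs = 0" if "length \<tau> = k" for \<tau>
      using False that by (auto simp: dbary_form_def wedge_length)
    ultimately show ?thesis by (simp add: form_sum_apply fmult_def)
  qed
  then show ?thesis using q(1) by blast
qed

lemma linear_on_subspace_hcoord: "linear_on_subspace V (\<lambda>v. hcoord x N f i (v, 0))"
  using hcoord_add[of x N f i "(_, 0)" "(_, 0)"] hcoord_scale[of x N f i _ "(_, 0)"]
  by (simp add: linear_on_subspace_def)

lemma fmult_dbary_form_poly_forms:
  assumes q: "q \<in> polys d" and "length \<tau> = k"
  shows "fmult q (dbary_form x N f \<tau>) \<in> poly_forms d k f"
proof -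
  let ?as = "map (\<lambda>i v. hcoord x N f i (v, 0)) \<tau>"
  have eq: "dbary_form x N f \<tau> y vs = (if set vs \<subseteq> tangent f then wedge ?as vs else 0)"
    if "y \<in> f" for y vs
    using that by (auto simp: dbary_form_def intro!: wedge_cong)
  have "alt_multilinear (tangent f) k (fmult q (dbary_form x N f \<tau>) y)" if "y \<in> f" for y
  proof -
    have "alt_multilinear (tangent f) (length ?as) (\<lambda>vs. if set vs \<subseteq> tangent f then wedge ?as vs else 0)"
      by (rule alt_multilinear_wedge) (auto intro: linear_on_subspace_hcoord)
    then have "alt_multilinear (tangent f) k (q y *\<^sub>R (\<lambda>vs. if set vs \<subseteq> tangent f then wedge ?as vs else 0))"
      using assms(2) by (intro alt_multilinear_closed) auto
    moreover have "fmult q (dbary_form x N f \<tau>) y = q y *\<^sub>R (\<lambda>vs. if set vs \<subseteq> tangent f then wedge ?as vs else 0)"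
      using eq[OF that] by (auto simp: fmult_def scaleR_fun_def fun_eq_iff)
    ultimately show ?thesis by simp
  qed
  moreover have "\<exists>p\<in>polys d. \<forall>y\<in>f. fmult q (dbary_form x N f \<tau>) y vs = p y" for vs
    using eq subspace_scale[OF subspace_polys q, of "if set vs \<subseteq> tangent f then wedge ?as vs else 0"]
    by (intro bexI) (auto simp: fmult_def scaleR_fun_def mult.commute)
  moreover have "fmult q (dbary_form x N f \<tau>) y = 0" if "y \<notin> f" for y
    using that by (auto simp: fmult_def dbary_form_def)
  ultimately show ?thesis by (simp add: poly_forms_def)
qed

text \<open>One identity serves both inclusions: \<open>koszul_dbary_form\<close> writes Koszul
  images through Whitney forms and products of differentials, where the products are themselves sums
  of Whitney forms; solved for the Whitney form, it exhibits each generator as a polynomial form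
  plus a Koszul image. The coefficient degree \<open>r - 1\<close> appears as
  \<open>d\<close>.\<close>

lemma poly_minus_forms_eq_whitney_span:
  assumes f: "nondegenerate x N f"
  shows "poly_minus_forms (Suc d) k f = whitney_span x N d k f"
proof -
  let ?I = "vertex_indices x N f"
  define z where "z = (SOME z. z \<in> affine hull f)"
  have "affine hull f \<noteq> {}"
    using f by (simp add: nondegenerate_affine_hull) (simp add: nondegenerate_def)
  then have z: "z \<in> affine hull f" unfolding z_def by (rule some_in_eq[THEN iffD2])
  have eq: "poly_minus_forms (Suc d) k f = {\<omega> + koszul z \<eta> |\<omega> \<eta>.
         \<omega> \<in> poly_forms (int d) k f \<and> \<eta> \<in> poly_forms (int d) (k + 1) f}"
    by (simp add: poly_minus_forms_def z_def Let_def)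
  have koszul_fmult: "koszul z (fmult q \<omega>) = fmult q (koszul z \<omega>)" for q \<omega>
    by (simp add: koszul_def fmult_def)
  have koszul_sum: "koszul z (\<Sum>i\<in>S. F i) = (\<Sum>i\<in>S. koszul z (F i))" for S :: "nat list set" and F
    by (simp add: koszul_def form_sum_apply fun_eq_iff)
  show ?thesis
  proof
    show "poly_minus_forms (Suc d) k f \<subseteq> whitney_span x N d k f"
    proof
      fix u assume "u \<in> poly_minus_forms (Suc d) k f"
      then obtain \<omega> \<eta> where u: "u = \<omega> + koszul z \<eta>" "\<omega> \<in> poly_forms (int d) k f"
        "\<eta> \<in> poly_forms (int d) (k + 1) f" unfolding eq by blast
      obtain p where p: "\<And>\<tau>. p \<tau> \<in> bary_polys x N f d"
        "\<omega> = (\<Sum>\<tau> | set \<tau> \<subseteq> ?I \<and> length \<tau> = k. fmult (p \<tau>) (dbary_form x N f \<tau>))"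
        using poly_forms_expand[OF f u(2)] by blast
      obtain q where q: "\<And>\<tau>. q \<tau> \<in> bary_polys x N f d"
        "\<eta> = (\<Sum>\<tau> | set \<tau> \<subseteq> ?I \<and> length \<tau> = k + 1. fmult (q \<tau>) (dbary_form x N f \<tau>))"
        using poly_forms_expand[OF f u(3)] by blast
      have \<omega>: "\<omega> \<in> whitney_span x N d k f"
        unfolding p(2) whitney_span_def
        by (intro span_sum fmult_dbary_form_in_span[OF f, unfolded whitney_span_def] p(1)) auto
      have "fmult (q \<tau>) (koszul z (dbary_form x N f \<tau>)) \<in> whitney_span x N d k f"
        if \<tau>: "set \<tau> \<subseteq> ?I" "length \<tau> = k + 1" for \<tau>
      proof -
        have "set (take i \<tau> @ drop (Suc i) \<tau>) \<subseteq> ?I" for i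
          using \<tau> set_take_subset[of i \<tau>] set_drop_subset[of "Suc i" \<tau>] by auto
        then show ?thesis
          unfolding koszul_dbary_form[OF z] fmult_linear fmult_sum whitney_span_def
          using \<tau>
          by (intro span_diff span_sum span_scale fmult_whitney_list_in_span[unfolded whitney_span_def]
              fmult_dbary_form_in_span[OF f, unfolded whitney_span_def] q(1)) auto
      qed
      then have "koszul z \<eta> \<in> whitney_span x N d k f"
        unfolding q(2) koszul_sum koszul_fmult whitney_span_def by (intro span_sum) auto
      then show "u \<in> whitney_span x N d k f"
        using \<omega> unfolding u(1) whitney_span_def by (intro span_add)
    qed
  next
    have "fmult (bary_monom x N f \<alpha>) (whitney_list x N f \<tau>) \<in> poly_minus_forms (Suc d) k f"
      if \<alpha>: "sum \<alpha> ?I = d" and \<tau>: "length \<tau> = Suc k" for \<alpha> \<tau>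
    proof -
      let ?m = "bary_monom x N f \<alpha>"
      let ?\<omega> = "\<Sum>i<length \<tau>. ((- 1) ^ i * hcoord x N f (\<tau> ! i) (z, 1)) *\<^sub>R
        fmult ?m (dbary_form x N f (take i \<tau> @ drop (Suc i) \<tau>))"
      let ?\<eta> = "fmult ?m (dbary_form x N f \<tau>)"
      have m: "?m \<in> polys (int d)" using bary_monom_polys[of x N f \<alpha>] \<alpha> by simp
      have "?\<omega> \<in> poly_forms (int d) k f"
        using \<tau> by (intro subspace_sum subspace_scale subspace_poly_forms
            fmult_dbary_form_poly_forms m) auto
      moreover have "?\<eta> \<in> poly_forms (int d) (k + 1) f"
        using \<tau> by (intro fmult_dbary_form_poly_forms m) auto
      moreover have "fmult ?m (whitney_list x N f \<tau>) = ?\<omega> + koszul z ?\<eta>"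
        unfolding koszul_fmult koszul_dbary_form[OF z] by (simp add: fmult_linear fmult_sum)
      ultimately show ?thesis unfolding eq by blast
    qed
    then show "whitney_span x N d k f \<subseteq> poly_minus_forms (Suc d) k f"
      unfolding whitney_span_def by (intro span_minimal subspace_poly_minus_forms) blast
  qed
qed

text \<open>Sorting changes a Whitney form by the sign of a permutation, and a repeated index
  annihilates it. The value 0 is a separate disjunct, since there may be no increasing map into the
  index set on which to use \<open>c = 0\<close>.\<close>

lemma whitney_list_increasing:
  assumes f: "nondegenerate x N f" and \<tau>: "set \<tau> \<subseteq> vertex_indices x N f" "length \<tau> = Suc k"
  shows "\<exists>c \<sigma>. strict_mono_on {0..k} \<sigma> \<and> \<sigma> ` {0..k} \<subseteq> vertex_indices x N f \<and>
    whitney_list x N f \<tau> = c *\<^sub>R whitney_list x N f (map \<sigma> [0..<Suc k]) \<or> whitney_list x N f \<tau> = 0"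
proof (cases "distinct \<tau>")
  case False
  then have "\<not> distinct (map (hcoord x N f) \<tau>)" by (simp add: distinct_map)
  then have "whitney_list x N f \<tau> = 0"
    by (intro ext) (simp add: whitney_list_def wedge_not_distinct_left)
  then show ?thesis by blast
next
  case True
  define \<rho> where "\<rho> = sort \<tau>"
  have \<rho>: "sorted_wrt (<) \<rho>" "length \<rho> = Suc k" "set \<rho> = set \<tau>"
    using True \<tau> by (simp_all add: \<rho>_def strict_sorted_iff)
  obtain p where p: "p permutes {..<length \<rho>}" "permute_list p \<rho> = \<tau>"
    using mset_eq_permutation[of \<tau> \<rho>] by (auto simp: \<rho>_def)
  have "map ((!) \<rho>) [0..<Suc k] = \<rho>" using \<rho>(2) map_nth by metis
  moreover have "map (hcoord x N f) \<tau> = map (\<lambda>i. map (hcoord x N f) \<rho> ! p i) [0..<length \<rho>]"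
    using permutes_in_image[OF p(1)] unfolding p(2)[symmetric] permute_list_def by simp
  then have "wedge (map (hcoord x N f) \<tau>) vs = of_int (sign p) * wedge (map (hcoord x N f) \<rho>) vs" for vs
    using wedge_permute_left[of p "map (hcoord x N f) \<rho>" vs] p(1) by simp
  then have "whitney_list x N f \<tau> = of_int (sign p) *\<^sub>R whitney_list x N f \<rho>"
    by (intro ext) (simp add: whitney_list_def form_apply_simps)
  moreover have "strict_mono_on {0..k} ((!) \<rho>)"
    using \<rho> by (auto simp: strict_mono_on_def sorted_wrt_iff_nth_less)
  moreover have "(!) \<rho> ` {0..k} \<subseteq> vertex_indices x N f"
    using \<rho> \<tau>(1) by auto
  ultimately show ?thesis by metis
qed

text \<open>These are exactly the generators in the definition of \<open>bary_ext\<close>, so a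
  linear map on the space is determined by its values on them.\<close>

lemma whitney_span_increasing:
  assumes f: "nondegenerate x N f"
  shows "whitney_span x N d k f \<subseteq> span {bary_whitney x N k (vertex_indices x N f) f \<alpha> \<sigma> |\<alpha> \<sigma>.
    sum \<alpha> (vertex_indices x N f) = d \<and> strict_mono_on {0..k} \<sigma> \<and> \<sigma> ` {0..k} \<subseteq> vertex_indices x N f}"
    (is "_ \<subseteq> span ?B")
  unfolding whitney_span_def
proof (intro span_minimal subspace_span subsetI)
  let ?I = "vertex_indices x N f"
  fix \<omega> assume "\<omega> \<in> {fmult (bary_monom x N f \<alpha>) (whitney_list x N f \<tau>) |\<alpha> \<tau>.
     sum \<alpha> ?I = d \<and> set \<tau> \<subseteq> ?I \<and> length \<tau> = Suc k}"
  then obtain \<alpha> \<tau> where \<omega>: "\<omega> = fmult (bary_monom x N f \<alpha>) (whitney_list x N f \<tau>)"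
    "sum \<alpha> ?I = d" "set \<tau> \<subseteq> ?I" "length \<tau> = Suc k" by blast
  show "\<omega> \<in> span ?B"
  proof (cases "whitney_list x N f \<tau> = 0")
    case True
    then have "\<omega> = 0" unfolding \<omega>(1) by (simp add: fmult_def fun_eq_iff)
    then show ?thesis by (simp only: span_zero)
  next
    case False
    then obtain c \<sigma> where \<sigma>: "strict_mono_on {0..k} \<sigma>" "\<sigma> ` {0..k} \<subseteq> ?I"
      "whitney_list x N f \<tau> = c *\<^sub>R whitney_list x N f (map \<sigma> [0..<Suc k])"
      using whitney_list_increasing[OF f \<omega>(3,4)] by blast
    have "bary_monom x N f (\<lambda>i. if i \<in> ?I then \<alpha> i else 0) = bary_monom x N f \<alpha>"
      by (simp add: bary_monom_def fun_eq_iff)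
    then have "\<omega> = c *\<^sub>R bary_whitney x N k ?I f \<alpha> \<sigma>"
      unfolding \<omega>(1) \<sigma>(3) bary_whitney_eq[OF f \<sigma>(2) subset_refl] by (simp only: fmult_linear)
    moreover have "bary_whitney x N k ?I f \<alpha> \<sigma> \<in> span ?B"
      using \<omega>(2) \<sigma>(1,2) by (intro span_base) blast
    ultimately show ?thesis by (simp only: span_scale)
  qed
qed

text \<open>There is no increasing map from \<open>k + 1\<close> indices into a smaller set, so the
  generating set is empty. This disposes of the boundary traces on faces of dimension below
  \<open>k\<close>.\<close>

lemma poly_minus_forms_low_dim:
  assumes f: "nondegenerate x N f" and "card (vertex_indices x N f) \<le> k"
    and "\<omega> \<in> poly_minus_forms (Suc d) k f"
  shows "\<omega> = 0"
proof -
  let ?I = "vertex_indices x N f"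
  have "\<not> (strict_mono_on {0..k} \<sigma> \<and> \<sigma> ` {0..k} \<subseteq> ?I)" for \<sigma> :: "nat \<Rightarrow> nat"
  proof
    assume \<sigma>: "strict_mono_on {0..k} \<sigma> \<and> \<sigma> ` {0..k} \<subseteq> ?I"
    then have "card {0..k} \<le> card ?I"
      by (intro card_inj_on_le[of \<sigma>] strict_mono_on_imp_inj_on) auto
    then show False using assms(2) by simp
  qed
  then have "{bary_whitney x N k ?I f \<alpha> \<sigma> |\<alpha> \<sigma>.
    sum \<alpha> ?I = d \<and> strict_mono_on {0..k} \<sigma> \<and> \<sigma> ` {0..k} \<subseteq> ?I} = {}" by blast
  then have "whitney_span x N d k f \<subseteq> {0}"
    using whitney_span_increasing[OF f, of d k] by (metis span_empty)
  then show ?thesis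
    using assms(3) poly_minus_forms_eq_whitney_span[OF f] by blast
qed

subsection \<open>Barycentric extension\<close>

lemma linear_on_subspaceD:
  assumes "linear_on_subspace V F" "u \<in> V"
  shows "F (c *\<^sub>R u) = c *\<^sub>R F u" and "w \<in> V \<Longrightarrow> F (u + w) = F u + F w"
  using assms by (auto simp: linear_on_subspace_def)

text \<open>Column operations: \<open>X\<close> is itself an argument, so multiples of it may be
  subtracted from the others. The prefix \<open>us\<close> holds the arguments already restored.
  With the radial vector as \<open>X\<close> this eliminates the differential of the weight.\<close>

lemma wedge_shear:
  assumes "\<And>a. a \<in> set as \<Longrightarrow> linear_on_subspace UNIV a"
  shows "wedge as (X # us @ map (\<lambda>p. p - t p *\<^sub>R X) ws) = wedge as (X # us @ ws)"
proof (induction ws arbitrary: us)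
  case (Cons w ws)
  let ?ws = "map (\<lambda>p. p - t p *\<^sub>R X) ws"
  have lin: "linear_on_subspace UNIV (\<lambda>v. wedge as ((X # us) @ v # ?ws))"
    using assms by (rule linear_on_subspace_wedge)
  have "wedge as ((X # us) @ (w + (- t w) *\<^sub>R X) # ?ws) =
      wedge as ((X # us) @ w # ?ws) + (- t w) *\<^sub>R wedge as ((X # us) @ X # ?ws)"
    using linear_on_subspaceD(2)[OF lin, of w "(- t w) *\<^sub>R X"] linear_on_subspaceD(1)[OF lin, of X "- t w"]
    by simp
  moreover have "wedge as ((X # us) @ X # ?ws) = 0"
    by (rule wedge_not_distinct_right) simp
  ultimately show ?case
    using Cons.IH[of "us @ [w]"] by simp
qed simp

text \<open>On a simplex \<open>g\<close> containing \<open>f\<close> the barycentric extension of \<open>\<omega>\<close> is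
  \<open>s\<^sup>r\<^sup>+\<^sup>k \<pi>\<^sup>*\<omega>\<close>, where \<open>s\<close> is the sum of the coordinates belonging to \<open>f\<close> and \<open>\<pi>\<close> the projection onto
  \<open>f\<close> from the opposite face. The map \<open>face_dproj\<close> is \<open>s d\<pi>\<close> and absorbs \<open>k\<close> of the factors \<open>s\<close>.
  Where \<open>s = 0\<close> the projection is a junk value, but the extension vanishes there since \<open>r \<ge> 1\<close>.\<close>

definition face_weight :: "(nat \<Rightarrow> 'a::euclidean_space) \<Rightarrow> nat \<Rightarrow> 'a set \<Rightarrow> 'a set \<Rightarrow> 'a \<Rightarrow> real" where
  "face_weight x N f g y = (\<Sum>i\<in>vertex_indices x N f. hcoord x N g i (y, 1))"

definition face_proj :: "(nat \<Rightarrow> 'a::euclidean_space) \<Rightarrow> nat \<Rightarrow> 'a set \<Rightarrow> 'a set \<Rightarrow> 'a \<Rightarrow> 'a" where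
  "face_proj x N f g y =
    (\<Sum>i\<in>vertex_indices x N f. (hcoord x N g i (y, 1) / face_weight x N f g y) *\<^sub>R x i)"

text \<open>Quotient rule: differentiating the weights \<open>hcoord / s\<close> in
  \<open>face_proj\<close> and multiplying by \<open>s\<close>, the part coming from the
  differential of \<open>s\<close> combines to the projected point, which is why it is subtracted
  from every vertex.\<close>

definition face_dproj :: "(nat \<Rightarrow> 'a::euclidean_space) \<Rightarrow> nat \<Rightarrow> 'a set \<Rightarrow> 'a set \<Rightarrow> 'a \<Rightarrow> 'a \<Rightarrow> 'a" where
  "face_dproj x N f g y v =
    (\<Sum>i\<in>vertex_indices x N f. hcoord x N g i (v, 0) *\<^sub>R (x i - face_proj x N f g y))"

definition face_ext ::
    "(nat \<Rightarrow> 'a::euclidean_space) \<Rightarrow> nat \<Rightarrow> nat \<Rightarrow> 'a set \<Rightarrow> 'a set \<Rightarrow> 'a form \<Rightarrow> 'a form" where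
  "face_ext x N r f g \<omega> = (\<lambda>y vs. if y \<in> g \<and> set vs \<subseteq> tangent g
     then face_weight x N f g y ^ r * \<omega> (face_proj x N f g y) (map (face_dproj x N f g y) vs) else 0)"

lemma face_ext_linear:
  "face_ext x N r f g (\<omega> + \<eta>) = face_ext x N r f g \<omega> + face_ext x N r f g \<eta>"
  "face_ext x N r f g (c *\<^sub>R \<omega>) = c *\<^sub>R face_ext x N r f g \<omega>"
  "face_ext x N r f g 0 = 0"
  by (simp_all add: face_ext_def fun_eq_iff scaleR_fun_def algebra_simps)

lemma linear_on_subspace_linear: "linear h \<Longrightarrow> linear_on_subspace V h"
  by (simp add: linear_on_subspace_def linear_add linear_scale)

text \<open>Every term of the contraction with \<open>(y, 1)\<close> carries one undifferentiated
  coordinate at \<open>y\<close>. Needed where the weight is 0.\<close>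

lemma whitney_list_zero:
  assumes "\<And>i. i \<in> set \<tau> \<Longrightarrow> hcoord x N g i (y, 1) = 0"
  shows "whitney_list x N g \<tau> y vs = 0"
proof -
  have "wedge (map (hcoord x N g) \<tau>) ((y, 1) # ws) = 0" for ws
    unfolding wedge_Cons_right by (rule sum.neutral) (simp add: assms)
  then show ?thesis by (simp add: whitney_list_def)
qed

context
  fixes x :: "nat \<Rightarrow> 'a::euclidean_space" and N :: nat and f g :: "'a set"
  assumes f: "nondegenerate x N f" and g: "nondegenerate x N g"
    and sub: "vertex_indices x N f \<subseteq> vertex_indices x N g"
begin

text \<open>The coordinates are nonnegative on \<open>g\<close>, so division by their sum gives a
  convex combination of the vertices of \<open>f\<close>.\<close>

lemma face_proj_mem:
  assumes y: "y \<in> g" and s: "face_weight x N f g y \<noteq> 0"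
  shows "face_proj x N f g y \<in> f"
    and "j \<in> vertex_indices x N f \<Longrightarrow>
      hcoord x N f j (face_proj x N f g y, 1) = hcoord x N g j (y, 1) / face_weight x N f g y"
proof -
  let ?I = "vertex_indices x N f" and ?s = "face_weight x N f g y"
  have nonneg: "0 \<le> hcoord x N g i (y, 1)" if "i \<in> ?I" for i
    using hcoord_nonneg[OF g y] that sub by auto
  then have "0 \<le> ?s" unfolding face_weight_def by (rule sum_nonneg)
  moreover have sum1: "(\<Sum>i\<in>?I. hcoord x N g i (y, 1) / ?s) = 1"
    using s by (simp add: face_weight_def flip: sum_divide_distrib)
  ultimately show "face_proj x N f g y \<in> f"
    unfolding face_proj_def by (intro nondegenerate_memI[OF f]) (use nonneg in auto)
  assume j: "j \<in> ?I"
  have "(face_proj x N f g y, 1) = (\<Sum>i\<in>?I. (hcoord x N g i (y, 1) / ?s) *\<^sub>R (x i, 1::real))"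
    using sum1 by (simp add: face_proj_def prod_eq_iff fst_sum snd_sum)
  then have "hcoord x N f j (face_proj x N f g y, 1) =
      (\<Sum>i\<in>?I. (hcoord x N g i (y, 1) / ?s) *\<^sub>R hcoord x N f j (x i, 1))"
    by (simp only: hcoord_sum hcoord_scale)
  also have "\<dots> = (\<Sum>i\<in>?I. if i = j then hcoord x N g i (y, 1) / ?s else 0)"
    using hcoord_vertex[OF f j] by (intro sum.cong) auto
  finally show "hcoord x N f j (face_proj x N f g y, 1) = hcoord x N g j (y, 1) / ?s"
    using j by simp
qed

text \<open>\<open>face_weight\<close> is affine, so its value at \<open>v\<close> minus its value
  at 0 is its differential along \<open>v\<close>. In coordinates the map \<open>face_dproj\<close>
  thus sends \<open>v\<close> to \<open>(v, 0)\<close> minus a multiple of the radial vector, the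
  form required by \<open>wedge_shear\<close>.\<close>

lemma face_dproj_mem:
  assumes y: "y \<in> g" and s: "face_weight x N f g y \<noteq> 0"
  shows "face_dproj x N f g y v \<in> tangent f"
    and "j \<in> vertex_indices x N f \<Longrightarrow> hcoord x N f j (face_dproj x N f g y v, 0) =
      hcoord x N g j ((v, 0) - (face_weight x N f g v / face_weight x N f g y -
        face_weight x N f g 0 / face_weight x N f g y) *\<^sub>R (y, 1))"
proof -
  let ?I = "vertex_indices x N f" and ?s = "face_weight x N f g y" and ?p = "face_proj x N f g y"
  have vert: "x i \<in> affine hull f" if "i \<in> ?I" for i
    using that by (simp add: nondegenerate_affine_hull[OF f] hull_inc)
  show "face_dproj x N f g y v \<in> tangent f"
    unfolding face_dproj_def
    by (intro subspace_sum subspace_scale subspace_tangent diff_affine_hull_tangent vert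
        hull_inc face_proj_mem(1)[OF y s])
  assume j: "j \<in> ?I"
  have t: "face_weight x N f g v - face_weight x N f g 0 = (\<Sum>i\<in>?I. hcoord x N g i (v, 0))"
    unfolding face_weight_def sum_subtractf[symmetric]
    by (intro sum.cong) (simp_all flip: hcoord_diff)
  have "(face_dproj x N f g y v, 0) = (\<Sum>i\<in>?I. hcoord x N g i (v, 0) *\<^sub>R ((x i, 1) - (?p, 1::real)))"
    by (simp add: face_dproj_def prod_eq_iff fst_sum snd_sum)
  then have "hcoord x N f j (face_dproj x N f g y v, 0) =
      (\<Sum>i\<in>?I. hcoord x N g i (v, 0) *\<^sub>R (hcoord x N f j (x i, 1) - hcoord x N f j (?p, 1)))"
    by (simp only: hcoord_sum hcoord_scale hcoord_diff)
  also have "\<dots> = (\<Sum>i\<in>?I. (if i = j then hcoord x N g i (v, 0) else 0) -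
      hcoord x N g i (v, 0) * (hcoord x N g j (y, 1) / ?s))"
    using hcoord_vertex[OF f j] face_proj_mem(2)[OF y s j] by (intro sum.cong) (auto simp: algebra_simps)
  also have "\<dots> = hcoord x N g j (v, 0) -
      (\<Sum>i\<in>?I. hcoord x N g i (v, 0)) * (hcoord x N g j (y, 1) / ?s)"
    using j by (simp add: sum_subtractf sum_distrib_right sum_divide_distrib)
  also have "\<dots> = hcoord x N g j (v, 0) - ((face_weight x N f g v - face_weight x N f g 0) / ?s) *
      hcoord x N g j (y, 1)"
    by (simp add: t)
  finally show "hcoord x N f j (face_dproj x N f g y v, 0) =
      hcoord x N g j ((v, 0) - (face_weight x N f g v / ?s - face_weight x N f g 0 / ?s) *\<^sub>R (y, 1))"
    by (simp only: hcoord_diff hcoord_scale real_scaleR_def diff_divide_distrib)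
qed

text \<open>The homogeneity argument: projection divides the monomial by \<open>s ^ d\<close> and
  the radial argument by \<open>s\<close>, which the weight \<open>s ^ Suc d\<close> cancels, while
  the tangential arguments change only by multiples of the radial vector.\<close>

lemma face_ext_whitney:
  assumes \<alpha>: "sum \<alpha> (vertex_indices x N f) = d" and \<tau>: "set \<tau> \<subseteq> vertex_indices x N f"
  shows "face_ext x N (Suc d) f g (fmult (bary_monom x N f \<alpha>) (whitney_list x N f \<tau>)) =
    fmult (bary_monom x N g (\<lambda>i. if i \<in> vertex_indices x N f then \<alpha> i else 0)) (whitney_list x N g \<tau>)"
proof (intro ext)
  fix y :: 'a and vs :: "'a list"
  let ?I = "vertex_indices x N f" and ?s = "face_weight x N f g y" and ?p = "face_proj x N f g y"
  let ?L = "face_dproj x N f g y" and ?\<beta> = "\<lambda>i. if i \<in> vertex_indices x N f then \<alpha> i else 0"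
  show "face_ext x N (Suc d) f g (fmult (bary_monom x N f \<alpha>) (whitney_list x N f \<tau>)) y vs =
    fmult (bary_monom x N g ?\<beta>) (whitney_list x N g \<tau>) y vs"
  proof (cases "y \<in> g \<and> set vs \<subseteq> tangent g")
    case False
    then have "whitney_list x N g \<tau> y vs = 0" by (auto simp: whitney_list_def)
    then show ?thesis using False by (simp only: face_ext_def fmult_def) simp
  next
    case True
    then have y: "y \<in> g" by simp
    show ?thesis
    proof (cases "?s = 0")
      case s: True
      \<comment> \<open>A vanishing sum of nonnegative coordinates. Here the left side is 0 through
        the positive power of the weight, and the right side because all its coordinates are
        0.\<close>
      have "hcoord x N g i (y, 1) = 0" if "i \<in> ?I" for i
        using s that hcoord_nonneg[OF g y] sub unfolding face_weight_def
        by (subst (asm) sum_nonneg_eq_0_iff) auto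
      then have "whitney_list x N g \<tau> y vs = 0" using \<tau> by (intro whitney_list_zero) auto
      then show ?thesis using s by (simp add: face_ext_def fmult_def)
    next
      case s: False
      let ?hf = "map (hcoord x N f) \<tau>" and ?hg = "map (hcoord x N g) \<tau>"
      \<comment> \<open>At \<open>(v, 0)\<close> this is the differential of the weight along
        \<open>v\<close>, divided by \<open>s\<close>: the multiple of \<open>(y, 1)\<close> to be
        sheared off.\<close>
      define t where "t p = (face_weight x N f g (fst p) / ?s - face_weight x N f g 0 / ?s)" for p :: "'a \<times> real"
      have \<tau>j: "\<tau> ! i \<in> ?I" if "i < length \<tau>" for i using \<tau> that by auto
      have "wedge ?hf ((?p, 1) # map (\<lambda>v. (v, 0)) (map ?L vs)) =
          wedge ?hg ([] @ ((1 / ?s) *\<^sub>R (y, 1)) # map (\<lambda>p. p - t p *\<^sub>R (y, 1)) (map (\<lambda>v. (v, 0)) vs))"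
      proof (rule wedge_cong)
        fix i j assume i: "i < length ?hf" and j: "j < length ((?p, 1::real) # map (\<lambda>v. (v, 0)) (map ?L vs))"
        show "(?hf ! i) (((?p, 1) # map (\<lambda>v. (v, 0)) (map ?L vs)) ! j) =
          (?hg ! i) (([] @ ((1 / ?s) *\<^sub>R (y, 1)) # map (\<lambda>p. p - t p *\<^sub>R (y, 1)) (map (\<lambda>v. (v, 0)) vs)) ! j)"
        proof (cases j)
          case 0
          have "hcoord x N g (\<tau> ! i) ((1 / ?s) *\<^sub>R (y, 1)) = (1 / ?s) * hcoord x N g (\<tau> ! i) (y, 1)"
            by (simp only: hcoord_scale real_scaleR_def)
          then show ?thesis
            using 0 i face_proj_mem(2)[OF y s \<tau>j[of i]] by simp
        next
          case (Suc m)
          then show ?thesis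
            using i j face_dproj_mem(2)[OF y s \<tau>j[of i], of "vs ! m"] by (simp add: t_def)
        qed
      qed simp_all
      also have "\<dots> = (1 / ?s) *\<^sub>R wedge ?hg ([] @ (y, 1) # map (\<lambda>p. p - t p *\<^sub>R (y, 1)) (map (\<lambda>v. (v, 0)) vs))"
      proof -
        have "linear_on_subspace UNIV (\<lambda>v. wedge ?hg ([] @ v # map (\<lambda>p. p - t p *\<^sub>R (y, 1)) (map (\<lambda>v. (v, 0)) vs)))"
          by (intro linear_on_subspace_wedge) (auto intro!: linear_on_subspace_linear linear_hcoord)
        from linear_on_subspaceD(1)[OF this UNIV_I] show ?thesis .
      qed
      also have "\<dots> = (1 / ?s) *\<^sub>R wedge ?hg ((y, 1) # map (\<lambda>v. (v, 0)) vs)"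
        using wedge_shear[of ?hg "(y, 1)" "[]" t "map (\<lambda>v. (v, 0)) vs"]
        by (auto intro!: linear_on_subspace_linear linear_hcoord simp del: map_map)
      finally have W: "whitney_list x N f \<tau> ?p (map ?L vs) = whitney_list x N g \<tau> y vs / ?s"
        using True face_proj_mem(1)[OF y s] face_dproj_mem(1)[OF y s]
        by (auto simp: whitney_list_def image_subset_iff)
      have "bary_monom x N g ?\<beta> y = (\<Prod>i\<in>?I. hcoord x N g i (y, 1) ^ \<alpha> i)"
        unfolding bary_monom_def using sub by (intro prod.mono_neutral_cong_right) auto
      moreover have "bary_monom x N f \<alpha> ?p = (\<Prod>i\<in>?I. hcoord x N g i (y, 1) ^ \<alpha> i / ?s ^ \<alpha> i)"
        unfolding bary_monom_def using face_proj_mem(2)[OF y s]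
        by (intro prod.cong) (simp_all add: power_divide)
      \<comment> \<open>Together with the factor \<open>1 / s\<close> in \<open>W\<close> this
        accounts for the full power \<open>Suc d\<close>.\<close>
      ultimately have M: "bary_monom x N f \<alpha> ?p = bary_monom x N g ?\<beta> y / ?s ^ d"
        using \<alpha> by (simp add: prod_dividef flip: power_sum)
      show ?thesis
        using True s by (simp add: face_ext_def fmult_def W M)
    qed
  qed
qed

lemma face_ext_poly_minus:
  assumes "\<omega> \<in> poly_minus_forms (Suc d) k f"
  shows "face_ext x N (Suc d) f g \<omega> \<in> poly_minus_forms (Suc d) k g"
  using assms unfolding poly_minus_forms_eq_whitney_span[OF f] poly_minus_forms_eq_whitney_span[OF g]
  unfolding whitney_span_def[of x N d k f]
proof (induction rule: span_induct_alt)
  case base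
  show ?case by (simp only: face_ext_linear whitney_span_def span_zero)
next
  case (step c \<omega> \<eta>)
  then obtain \<alpha> \<tau> where \<omega>: "\<omega> = fmult (bary_monom x N f \<alpha>) (whitney_list x N f \<tau>)"
    "sum \<alpha> (vertex_indices x N f) = d" "set \<tau> \<subseteq> vertex_indices x N f" "length \<tau> = Suc k" by blast
  have "(\<Sum>i\<in>vertex_indices x N g. if i \<in> vertex_indices x N f then \<alpha> i else 0) = d"
    using sub \<omega>(2) by (simp add: sum.If_cases Int_absorb1 Int_absorb2)
  then have "face_ext x N (Suc d) f g \<omega> \<in> whitney_span x N d k g"
    unfolding \<omega>(1) face_ext_whitney[OF \<omega>(2,3)] whitney_span_def
    using sub \<omega>(3,4) by (intro span_base) blast
  then show ?case
    using step.IH by (simp only: face_ext_linear whitney_span_def span_add span_scale)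
qed

text \<open>Resolves the description operator in \<open>bary_ext\<close>. Existence comes from
  \<open>face_ext\<close>, whose linearity is built in, so relations among the generators never
  enter; uniqueness holds because the increasing generators span.\<close>

lemma bary_ext_eq:
  "bary_ext x N (Suc d) k f g =
    (\<lambda>\<omega>. if \<omega> \<in> poly_minus_forms (Suc d) k f then face_ext x N (Suc d) f g \<omega> else 0)" (is "_ = ?E")
  unfolding bary_ext_def
proof (rule the_equality)
  let ?I = "vertex_indices x N f"
  note V = subspace_poly_minus_forms[of "Suc d" k f]
  have gen: "bary_whitney x N k ?I f \<alpha> \<sigma> \<in> poly_minus_forms (Suc d) k f"
    and gen_ext: "face_ext x N (Suc d) f g (bary_whitney x N k ?I f \<alpha> \<sigma>) = bary_whitney x N k ?I g \<alpha> \<sigma>"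
    if "sum \<alpha> ?I = d" "\<sigma> ` {0..k} \<subseteq> ?I" for \<alpha> \<sigma>
  proof -
    let ?\<beta> = "\<lambda>i. if i \<in> ?I then \<alpha> i else 0"
    have \<beta>: "sum ?\<beta> ?I = d" "set (map \<sigma> [0..<Suc k]) \<subseteq> ?I"
      using that by (auto simp: image_subset_iff simp del: upt_Suc)
    show "bary_whitney x N k ?I f \<alpha> \<sigma> \<in> poly_minus_forms (Suc d) k f"
      unfolding poly_minus_forms_eq_whitney_span[OF f] whitney_span_def
        bary_whitney_eq[OF f that(2) subset_refl]
      using \<beta> by (intro span_base CollectI exI[of _ ?\<beta>] exI[of _ "map \<sigma> [0..<Suc k]"] conjI refl)
        (simp_all del: upt_Suc)
    show "face_ext x N (Suc d) f g (bary_whitney x N k ?I f \<alpha> \<sigma>) = bary_whitney x N k ?I g \<alpha> \<sigma>"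
      using that(2) sub
      by (subst bary_whitney_eq[OF f that(2) subset_refl], subst bary_whitney_eq[OF g _ sub],
          simp, subst face_ext_whitney[OF \<beta>]) (simp add: if_distrib cong: if_cong)
  qed
  show "(\<forall>\<omega>\<in>poly_minus_forms (Suc d) k f. ?E \<omega> \<in> poly_minus_forms (Suc d) k g) \<and>
     linear_on_subspace (poly_minus_forms (Suc d) k f) ?E \<and>
     (\<forall>\<alpha> \<sigma>. (\<Sum>i\<in>?I. \<alpha> i) + 1 = Suc d \<and>
        strict_mono_on {0..k} \<sigma> \<and> \<sigma> ` {0..k} \<subseteq> ?I \<longrightarrow>
        ?E (bary_whitney x N k ?I f \<alpha> \<sigma>) = bary_whitney x N k ?I g \<alpha> \<sigma>) \<and>
     (\<forall>\<omega>. \<omega> \<notin> poly_minus_forms (Suc d) k f \<longrightarrow> ?E \<omega> = 0)"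
    using face_ext_poly_minus subspace_add[OF V] subspace_scale[OF V] gen gen_ext
    by (simp add: linear_on_subspace_def face_ext_linear)
  fix E
  assume E: "(\<forall>\<omega>\<in>poly_minus_forms (Suc d) k f. E \<omega> \<in> poly_minus_forms (Suc d) k g) \<and>
     linear_on_subspace (poly_minus_forms (Suc d) k f) E \<and>
     (\<forall>\<alpha> \<sigma>. (\<Sum>i\<in>?I. \<alpha> i) + 1 = Suc d \<and>
        strict_mono_on {0..k} \<sigma> \<and> \<sigma> ` {0..k} \<subseteq> ?I \<longrightarrow>
        E (bary_whitney x N k ?I f \<alpha> \<sigma>) = bary_whitney x N k ?I g \<alpha> \<sigma>) \<and>
     (\<forall>\<omega>. \<omega> \<notin> poly_minus_forms (Suc d) k f \<longrightarrow> E \<omega> = 0)"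
  define B where "B = {bary_whitney x N k ?I f \<alpha> \<sigma> |\<alpha> \<sigma>.
    sum \<alpha> ?I = d \<and> strict_mono_on {0..k} \<sigma> \<and> \<sigma> ` {0..k} \<subseteq> ?I}"
  have B: "B \<subseteq> poly_minus_forms (Suc d) k f" unfolding B_def using gen by blast
  have lin: "E (u + w) = E u + E w" "E (c *\<^sub>R u) = c *\<^sub>R E u"
    if "u \<in> poly_minus_forms (Suc d) k f" "w \<in> poly_minus_forms (Suc d) k f" for u w c
    using E that unfolding linear_on_subspace_def by blast+
  have EB: "E \<omega> = face_ext x N (Suc d) f g \<omega>" if "\<omega> \<in> B" for \<omega>
    using that E gen_ext unfolding B_def by force
  have "\<omega> \<in> poly_minus_forms (Suc d) k f \<and> E \<omega> = face_ext x N (Suc d) f g \<omega>" if "\<omega> \<in> span B" for \<omega>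
    using that
  proof (induction rule: span_induct_alt)
    case base
    have "E (0 *\<^sub>R 0) = 0 *\<^sub>R E 0" using lin(2) subspace_0[OF V] by blast
    then show ?case using subspace_0[OF V] by (simp only: face_ext_linear scaleR_zero_left simp_thms)
  next
    case (step c u w)
    have u: "u \<in> poly_minus_forms (Suc d) k f" using step B by blast
    then have cu: "c *\<^sub>R u \<in> poly_minus_forms (Suc d) k f" by (rule subspace_scale[OF V])
    have "E (c *\<^sub>R u + w) = c *\<^sub>R E u + E w" using lin(1)[OF cu] lin(2)[OF u u] step.IH by metis
    then show ?case
      using step EB[of u] subspace_add[OF V cu] by (simp only: face_ext_linear simp_thms)
  qed
  then have "E \<omega> = face_ext x N (Suc d) f g \<omega>" if "\<omega> \<in> poly_minus_forms (Suc d) k f" for \<omega>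
    using that whitney_span_increasing[OF f, of d k]
    unfolding poly_minus_forms_eq_whitney_span[OF f] B_def by blast
  then show "E = ?E"
    using E by (intro ext) simp
qed

end

subsection \<open>Traces\<close>

lemma trace_form_linear:
  "trace_form f (\<omega> + \<eta>) = trace_form f \<omega> + trace_form f \<eta>"
  "trace_form f (c *\<^sub>R \<omega>) = c *\<^sub>R trace_form f \<omega>"
  "trace_form f 0 = 0"
  by (simp_all add: trace_form_def fun_eq_iff scaleR_fun_def)

lemma trace_form_trace_form: "e \<subseteq> f \<Longrightarrow> trace_form e (trace_form f \<omega>) = trace_form e \<omega>"
  using tangent_mono[of e f] by (auto simp: trace_form_def fun_eq_iff)

text \<open>For \<open>g = f\<close> the formula on generators returns each generator, as the
  padding of its exponents is then without effect.\<close>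

lemma face_ext_self:
  assumes f: "nondegenerate x N f" and "\<omega> \<in> poly_minus_forms (Suc d) k f"
  shows "face_ext x N (Suc d) f f \<omega> = \<omega>"
  using assms(2) unfolding poly_minus_forms_eq_whitney_span[OF f] whitney_span_def
proof (induction rule: span_induct_alt)
  case base
  show ?case by (simp only: face_ext_linear)
next
  case (step c \<omega> \<eta>)
  then obtain \<alpha> \<tau> where \<omega>: "\<omega> = fmult (bary_monom x N f \<alpha>) (whitney_list x N f \<tau>)"
    "sum \<alpha> (vertex_indices x N f) = d" "set \<tau> \<subseteq> vertex_indices x N f" "length \<tau> = Suc k" by blast
  have "bary_monom x N f (\<lambda>i. if i \<in> vertex_indices x N f then \<alpha> i else 0) = bary_monom x N f \<alpha>"
    by (simp add: bary_monom_def fun_eq_iff)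
  then have "face_ext x N (Suc d) f f \<omega> = \<omega>"
    unfolding \<omega>(1) face_ext_whitney[OF f f subset_refl \<omega>(2,3)] by (simp only:)
  then show ?case using step.IH by (simp only: face_ext_linear)
qed

text \<open>A form of the space is its own extension, and \<open>face_ext\<close> is by construction
  0 at points off \<open>f\<close> and at vectors not tangent to \<open>f\<close>.\<close>

lemma trace_form_self:
  assumes f: "nondegenerate x N f" and "\<omega> \<in> poly_minus_forms (Suc d) k f"
  shows "trace_form f \<omega> = \<omega>"
proof -
  have "trace_form f (face_ext x N (Suc d) f f \<omega>) = face_ext x N (Suc d) f f \<omega>"
    by (auto simp: trace_form_def face_ext_def fun_eq_iff)
  then show ?thesis using face_ext_self[OF assms] by (simp only:)
qed

context
  fixes x :: "nat \<Rightarrow> 'a::euclidean_space" and N :: nat and e g :: "'a set"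
  assumes e: "nondegenerate x N e" and g: "nondegenerate x N g"
    and sub: "vertex_indices x N e \<subseteq> vertex_indices x N g"
begin

text \<open>A vertex outside \<open>e\<close> that occurs in the index list, or with positive
  exponent in the monomial, makes the trace 0; otherwise the trace is the generator of
  \<open>e\<close> with the same data.\<close>

lemma trace_form_whitney:
  assumes \<alpha>: "sum \<alpha> (vertex_indices x N g) = d" and \<tau>: "set \<tau> \<subseteq> vertex_indices x N g" "length \<tau> = Suc k"
  shows "trace_form e (fmult (bary_monom x N g \<alpha>) (whitney_list x N g \<tau>)) \<in> whitney_span x N d k e"
proof -
  let ?I = "vertex_indices x N e" and ?J = "vertex_indices x N g"
  have eg: "e \<subseteq> g" "tangent e \<subseteq> tangent g"
    using nondegenerate_subset[OF e g sub] tangent_mono by auto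
  have restrict: "hcoord x N g i (y, 1) = (if i \<in> ?I then hcoord x N e i (y, 1) else 0)"
    "v \<in> tangent e \<Longrightarrow> hcoord x N g i (v, 0) = (if i \<in> ?I then hcoord x N e i (v, 0) else 0)"
    if "i \<in> ?J" "y \<in> e" for i y v
    using that hcoord_restrict[OF e g sub] hspace_point[OF e hull_inc] hspace_vector[OF e] by auto
  have wh: "whitney_list x N g \<tau> y vs = (if set \<tau> \<subseteq> ?I then whitney_list x N e \<tau> y vs else 0)"
    if y: "y \<in> e" and vs: "set vs \<subseteq> tangent e" for y vs
  proof (cases "set \<tau> \<subseteq> ?I")
    case True
    have "wedge (map (hcoord x N g) \<tau>) ((y, 1) # map (\<lambda>v. (v, 0)) vs) =
        wedge (map (hcoord x N e) \<tau>) ((y, 1) # map (\<lambda>v. (v, 0)) vs)"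
    proof (rule wedge_cong)
      fix i j assume i: "i < length (map (hcoord x N g) \<tau>)" and j: "j < length ((y, 1::real) # map (\<lambda>v. (v, 0)) vs)"
      have "\<tau> ! i \<in> set \<tau>" using i by simp
      then have "\<tau> ! i \<in> ?I" "\<tau> ! i \<in> ?J" using True sub by auto
      then show "(map (hcoord x N g) \<tau> ! i) (((y, 1) # map (\<lambda>v. (v, 0)) vs) ! j) =
        (map (hcoord x N e) \<tau> ! i) (((y, 1) # map (\<lambda>v. (v, 0)) vs) ! j)"
      proof (cases j)
        case (Suc m)
        then have "vs ! m \<in> tangent e" using j vs by auto
        then show ?thesis using Suc i j y restrict(2)[of "\<tau> ! i" y "vs ! m"] \<open>\<tau> ! i \<in> ?I\<close> \<open>\<tau> ! i \<in> ?J\<close>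
          by simp
      qed (use i y restrict(1) \<open>\<tau> ! i \<in> ?I\<close> \<open>\<tau> ! i \<in> ?J\<close> in simp)
    qed simp_all
    then show ?thesis using True y vs eg by (auto simp: whitney_list_def)
  next
    case False
    then obtain i where i: "i \<in> set \<tau>" "i \<notin> ?I" "i \<in> ?J" using \<tau> by auto
    have "wedge (map (hcoord x N g) \<tau>) ((y, 1) # map (\<lambda>v. (v, 0)) vs) = 0"
      using i y vs restrict by (intro wedge_zero_left[of "hcoord x N g i"]) auto
    then show ?thesis using False by (simp add: whitney_list_def)
  qed
  show ?thesis
  proof (cases "set \<tau> \<subseteq> ?I \<and> (\<forall>i\<in>?J - ?I. \<alpha> i = 0)")
    case True
    have "bary_monom x N g \<alpha> y = bary_monom x N e \<alpha> y" if "y \<in> e" for y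
      unfolding bary_monom_def using True sub restrict that by (intro prod.mono_neutral_cong_right) auto
    then have "trace_form e (fmult (bary_monom x N g \<alpha>) (whitney_list x N g \<tau>)) =
        fmult (bary_monom x N e \<alpha>) (whitney_list x N e \<tau>)"
      using wh True by (auto simp: fun_eq_iff trace_form_def fmult_def whitney_list_def)
    moreover have "sum \<alpha> ?I = d"
      using \<alpha> True sub by (subst sum.mono_neutral_left[of ?J]) auto
    ultimately show ?thesis
      unfolding whitney_span_def using True \<tau>(2) by (intro span_base) blast
  next
    case False
    have "bary_monom x N g \<alpha> y = 0" if "y \<in> e" "i \<in> ?J - ?I" "\<alpha> i \<noteq> 0" for y i
      unfolding bary_monom_def using restrict that by (intro prod_zero) auto
    then have "trace_form e (fmult (bary_monom x N g \<alpha>) (whitney_list x N g \<tau>)) = 0"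
      using wh False by (auto simp: fun_eq_iff trace_form_def fmult_def)
    then show ?thesis unfolding whitney_span_def by (simp only: span_zero)
  qed
qed

lemma trace_form_poly_minus:
  assumes "\<omega> \<in> poly_minus_forms (Suc d) k g"
  shows "trace_form e \<omega> \<in> poly_minus_forms (Suc d) k e"
  using assms unfolding poly_minus_forms_eq_whitney_span[OF e] poly_minus_forms_eq_whitney_span[OF g]
  unfolding whitney_span_def[of x N d k g]
proof (induction rule: span_induct_alt)
  case base
  show ?case by (simp only: trace_form_linear whitney_span_def span_zero)
next
  case (step c \<omega> \<eta>)
  then have "trace_form e \<omega> \<in> whitney_span x N d k e"
    using trace_form_whitney by blast
  then show ?case
    using step.IH by (simp only: trace_form_linear whitney_span_def span_add span_scale)
qed

text \<open>On \<open>e\<close> the coordinates belonging to \<open>f\<close> are the same whether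
  taken in \<open>g\<close> or in \<open>e\<close>, hence so are weight, projection and
  differential.\<close>

lemma trace_form_face_ext:
  assumes fe: "vertex_indices x N f \<subseteq> vertex_indices x N e"
  shows "trace_form e (face_ext x N r f g \<omega>) = face_ext x N r f e \<omega>"
proof (intro ext)
  fix y vs
  have eg: "e \<subseteq> g" "tangent e \<subseteq> tangent g"
    using nondegenerate_subset[OF e g sub] tangent_mono by auto
  show "trace_form e (face_ext x N r f g \<omega>) y vs = face_ext x N r f e \<omega> y vs"
  proof (cases "y \<in> e \<and> set vs \<subseteq> tangent e")
    case True
    have restrict: "hcoord x N g i p = hcoord x N e i p"
      if "i \<in> vertex_indices x N f" "p \<in> hspace x N e" for i p
      using fe sub that(1) hcoord_restrict[OF e g sub that(2), of i] by (simp add: subset_iff)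
    have y: "(y, 1) \<in> hspace x N e" using True hspace_point[OF e hull_inc] by auto
    have s: "face_weight x N f g y = face_weight x N f e y"
      using restrict y by (simp add: face_weight_def)
    have p: "face_proj x N f g y = face_proj x N f e y"
      using restrict y by (simp add: face_proj_def s)
    have m: "map (face_dproj x N f g y) vs = map (face_dproj x N f e y) vs"
      using restrict True hspace_vector[OF e] by (auto simp: face_dproj_def p intro!: sum.cong)
    have "y \<in> g" "set vs \<subseteq> tangent g" using True eg by auto
    then show ?thesis using True by (simp add: trace_form_def face_ext_def s p m)
  next
    case False
    then show ?thesis by (auto simp: trace_form_def face_ext_def)
  qed
qed

text \<open>On \<open>e\<close> only the vertices common to \<open>f\<close> and \<open>e\<close>
  have nonzero coordinates among those of \<open>f\<close>. Where the weight is nonzero, the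
  projection therefore maps \<open>e\<close> into the face \<open>c\<close> they span and tangent
  vectors of \<open>e\<close> to tangent vectors of \<open>c\<close>; the extension thus evaluates
  only the trace of \<open>\<mu>\<close> on a proper face of \<open>f\<close>.\<close>

lemma trace_form_face_ext_eq_0:
  assumes f: "nondegenerate x N f" and fg: "vertex_indices x N f \<subseteq> vertex_indices x N g"
    and nfe: "\<not> vertex_indices x N f \<subseteq> vertex_indices x N e" and r: "0 < r"
    and \<mu>: "\<And>c. c \<in> simplex_faces f \<Longrightarrow> c \<noteq> f \<Longrightarrow> trace_form c \<mu> = 0"
  shows "trace_form e (face_ext x N r f g \<mu>) = 0"
proof (intro ext, unfold zero_fun_apply)
  fix y vs
  let ?I = "vertex_indices x N f"
  let ?C = "?I \<inter> vertex_indices x N e"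
  let ?s = "face_weight x N f g y" and ?p = "face_proj x N f g y"
  show "trace_form e (face_ext x N r f g \<mu>) y vs = 0"
  proof (cases "y \<in> e \<and> set vs \<subseteq> tangent e \<and> ?s \<noteq> 0")
    case False
    then show ?thesis using r by (auto simp: trace_form_def face_ext_def)
  next
    case True
    then have y: "y \<in> e" and vs: "set vs \<subseteq> tangent e" and s: "?s \<noteq> 0" by auto
    have out: "hcoord x N g i p = 0" if "i \<in> ?I" "i \<notin> vertex_indices x N e" "p \<in> hspace x N e" for i p
      using fg that(1,2) hcoord_restrict[OF e g sub that(3), of i] by auto
    have yh: "(y, 1) \<in> hspace x N e" using y hspace_point[OF e hull_inc] by auto
    have yg: "y \<in> g" using y nondegenerate_subset[OF e g sub] by auto
    define c where "c = convex hull (x ` ?C)"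
    have s_eq: "?s = (\<Sum>i\<in>?C. hcoord x N g i (y, 1))"
      unfolding face_weight_def using out yh by (intro sum.mono_neutral_right) auto
    then have C: "?C \<noteq> {}" using s by auto
    have nonneg: "0 \<le> hcoord x N g i (y, 1)" if "i \<in> ?C" for i
      using hcoord_nonneg[OF g yg] that fg by auto
    have p_eq: "?p = (\<Sum>i\<in>?C. (hcoord x N g i (y, 1) / ?s) *\<^sub>R x i)"
      unfolding face_proj_def using out yh by (intro sum.mono_neutral_right) auto
    have "0 \<le> ?s" unfolding s_eq by (rule sum_nonneg[OF nonneg])
    moreover have "(\<Sum>i\<in>?C. hcoord x N g i (y, 1) / ?s) = 1"
      using s by (simp add: s_eq flip: sum_divide_distrib)
    ultimately have p: "?p \<in> c"
      unfolding p_eq c_def by (intro convex_sum) (auto simp: hull_inc nonneg)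
    have vert: "x i \<in> c" if "i \<in> ?C" for i unfolding c_def using that by (intro hull_inc) auto
    have L: "face_dproj x N f g y v \<in> tangent c" if "v \<in> set vs" for v
    proof -
      have "face_dproj x N f g y v = (\<Sum>i\<in>?C. hcoord x N g i (v, 0) *\<^sub>R (x i - ?p))"
        unfolding face_dproj_def using out[OF _ _ hspace_vector[OF e, of v]] that vs
        by (intro sum.mono_neutral_right) auto
      then show ?thesis
        using p vert by (simp only:) (intro subspace_sum subspace_scale subspace_tangent
            diff_affine_hull_tangent hull_inc; assumption)
    qed
    have indep: "\<not> affine_dependent (x ` ?I)" and inj: "inj_on x ?I" and hull: "convex hull (x ` ?I) = f"
      using f unfolding nondegenerate_def by auto
    have "c face_of f"
      using face_of_convex_hull_affine_independent[OF indep, of c] unfolding hull c_def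
      by (metis image_mono inf_le1)
    moreover have "c \<noteq> {}" using p by auto
    \<comment> \<open>Some vertex of \<open>f\<close> is not in \<open>e\<close>; if
      \<open>c\<close> were \<open>f\<close>, this vertex would lie in the affine hull of the
      others.\<close>
    moreover have "c \<noteq> f"
    proof
      assume cf: "c = f"
      obtain i where i: "i \<in> ?I" "i \<notin> ?C" using nfe by auto
      have "x i \<in> f" using i hull by (metis hull_inc imageI)
      then have "x i \<in> affine hull (x ` ?C)"
        using cf convex_hull_subset_affine_hull unfolding c_def by blast
      moreover have "x ` ?C \<subseteq> x ` ?I - {x i}" using i inj by (auto simp: inj_on_def)
      ultimately have "x i \<in> affine hull (x ` ?I - {x i})" by (meson hull_mono subsetD)
      then show False using indep i unfolding affine_dependent_def by blast
    qed
    ultimately have "trace_form c \<mu> = 0" by (intro \<mu>) (auto simp: simplex_faces_def)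
    then have "trace_form c \<mu> ?p (map (face_dproj x N f g y) vs) = 0" by simp
    then have "\<mu> ?p (map (face_dproj x N f g y) vs) = 0"
      using p L by (auto simp: trace_form_def image_subset_iff split: if_splits)
    then show ?thesis by (simp add: trace_form_def face_ext_def)
  qed
qed

end

subsection \<open>Direct sums\<close>

lemma linear_on_subspace_0: "linear_on_subspace V F \<Longrightarrow> subspace V \<Longrightarrow> F 0 = 0"
  using linear_on_subspaceD(1)[of V F 0 0] by (simp add: subspace_0)

lemma linear_on_subspace_diff:
  assumes F: "linear_on_subspace V F" and V: "subspace V" and "u \<in> V" "w \<in> V"
  shows "F (u - w) = F u - F w"
proof -
  have "(- 1) *\<^sub>R w \<in> V" using V assms(4) by (rule subspace_scale)
  from linear_on_subspaceD(2)[OF F assms(3) this] linear_on_subspaceD(1)[OF F assms(4), of "- 1"]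
  show ?thesis by simp
qed

lemma linear_on_subspace_sum:
  assumes F: "linear_on_subspace V F" and V: "subspace V" and "finite I" "\<And>i. i \<in> I \<Longrightarrow> w i \<in> V"
  shows "F (sum w I) = (\<Sum>i\<in>I. F (w i))"
  using linear_on_subspace_linear_combination[OF F V assms(3), of w "\<lambda>_. 1"] assms(4) by simp

text \<open>The index set is ordered by inclusion of faces; \<open>tr i\<close> stands for the trace on the face \<open>i\<close>.\<close>

lemma internal_direct_sum_of_traces:
  fixes V :: "'b::real_vector set" and I :: "'i::order set"
    and W :: "'i \<Rightarrow> 'b set" and tr :: "'i \<Rightarrow> 'b \<Rightarrow> 'c::real_vector"
  assumes I: "finite I" and V: "subspace V"
    and W: "\<And>i. i \<in> I \<Longrightarrow> subspace (W i)" "\<And>i. i \<in> I \<Longrightarrow> W i \<subseteq> V"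
    and tr: "\<And>i. i \<in> I \<Longrightarrow> linear_on_subspace V (tr i)"
    and tr_0: "\<And>i j w. i \<in> I \<Longrightarrow> j \<in> I \<Longrightarrow> w \<in> W i \<Longrightarrow> \<not> i \<le> j \<Longrightarrow> tr j w = 0"
    and tr_inj: "\<And>i w. i \<in> I \<Longrightarrow> w \<in> W i \<Longrightarrow> tr i w = 0 \<Longrightarrow> w = 0"
    and tr_surj: "\<And>i v. i \<in> I \<Longrightarrow> v \<in> V \<Longrightarrow> (\<And>j. j \<in> I \<Longrightarrow> j < i \<Longrightarrow> tr j v = 0) \<Longrightarrow>
      \<exists>w\<in>W i. tr i w = tr i v"
    and tr_all: "\<And>v. v \<in> V \<Longrightarrow> (\<And>i. i \<in> I \<Longrightarrow> tr i v = 0) \<Longrightarrow> v = 0"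
  shows "is_internal_direct_sum V I W"
proof -
  have indep: "w i = 0" if w: "\<forall>i\<in>I. w i \<in> W i" "(\<Sum>i\<in>I. w i) = 0" and i: "i \<in> I" for w i
  proof (rule ccontr)
    assume "w i \<noteq> 0"
    define J where "J = {i \<in> I. w i \<noteq> 0}"
    have "finite J" "J \<noteq> {}" using I i \<open>w i \<noteq> 0\<close> by (auto simp: J_def)
    \<comment> \<open>Every other \<open>j\<close> in \<open>J\<close> fails
      \<open>j \<le> m\<close> by minimality, so \<open>tr m\<close> annihilates its component and
      sees only \<open>w m\<close> in the vanishing sum.\<close>
    then obtain m where m: "m \<in> J" "\<forall>j\<in>J. j \<le> m \<longrightarrow> m = j"
      using finite_has_minimal by metis
    then have mI: "m \<in> I" by (simp add: J_def)
    have "tr m (w j) = 0" if j: "j \<in> I - {m}" for j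
    proof (cases "j \<in> J")
      case True
      then show ?thesis using tr_0[of j m "w j"] j mI m w by auto
    next
      case False
      then show ?thesis using j linear_on_subspace_0[OF tr[OF mI] V] by (simp add: J_def)
    qed
    then have "(\<Sum>j\<in>I. tr m (w j)) = tr m (w m)"
      using I mI by (simp add: sum.remove)
    moreover have "tr m (\<Sum>j\<in>I. w j) = (\<Sum>j\<in>I. tr m (w j))"
      using w W by (intro linear_on_subspace_sum[OF tr[OF mI] V I]) auto
    ultimately have "tr m (w m) = 0"
      using w(2) linear_on_subspace_0[OF tr[OF mI] V] by simp
    then show False using tr_inj[OF mI] w(1) mI m(1) by (auto simp: J_def)
  qed
  \<comment> \<open>Induction over down-closed index sets. Removing a maximal \<open>m\<close> keeps
    the set down-closed, and the remainder left by the smaller set has zero trace at all indices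
    below \<open>m\<close>, so \<open>tr_surj\<close> supplies a component there. Subtracting it
    does not disturb the traces already made 0, since \<open>m \<le> j\<close> fails for the other
    \<open>j\<close>.\<close>
  have part: "\<exists>w. (\<forall>i\<in>S. w i \<in> W i) \<and> (\<forall>j\<in>S. tr j (v - (\<Sum>i\<in>S. w i)) = 0)"
    if "v \<in> V" "S \<subseteq> I" "\<And>i j. i \<in> S \<Longrightarrow> j \<in> I \<Longrightarrow> j \<le> i \<Longrightarrow> j \<in> S" for v S
    using finite_subset[OF that(2) I] that(2,3)
  proof (induction S rule: finite_psubset_induct)
    case (psubset S)
    show ?case
    proof (cases "S = {}")
      case False
      then obtain m where m: "m \<in> S" "\<forall>j\<in>S. m \<le> j \<longrightarrow> m = j"
        using finite_has_maximal[OF psubset.hyps] by metis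
      let ?S = "S - {m}"
      have mI: "m \<in> I" using m psubset.prems by auto
      have "?S \<subset> S" "?S \<subseteq> I" using m psubset.prems by auto
      moreover have "j \<in> ?S" if "i \<in> ?S" "j \<in> I" "j \<le> i" for i j
        using that psubset.prems(2)[of i j] m by auto
      ultimately obtain w where w: "\<forall>i\<in>?S. w i \<in> W i" "\<forall>j\<in>?S. tr j (v - (\<Sum>i\<in>?S. w i)) = 0"
        using psubset.IH[of ?S] by blast
      let ?u = "v - (\<Sum>i\<in>?S. w i)"
      have wV: "w i \<in> V" if "i \<in> ?S" for i
        using that w(1) W(2)[of i] psubset.prems(1) by blast
      then have u: "?u \<in> V"
        using \<open>v \<in> V\<close> V by (intro subspace_diff subspace_sum)
      have "tr j ?u = 0" if "j \<in> I" "j < m" for j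
        using w(2) psubset.prems(2)[of m j] m(1) that by auto
      then obtain wm where wm: "wm \<in> W m" "tr m wm = tr m ?u" using tr_surj[OF mI u] by blast
      let ?w = "w(m := wm)"
      have sum: "(\<Sum>i\<in>S. ?w i) = wm + (\<Sum>i\<in>?S. w i)"
        using psubset.hyps m(1) by (simp add: sum.remove[of S m])
      have eq: "v - (\<Sum>i\<in>S. ?w i) = ?u - wm" unfolding sum by (simp add: algebra_simps)
      have "tr j (v - (\<Sum>i\<in>S. ?w i)) = 0" if j: "j \<in> S" for j
      proof -
        have jI: "j \<in> I" using j psubset.prems by auto
        have wmV: "wm \<in> V" using wm W mI by auto
        have "tr j (v - (\<Sum>i\<in>S. ?w i)) = tr j ?u - tr j wm"
          unfolding eq by (rule linear_on_subspace_diff[OF tr[OF jI] V u wmV])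
        also have "\<dots> = 0"
        proof (cases "j = m")
          case False
          then have "\<not> m \<le> j" using m(2) j by auto
          then show ?thesis using tr_0[OF mI jI wm(1)] w(2) j False by simp
        qed (use wm in simp)
        finally show ?thesis .
      qed
      then show ?thesis using w(1) wm(1) by (intro exI[of _ ?w]) auto
    qed auto
  qed
  have "V = {\<Sum>i\<in>I. w i |w. \<forall>i\<in>I. w i \<in> W i}"
  proof (intro equalityI subsetI)
    fix v assume v: "v \<in> V"
    obtain w where w: "\<forall>i\<in>I. w i \<in> W i" "\<forall>j\<in>I. tr j (v - (\<Sum>i\<in>I. w i)) = 0"
      using part[OF v subset_refl] by blast
    have "w i \<in> V" if "i \<in> I" for i using that w(1) W(2)[of i] by blast
    then have "v - (\<Sum>i\<in>I. w i) \<in> V"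
      using v V by (intro subspace_diff subspace_sum)
    then have "v = (\<Sum>i\<in>I. w i)" using tr_all w(2) by force
    then show "v \<in> {\<Sum>i\<in>I. w i |w. \<forall>i\<in>I. w i \<in> W i}" using w(1) by blast
  next
    fix v assume "v \<in> {\<Sum>i\<in>I. w i |w. \<forall>i\<in>I. w i \<in> W i}"
    then obtain w where w: "v = (\<Sum>i\<in>I. w i)" "\<forall>i\<in>I. w i \<in> W i" by blast
    have "w i \<in> V" if "i \<in> I" for i using that w(2) W(2)[of i] by blast
    then show "v \<in> V" unfolding w(1) using V by (intro subspace_sum)
  qed
  then show ?thesis
    unfolding is_internal_direct_sum_def using I W indep by blast
qed

lemma whitney_list_expand:
  "whitney_list x N f \<tau> = (\<Sum>i<length \<tau>. fmult (\<lambda>y. (- 1) ^ i * hcoord x N f (\<tau> ! i) (y, 1))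
      (dbary_form x N f (take i \<tau> @ drop (Suc i) \<tau>)))"
proof (intro ext)
  fix y :: 'a and vs :: "'a list"
  show "whitney_list x N f \<tau> y vs = (\<Sum>i<length \<tau>. fmult (\<lambda>y. (- 1) ^ i * hcoord x N f (\<tau> ! i) (y, 1))
      (dbary_form x N f (take i \<tau> @ drop (Suc i) \<tau>))) y vs"
  proof (cases "y \<in> f \<and> set vs \<subseteq> tangent f")
    case True
    then show ?thesis
      by (simp add: whitney_list_def dbary_form_def form_sum_apply fmult_def wedge_Cons_right
          take_map drop_map)
  next
    case False
    then have "whitney_list x N f \<tau> y vs = 0" "dbary_form x N f \<tau>' y vs = 0" for \<tau>'
      by (auto simp: whitney_list_def dbary_form_def)
    then show ?thesis by (simp add: form_sum_apply fmult_def)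
  qed
qed

text \<open>A Whitney form has coefficients of degree at most 1, the monomial has degree
  \<open>d\<close>. The inclusion provides the continuous coefficients on which square integrability
  and uniqueness of representatives rest.\<close>

lemma poly_minus_forms_subset_poly_forms:
  assumes f: "nondegenerate x N f"
  shows "poly_minus_forms (Suc d) k f \<subseteq> poly_forms (int (Suc d)) k f"
  unfolding poly_minus_forms_eq_whitney_span[OF f] whitney_span_def
proof (intro span_minimal subspace_poly_forms subsetI)
  fix \<omega> assume "\<omega> \<in> {fmult (bary_monom x N f \<alpha>) (whitney_list x N f \<tau>) |\<alpha> \<tau>.
     sum \<alpha> (vertex_indices x N f) = d \<and> set \<tau> \<subseteq> vertex_indices x N f \<and> length \<tau> = Suc k}"
  then obtain \<alpha> \<tau> where \<omega>: "\<omega> = fmult (bary_monom x N f \<alpha>) (whitney_list x N f \<tau>)"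
    and \<alpha>: "sum \<alpha> (vertex_indices x N f) = d" and \<tau>: "length \<tau> = Suc k" by blast
  let ?q = "\<lambda>i y. bary_monom x N f \<alpha> y * ((- 1) ^ i * hcoord x N f (\<tau> ! i) (y, 1))"
  have "?q i \<in> polys (int d + (0 + 1))" for i
    using bary_monom_polys[of x N f \<alpha>] \<alpha> by (intro polys_mult const_polys hcoord_polys) auto
  then have "(\<Sum>i<length \<tau>. fmult (?q i) (dbary_form x N f (take i \<tau> @ drop (Suc i) \<tau>)))
      \<in> poly_forms (int (Suc d)) k f"
    using \<tau> by (intro subspace_sum subspace_poly_forms fmult_dbary_form_poly_forms)
      (auto simp: add.commute)
  moreover have "\<omega> = (\<Sum>i<length \<tau>. fmult (?q i) (dbary_form x N f (take i \<tau> @ drop (Suc i) \<tau>)))"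
    unfolding \<omega> by (subst whitney_list_expand) (simp add: fmult_sum, simp add: fmult_def mult.assoc)
  ultimately show "\<omega> \<in> poly_forms (int (Suc d)) k f" by (simp only:)
qed

subsection \<open>Forms on a triangulation\<close>

locale numbered_mesh =
  fixes \<Omega> :: "'a::euclidean_space set" and \<T> :: "'a set set" and x :: "nat \<Rightarrow> 'a" and N :: nat
  assumes domain: "bounded_polyhedral_domain \<Omega>"
    and triangulation: "simplicial_triangulation \<T> \<Omega>"
    and numbering: "vertex_numbering \<T> x N"
begin

lemma finite_mesh: "finite \<T>"
  using triangulation by (simp add: simplicial_triangulation_def triangulation_def)

lemma mesh_simplex: "T \<in> \<T> \<Longrightarrow> int DIM('a) simplex T"
  using triangulation by (simp add: simplicial_triangulation_def)

lemma mesh_Union: "\<Union>\<T> = closure \<Omega>"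
  using triangulation by (simp add: simplicial_triangulation_def)

lemma mesh_Int_face_of: "T \<in> \<T> \<Longrightarrow> T' \<in> \<T> \<Longrightarrow> (T \<inter> T') face_of T"
  using triangulation by (simp add: simplicial_triangulation_def triangulation_def)

lemma mesh_convex: "T \<in> \<T> \<Longrightarrow> convex T"
  using mesh_simplex by (auto simp: simplex_def)

lemma mesh_compact: "T \<in> \<T> \<Longrightarrow> compact T"
  using mesh_simplex simplex_imp_polytope polytope_imp_compact by blast

lemma mesh_interior: assumes "T \<in> \<T>" shows "interior T \<noteq> {}" "closure (interior T) = T"
proof -
  have "aff_dim T = int DIM('a)" using mesh_simplex[OF assms] by (rule aff_dim_simplex)
  moreover from this have "T \<noteq> {}" by auto
  ultimately show "interior T \<noteq> {}"
    using mesh_convex[OF assms] by (metis interior_rel_interior rel_interior_eq_empty)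
  then show "closure (interior T) = T"
    using mesh_convex[OF assms] mesh_compact[OF assms]
    by (simp add: convex_closure_interior compact_imp_closed)
qed

lemma mesh_tangent: assumes "T \<in> \<T>" shows "tangent T = UNIV"
proof -
  have "affine hull T = UNIV"
    using aff_dim_simplex[OF mesh_simplex[OF assms]] aff_dim_eq_full by blast
  then have "u \<in> tangent T" for u using diff_affine_hull_tangent[of u T 0] by simp
  then show ?thesis by auto
qed

text \<open>A face meeting the interior of \<open>T\<close> is all of \<open>T\<close>, so
  \<open>T\<close> would lie in \<open>T'\<close>; then the interior of \<open>T'\<close> meets
  \<open>T\<close> as well and the argument repeats with the roles exchanged.\<close>

lemma mesh_disjoint_interior:
  assumes "T \<in> \<T>" "T' \<in> \<T>" "T \<noteq> T'"
  shows "interior T \<inter> T' = {}"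
proof (rule ccontr)
  assume "interior T \<inter> T' \<noteq> {}"
  then have "T \<inter> T' = T"
    using face_of_disjoint_interior[OF mesh_Int_face_of[OF assms(1,2)]] interior_subset by blast
  then have "interior T \<subseteq> interior T'" by (intro interior_mono) auto
  then have "T' \<inter> T = T'"
    using face_of_disjoint_interior[OF mesh_Int_face_of[OF assms(2,1)]] mesh_interior[OF assms(1)]
      interior_subset by blast
  then show False using \<open>T \<inter> T' = T\<close> assms(3) by auto
qed

lemma mesh_mem_faces: "T \<in> \<T> \<Longrightarrow> T \<in> mesh_faces \<T>"
  using mesh_convex[of T] mesh_interior(1)[of T] unfolding mesh_faces_def simplex_faces_def
  by (intro UN_I[of T]) (auto intro: face_of_refl)

lemma finite_mesh_faces: "finite (mesh_faces \<T>)"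
proof -
  have "finite (simplex_faces T)" if "T \<in> \<T>" for T
    using finite_polytope_faces[OF simplex_imp_polytope[OF mesh_simplex[OF that]]]
    by (auto simp: simplex_faces_def elim: finite_subset[rotated])
  then show ?thesis using finite_mesh by (simp add: mesh_faces_def)
qed

text \<open>The two faces may come from different simplices. The intersection of these simplices is
  a face of both and contains the smaller face, which transfers it to the simplex of the larger
  one.\<close>

lemma mesh_face_of:
  assumes f: "f \<in> mesh_faces \<T>" and g: "g \<in> mesh_faces \<T>" and "f \<subseteq> g"
  shows "f face_of g"
proof -
  obtain T where T: "T \<in> \<T>" "f face_of T" using f by (auto simp: mesh_faces_def simplex_faces_def)
  obtain T' where T': "T' \<in> \<T>" "g face_of T'" using g by (auto simp: mesh_faces_def simplex_faces_def)
  have sub: "g \<subseteq> T'" "f \<subseteq> T" using T' T face_of_imp_subset by auto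
  then have "f face_of (T \<inter> T')" using T(2) assms(3) by (intro face_of_subset[OF T(2)]) auto
  moreover have "(T \<inter> T') face_of T'" using mesh_Int_face_of[OF T'(1) T(1)] by (simp add: Int_commute)
  ultimately have "f face_of T'" by (rule face_of_trans)
  from face_of_subset[OF this assms(3) sub(1)] show ?thesis .
qed

lemma mesh_nondegenerate:
  assumes f: "f \<in> mesh_faces \<T>"
  shows "nondegenerate x N f"
proof -
  obtain T where T: "T \<in> \<T>" "f face_of T" "f \<noteq> {}"
    using f by (auto simp: mesh_faces_def simplex_faces_def)
  obtain C where C: "\<not> affine_dependent C" "T = convex hull C"
    using mesh_simplex[OF T(1)] by (auto simp: simplex_def)
  obtain c where c: "c \<subseteq> C" "f = convex hull c"
    using T(2) C face_of_convex_hull_affine_independent by blast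
  have cdep: "\<not> affine_dependent c" using C(1) c(1) affine_independent_subset by blast
  \<comment> \<open>The vertices of the face are vertices of \<open>T\<close>, so they lie in the
    range of the numbering, and the indices of the extreme points recover exactly
    \<open>c\<close>.\<close>
  have ext: "v extreme_point_of f \<longleftrightarrow> v \<in> c" for v
    using extreme_point_of_convex_hull_affine_independent[OF cdep] c(2) by simp
  have bij: "bij_betw x {0..N} {v. \<exists>T\<in>\<T>. v extreme_point_of T}"
    using numbering by (simp add: vertex_numbering_def)
  have "c \<subseteq> {v. \<exists>T\<in>\<T>. v extreme_point_of T}"
    using T(1) c(1) extreme_point_of_convex_hull_affine_independent[OF C(1)] C(2) by auto
  then have "c \<subseteq> x ` {0..N}" using bij by (simp add: bij_betw_def)
  then have im: "x ` vertex_indices x N f = c"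
    unfolding vertex_indices_def ext by auto
  have "inj_on x (vertex_indices x N f)"
    using bij by (auto simp: bij_betw_def vertex_indices_def intro: inj_on_subset)
  then show ?thesis
    using im cdep c T(3) by (auto simp: nondegenerate_def)
qed

lemma mesh_vertex_indices_mono:
  assumes f: "f \<in> mesh_faces \<T>" and g: "g \<in> mesh_faces \<T>"
  shows "vertex_indices x N f \<subseteq> vertex_indices x N g \<longleftrightarrow> f \<subseteq> g"
proof
  assume "f \<subseteq> g"
  then show "vertex_indices x N f \<subseteq> vertex_indices x N g"
    using extreme_point_of_face[OF mesh_face_of[OF f g]] by (auto simp: vertex_indices_def)
qed (rule nondegenerate_subset[OF mesh_nondegenerate[OF f] mesh_nondegenerate[OF g]])

lemma mesh_card_vertex_indices:
  assumes f: "f \<in> mesh_faces \<T>"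
  shows "int (card (vertex_indices x N f)) = aff_dim f + 1"
proof -
  have *: "inj_on x (vertex_indices x N f)" "\<not> affine_dependent (x ` vertex_indices x N f)"
    "convex hull (x ` vertex_indices x N f) = f"
    using mesh_nondegenerate[OF f] by (auto simp: nondegenerate_def)
  then show ?thesis
    using aff_dim_affine_independent[OF *(2)] aff_dim_convex_hull[of "x ` vertex_indices x N f"]
    by (simp add: card_image)
qed

lemma mesh_faces_subface: "f \<in> mesh_faces \<T> \<Longrightarrow> e \<in> simplex_faces f \<Longrightarrow> e \<in> mesh_faces \<T>"
  using face_of_trans by (auto simp: mesh_faces_def simplex_faces_def)

end

section \<open>Classes of forms modulo null sets\<close>

lemma ae_class_exhaust: "\<exists>\<omega>. W = ae_class \<omega>"
  by (induction W rule: ae_form.abs_induct) blast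

lemma restricts_to_add:
  "restricts_to W T p \<Longrightarrow> restricts_to W' T q \<Longrightarrow> restricts_to (W + W') T (p + q)"
  by transfer (erule (1) eventually_elim2, simp)

lemma restricts_to_scale: "restricts_to W T p \<Longrightarrow> restricts_to (c *\<^sub>R W) T (c *\<^sub>R p)"
  by transfer (erule eventually_mono, simp add: scaleR_fun_def)

lemma restricts_to_0: "restricts_to 0 T 0"
  by transfer simp

lemma L2_forms_restricts_to_outside: "W \<in> L2_forms k \<Omega> \<Longrightarrow> restricts_to W (- \<Omega>) 0"
  unfolding L2_forms_def by (auto simp: restricts_to.abs_eq)

lemma alt_multilinear_sum:
  "(\<And>i. i \<in> S \<Longrightarrow> alt_multilinear V k (a i)) \<Longrightarrow> alt_multilinear V k (\<Sum>i\<in>S. a i)"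
proof (induction S rule: infinite_finite_induct)
  case (insert i S)
  have "alt_multilinear V k (a i)" "alt_multilinear V k (\<Sum>i\<in>S. a i)"
    using insert by auto
  then have "alt_multilinear V k (a i + (\<Sum>i\<in>S. a i))" by (rule alt_multilinear_closed(1))
  then show ?case by (simp only: sum.insert[OF insert.hyps])
qed (simp_all only: sum.infinite sum.empty alt_multilinear_0 not_False_eq_True)

lemma subspace_poly_minus_forms0: "subspace (poly_minus_forms0 r k f)"
  using subspace_0[OF subspace_poly_minus_forms[of r k f]]
    subspace_add[OF subspace_poly_minus_forms[of r k f]]
    subspace_scale[OF subspace_poly_minus_forms[of r k f]]
  unfolding subspace_def poly_minus_forms0_def
  by (simp add: trace_form_linear)

section \<open>Gluing simplexwise forms into one class\<close>

context numbered_mesh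
begin

text \<open>A polytope in the frontier has empty interior: its interior is an open set disjoint from
  the domain, hence disjoint from the closure of the domain, which contains the frontier. Convexity
  then makes it a null set.\<close>

lemma negligible_frontier_domain: "negligible (frontier \<Omega>)"
proof -
  obtain P where P: "finite P" "\<forall>p\<in>P. polytope p" "frontier \<Omega> = \<Union>P"
    using domain by (auto simp: bounded_polyhedral_domain_def)
  have "open \<Omega>" using domain by (simp add: bounded_polyhedral_domain_def)
  have "interior p = {}" if "p \<in> P" for p
  proof -
    have p: "interior p \<subseteq> frontier \<Omega>" using that P(3) interior_subset by blast
    then have "interior p \<inter> \<Omega> = {}" using \<open>open \<Omega>\<close> by (auto simp: frontier_def interior_open)
    then have "interior p \<inter> closure \<Omega> = {}" by (simp add: open_Int_closure_eq_empty)
    then show ?thesis using p by (auto simp: frontier_def)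
  qed
  then have "negligible p" if "p \<in> P" for p
    using that P(2) by (simp add: negligible_convex_interior polytope_imp_convex)
  then show ?thesis unfolding P(3) using P(1) by (intro negligible_Union) auto
qed

text \<open>The simplices cover the closure of the domain, whereas forms are 0 off the domain
  itself; the two conventions agree only because the frontier, cracks included, is null.\<close>

lemma AE_mesh_interior: "AE y in lebesgue. \<forall>T\<in>\<T>. y \<in> T \<longrightarrow> y \<in> interior T \<and> y \<in> \<Omega>"
proof -
  have "negligible (\<Union>(frontier ` \<T>) \<union> frontier \<Omega>)"
    using finite_mesh mesh_convex negligible_convex_frontier negligible_frontier_domain
    by (intro negligible_Un negligible_Union) auto
  then have null: "(\<Union>(frontier ` \<T>) \<union> frontier \<Omega>) \<in> null_sets lebesgue"
    by (simp add: negligible_iff_null_sets)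
  have "open \<Omega>" using domain by (simp add: bounded_polyhedral_domain_def)
  have "y \<in> interior T \<and> y \<in> \<Omega>"
    if "y \<notin> \<Union>(frontier ` \<T>) \<union> frontier \<Omega>" "T \<in> \<T>" "y \<in> T" for y T
  proof -
    have "y \<in> closure T" "y \<in> closure \<Omega>"
      using that mesh_Union closure_subset by blast+
    then show ?thesis using that \<open>open \<Omega>\<close> by (auto simp: frontier_def interior_open)
  qed
  then show ?thesis using null by (intro AE_I'[OF null]) auto
qed

text \<open>Summing over interiors avoids choosing a simplex at shared boundary points: at most one
  term is nonzero, and on the null set of boundaries the value is 0.\<close>

definition glue_fun :: "('a set \<Rightarrow> 'a form) \<Rightarrow> 'a form" where
  "glue_fun p y = (if y \<in> \<Omega> then \<Sum>T\<in>\<T>. if y \<in> interior T then p T y else 0 else 0)"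

definition glue :: "('a set \<Rightarrow> 'a form) \<Rightarrow> 'a ae_form" where
  "glue p = ae_class (glue_fun p)"

lemma glue_fun_eq:
  assumes "T \<in> \<T>" "y \<in> interior T" "y \<in> \<Omega>"
  shows "glue_fun p y = p T y"
proof -
  have "y \<notin> interior T'" if "T' \<in> \<T>" "T' \<noteq> T" for T'
    using mesh_disjoint_interior[OF assms(1) that(1)] that(2) assms(2) interior_subset by blast
  then have "glue_fun p y = (\<Sum>T'\<in>\<T>. if T' = T then p T' y else 0)"
    unfolding glue_fun_def using assms by (simp only: if_True) (intro sum.cong, auto)
  also have "\<dots> = p T y" using finite_mesh assms(1) by (simp only: sum.delta if_True)
  finally show ?thesis .
qed

lemma restricts_to_glue: "T \<in> \<T> \<Longrightarrow> restricts_to (glue p) T (p T)"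
  unfolding glue_def restricts_to.abs_eq
  by (rule eventually_mono[OF AE_mesh_interior]) (auto intro: glue_fun_eq)

lemma glue_outside: "restricts_to (glue p) (- \<Omega>) 0"
  unfolding glue_def restricts_to.abs_eq by (auto simp: glue_fun_def)

text \<open>The simplices together with the complement of the domain cover the space, and finitely
  many null sets may be discarded.\<close>

lemma mesh_form_eqI:
  assumes "restricts_to W (- \<Omega>) 0" "restricts_to W' (- \<Omega>) 0"
    and "\<And>T. T \<in> \<T> \<Longrightarrow> restricts_to W T (p T)" "\<And>T. T \<in> \<T> \<Longrightarrow> restricts_to W' T (p T)"
  shows "W = W'"
proof -
  obtain \<omega> \<omega>' where W: "W = ae_class \<omega>" "W' = ae_class \<omega>'"
    using ae_class_exhaust by metis
  have "AE y in lebesgue. \<forall>T\<in>\<T>. y \<in> T \<longrightarrow> \<omega> y = p T y"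
    and "AE y in lebesgue. \<forall>T\<in>\<T>. y \<in> T \<longrightarrow> \<omega>' y = p T y"
    using assms(3,4) unfolding W restricts_to.abs_eq
    by (simp_all add: AE_finite_all[OF finite_mesh])
  moreover have "AE y in lebesgue. y \<in> - \<Omega> \<longrightarrow> \<omega> y = 0 y" "AE y in lebesgue. y \<in> - \<Omega> \<longrightarrow> \<omega>' y = 0 y"
    using assms(1,2) unfolding W restricts_to.abs_eq by simp_all
  ultimately have "AE y in lebesgue. \<omega> y = \<omega>' y"
  proof eventually_elim
    case (elim y)
    show ?case
    proof (cases "y \<in> \<Omega>")
      case True
      then obtain T where "T \<in> \<T>" "y \<in> T" using mesh_Union closure_subset by blast
      then show ?thesis using elim(1,2) by simp
    qed (use elim(3,4) in auto)
  qed
  then show ?thesis unfolding W by (simp add: ae_form.abs_eq_iff)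
qed

lemma glue_eqI:
  "restricts_to W (- \<Omega>) 0 \<Longrightarrow> (\<And>T. T \<in> \<T> \<Longrightarrow> restricts_to W T (p T)) \<Longrightarrow> W = glue p"
  using mesh_form_eqI[of W "glue p" p] glue_outside restricts_to_glue by blast

lemma glue_add: "glue p + glue q = glue (\<lambda>T. p T + q T)"
proof (rule glue_eqI)
  show "restricts_to (glue p + glue q) (- \<Omega>) 0"
    using restricts_to_add[OF glue_outside[of p] glue_outside[of q]] by (simp only: add_0_right)
qed (intro restricts_to_add restricts_to_glue)

lemma glue_scale: "c *\<^sub>R glue p = glue (\<lambda>T. c *\<^sub>R p T)"
proof (rule glue_eqI)
  show "restricts_to (c *\<^sub>R glue p) (- \<Omega>) 0"
    using restricts_to_scale[OF glue_outside[of p], of c] by (simp only: scaleR_zero_right)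
qed (intro restricts_to_scale restricts_to_glue)

lemma glue_0: "(\<And>T. T \<in> \<T> \<Longrightarrow> p T = 0) \<Longrightarrow> glue p = 0"
proof (rule glue_eqI[symmetric])
  assume "\<And>T. T \<in> \<T> \<Longrightarrow> p T = 0"
  then show "restricts_to 0 T (p T)" if "T \<in> \<T>" for T
    using that restricts_to_0[of T] by (simp only:)
qed (rule restricts_to_0)

text \<open>Each coefficient is a finite sum of continuous functions cut off to open sets, hence
  measurable, and it is bounded on a bounded domain.\<close>

lemma glue_L2:
  assumes p: "\<And>T. T \<in> \<T> \<Longrightarrow> p T \<in> poly_forms r k T"
  shows "glue p \<in> L2_forms k \<Omega>"
proof -
  have "alt_multilinear UNIV k (glue_fun p y)" if "y \<in> \<Omega>" for y
  proof -
    have "alt_multilinear UNIV k (if y \<in> interior T then p T y else 0)" if T: "T \<in> \<T>" for T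
    proof (cases "y \<in> interior T")
      case True
      then have "y \<in> T" using interior_subset by blast
      then show ?thesis using p[OF T] mesh_tangent[OF T] True by (simp add: poly_forms_def)
    qed (simp only: if_False alt_multilinear_0)
    then show ?thesis
      using alt_multilinear_sum[of \<T> UNIV k "\<lambda>T. if y \<in> interior T then p T y else 0"] that
      by (simp only: glue_fun_def if_True)
  qed
  moreover have "(\<lambda>y. glue_fun p y vs) \<in> borel_measurable lebesgue \<and>
      integrable lebesgue (\<lambda>y. (glue_fun p y vs)\<^sup>2)" for vs
  proof -
    \<comment> \<open>The coefficient of \<open>p T\<close> is 0 off \<open>T\<close> and may jump
      at the boundary; a polynomial agreeing with it on \<open>T\<close> is continuous
      everywhere.\<close>
    have "\<forall>T. \<exists>q. T \<in> \<T> \<longrightarrow> continuous_on UNIV q \<and> (\<forall>y\<in>T. p T y vs = q y)"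
      using p continuous_on_polys unfolding poly_forms_def by blast
    then obtain q where q: "\<And>T. T \<in> \<T> \<Longrightarrow> continuous_on UNIV (q T)"
      "\<And>T y. T \<in> \<T> \<Longrightarrow> y \<in> T \<Longrightarrow> p T y vs = q T y" by metis
    define F where "F y = (\<Sum>T\<in>\<T>. indicat_real (\<Omega> \<inter> interior T) y * q T y)" for y
    have sum_app: "(\<Sum>T\<in>S. if y \<in> interior T then p T y else 0) vs =
        (\<Sum>T\<in>S. if y \<in> interior T then p T y vs else 0)" for S y
      by (induction S rule: infinite_finite_induct) auto
    have F: "glue_fun p y vs = F y" for y
    proof (cases "y \<in> \<Omega>")
      case True
      then have "glue_fun p y vs = (\<Sum>T\<in>\<T>. if y \<in> interior T then p T y vs else 0)"
        by (simp only: glue_fun_def if_True sum_app)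
      also have "\<dots> = F y"
        unfolding F_def using True q(2) interior_subset by (intro sum.cong) (auto simp: indicator_def)
      finally show ?thesis .
    qed (simp add: glue_fun_def F_def)
    have "open \<Omega>" "bounded \<Omega>" using domain by (simp_all add: bounded_polyhedral_domain_def)
    have meas: "F \<in> borel_measurable borel"
      unfolding F_def using q(1) \<open>open \<Omega>\<close>
      by (intro borel_measurable_sum borel_measurable_times borel_measurable_indicator
          borel_measurable_continuous_onI) auto
    have "\<forall>T. \<exists>b. T \<in> \<T> \<longrightarrow> (\<forall>y\<in>T. \<bar>q T y\<bar> \<le> b)"
    proof
      fix T
      show "\<exists>b. T \<in> \<T> \<longrightarrow> (\<forall>y\<in>T. \<bar>q T y\<bar> \<le> b)"
      proof (cases "T \<in> \<T>")
        case True
        then have "bounded (q T ` T)"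
          using q(1) mesh_compact by (intro compact_imp_bounded compact_continuous_image)
            (auto intro: continuous_on_subset)
        then show ?thesis unfolding bounded_iff by auto
      qed simp
    qed
    then obtain b where b: "\<And>T y. T \<in> \<T> \<Longrightarrow> y \<in> T \<Longrightarrow> \<bar>q T y\<bar> \<le> b T" by metis
    define B where "B = (\<Sum>T\<in>\<T>. \<bar>b T\<bar>)"
    have "\<bar>F y\<bar> \<le> B" for y
      unfolding F_def B_def
    proof (rule order_trans[OF sum_abs], rule sum_mono)
      fix T assume T: "T \<in> \<T>"
      show "\<bar>indicat_real (\<Omega> \<inter> interior T) y * q T y\<bar> \<le> \<bar>b T\<bar>"
        using b[OF T, of y] interior_subset[of T] by (auto simp: indicator_def)
    qed
    then have F2: "(F y)\<^sup>2 \<le> B\<^sup>2" for y using power_mono[of "\<bar>F y\<bar>" B 2] by simp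
    have F0: "F y = 0" if "y \<notin> \<Omega>" for y using that by (simp add: F_def)
    have meas_leb: "F \<in> borel_measurable lebesgue"
      using meas by (intro measurable_completion) simp
    have "integrable lebesgue (\<lambda>y. (F y)\<^sup>2)"
    proof (rule Bochner_Integration.integrable_bound)
      show "integrable lebesgue (\<lambda>y. B\<^sup>2 * indicat_real \<Omega> y)"
        using \<open>open \<Omega>\<close> \<open>bounded \<Omega>\<close> bounded_set_imp_lmeasurable[of \<Omega>]
        by (intro integrable_mult_right) (auto simp: fmeasurable_def intro!: integrable_real_indicator)
      show "AE y in lebesgue. norm ((F y)\<^sup>2) \<le> norm (B\<^sup>2 * indicat_real \<Omega> y)"
        using F2 F0 by (intro AE_I2) (auto simp: indicator_def)
    qed (use meas_leb in measurable)
    then show ?thesis using meas_leb by (simp add: F)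
  qed
  moreover have "glue_fun p y = 0" if "y \<notin> \<Omega>" for y
    using that by (simp only: glue_fun_def if_False)
  ultimately show ?thesis unfolding L2_forms_def glue_def by blast
qed

text \<open>For each list of arguments the difference of the coefficients is continuous; its nonzero
  set within the interior is open and null, hence empty. Since \<open>T\<close> is the closure of
  its interior, equality extends to \<open>T\<close>.\<close>

lemma restricts_to_unique:
  assumes T: "T \<in> \<T>" and pq: "p \<in> poly_forms r k T" "q \<in> poly_forms r k T"
    and "restricts_to W T p" "restricts_to W T q"
  shows "p = q"
proof (intro ext)
  fix y vs
  obtain \<omega> where W: "W = ae_class \<omega>" using ae_class_exhaust by metis
  have "AE y in lebesgue. y \<in> T \<longrightarrow> p y = q y"
    using assms(4,5) unfolding W restricts_to.abs_eq by eventually_elim simp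
  then obtain Z where Z: "Z \<in> null_sets lebesgue" "{y. \<not> (y \<in> T \<longrightarrow> p y = q y)} \<subseteq> Z"
    unfolding eventually_ae_filter by auto
  obtain a where a: "a \<in> polys r" "\<forall>y\<in>T. p y vs = a y" using pq(1) unfolding poly_forms_def by blast
  obtain b where b: "b \<in> polys r" "\<forall>y\<in>T. q y vs = b y" using pq(2) unfolding poly_forms_def by blast
  have cont: "continuous_on UNIV (\<lambda>y. a y - b y)"
    using a b by (intro continuous_on_diff continuous_on_polys)
  let ?U = "interior T \<inter> {y. a y - b y \<noteq> 0}"
  have "open ?U"
    using cont by (intro open_Int open_interior open_Collect_neq continuous_on_const)
  moreover have "negligible ?U"
  proof (rule negligible_subset)
    show "negligible Z" using Z(1) by (simp add: negligible_iff_null_sets)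
    show "?U \<subseteq> Z"
    proof
      fix y assume y: "y \<in> ?U"
      then have "y \<in> T" using interior_subset by blast
      then have "p y vs \<noteq> q y vs" using y a b by auto
      then have "p y \<noteq> q y" by auto
      then show "y \<in> Z" using Z(2) \<open>y \<in> T\<close> by blast
    qed
  qed
  ultimately have "?U = {}" using open_not_negligible by blast
  then have "a y - b y = 0" if "y \<in> interior T" for y using that by blast
  then have "a y - b y = 0" if "y \<in> closure (interior T)" for y
    using that by (intro continuous_constant_on_closure[of "interior T" "\<lambda>y. a y - b y" 0 y])
      (auto intro: continuous_on_subset[OF cont])
  then have "p y vs = q y vs" if "y \<in> T" for y
    using that a b mesh_interior(2)[OF T] by simp
  moreover have "p y = 0" "q y = 0" if "y \<notin> T" using pq that by (auto simp: poly_forms_def)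
  ultimately show "p y vs = q y vs" by (cases "y \<in> T") simp_all
qed

end

context numbered_mesh
begin

text \<open>The defining condition of the mesh space, stated for families of forms and without the
  upper bound on the dimension of the face, so that simplices and lower faces are treated
  alike.\<close>

definition compatible :: "nat \<Rightarrow> nat \<Rightarrow> ('a set \<Rightarrow> 'a form) \<Rightarrow> bool" where
  "compatible d k p \<longleftrightarrow> (\<forall>T\<in>\<T>. p T \<in> poly_minus_forms (Suc d) k T) \<and>
     (\<forall>f\<in>mesh_faces \<T>. int k \<le> aff_dim f \<longrightarrow>
        (\<forall>T\<in>\<T>. \<forall>T'\<in>\<T>. f \<subseteq> T \<and> f \<subseteq> T' \<longrightarrow> trace_form f (p T) = trace_form f (p T')))"

lemma compatibleD:
  assumes "compatible d k p" "T \<in> \<T>"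
  shows "p T \<in> poly_minus_forms (Suc d) k T"
    and "f \<in> mesh_faces \<T> \<Longrightarrow> int k \<le> aff_dim f \<Longrightarrow> T' \<in> \<T> \<Longrightarrow> f \<subseteq> T \<Longrightarrow> f \<subseteq> T' \<Longrightarrow>
      trace_form f (p T) = trace_form f (p T')"
  using assms unfolding compatible_def by blast+

lemma poly_minus_forms_poly_forms:
  "T \<in> \<T> \<Longrightarrow> p \<in> poly_minus_forms (Suc d) k T \<Longrightarrow> p \<in> poly_forms (int (Suc d)) k T"
  using poly_minus_forms_subset_poly_forms[OF mesh_nondegenerate[OF mesh_mem_faces]] by blast

lemma compatible_glue_L2:
  assumes "compatible d k p"
  shows "glue p \<in> L2_forms k \<Omega>"
proof (rule glue_L2)
  show "p T \<in> poly_forms (int (Suc d)) k T" if "T \<in> \<T>" for T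
    using poly_minus_forms_poly_forms[OF that compatibleD(1)[OF assms that]] .
qed

lemma poly_minus_mesh_eq:
  "poly_minus_mesh \<Omega> \<T> (Suc d) k = {glue p |p. compatible d k p}"
proof (intro equalityI subsetI)
  fix W assume "W \<in> poly_minus_mesh \<Omega> \<T> (Suc d) k"
  then have "W \<in> L2_forms k \<Omega> \<and> (\<exists>p.
     (\<forall>T\<in>\<T>. p T \<in> poly_minus_forms (Suc d) k T \<and> restricts_to W T (p T)) \<and>
     (\<forall>f\<in>mesh_faces \<T>. int k \<le> aff_dim f \<and> aff_dim f \<le> int DIM('a) - 1 \<longrightarrow>
        (\<forall>T\<in>\<T>. \<forall>T'\<in>\<T>. f \<subseteq> T \<and> f \<subseteq> T' \<longrightarrow> trace_form f (p T) = trace_form f (p T'))))"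
    by (simp only: poly_minus_mesh_def mem_Collect_eq)
  then obtain p where W: "W \<in> L2_forms k \<Omega>"
    and p: "\<forall>T\<in>\<T>. p T \<in> poly_minus_forms (Suc d) k T \<and> restricts_to W T (p T)"
    and tr: "\<forall>f\<in>mesh_faces \<T>. int k \<le> aff_dim f \<and> aff_dim f \<le> int DIM('a) - 1 \<longrightarrow>
        (\<forall>T\<in>\<T>. \<forall>T'\<in>\<T>. f \<subseteq> T \<and> f \<subseteq> T' \<longrightarrow> trace_form f (p T) = trace_form f (p T'))"
    by (elim conjE exE)
  have trace_eq: "trace_form f (p T) = trace_form f (p T')"
    if f: "f \<in> mesh_faces \<T>" "int k \<le> aff_dim f" and T: "T \<in> \<T>" "T' \<in> \<T>" "f \<subseteq> T" "f \<subseteq> T'" for f T T'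
  proof (cases "aff_dim f \<le> int DIM('a) - 1")
    case False
    \<comment> \<open>A face of full dimension equals every simplex containing it, so the two
      simplices coincide.\<close>
    have "f = U" if U: "U \<in> \<T>" "f \<subseteq> U" for U
    proof (rule ccontr)
      assume "f \<noteq> U"
      then have "aff_dim f < aff_dim U"
        using mesh_face_of[OF f(1) mesh_mem_faces[OF U(1)] U(2)] mesh_convex[OF U(1)]
        by (intro face_of_aff_dim_lt)
      then show False using False aff_dim_simplex[OF mesh_simplex[OF U(1)]] by simp
    qed
    then show ?thesis using T by metis
  next
    case True
    then show ?thesis using tr f T by blast
  qed
  have "compatible d k p"
    unfolding compatible_def
  proof (intro conjI ballI impI)
    show "p T \<in> poly_minus_forms (Suc d) k T" if "T \<in> \<T>" for T using p that by blast
    show "trace_form f (p T) = trace_form f (p T')"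
      if "f \<in> mesh_faces \<T>" "int k \<le> aff_dim f" "T \<in> \<T>" "T' \<in> \<T>" "f \<subseteq> T \<and> f \<subseteq> T'" for f T T'
      using trace_eq[OF that(1-4)] that(5) by blast
  qed
  moreover have "W = glue p"
    using p L2_forms_restricts_to_outside[OF W] by (intro glue_eqI) simp_all
  ultimately show "W \<in> {glue p |p. compatible d k p}" by blast
next
  fix W assume "W \<in> {glue p |p. compatible d k p}"
  then obtain p where p: "W = glue p" "compatible d k p" by blast
  show "W \<in> poly_minus_mesh \<Omega> \<T> (Suc d) k"
    unfolding poly_minus_mesh_def p(1)
  proof (intro CollectI conjI exI[of _ p] ballI impI)
    show "glue p \<in> L2_forms k \<Omega>" by (rule compatible_glue_L2[OF p(2)])
    show "p T \<in> poly_minus_forms (Suc d) k T" if "T \<in> \<T>" for T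
      by (rule compatibleD(1)[OF p(2) that])
    show "restricts_to (glue p) T (p T)" if "T \<in> \<T>" for T by (rule restricts_to_glue[OF that])
    show "trace_form f (p T) = trace_form f (p T')"
      if "f \<in> mesh_faces \<T>" "int k \<le> aff_dim f \<and> aff_dim f \<le> int DIM('a) - 1" "T \<in> \<T>" "T' \<in> \<T>"
        "f \<subseteq> T \<and> f \<subseteq> T'" for f T T'
      using compatibleD(2)[OF p(2) that(3,1) _ that(4)] that(2,5) by blast
  qed
qed

lemma compatible_0: "compatible d k (\<lambda>T. 0)"
  unfolding compatible_def
  by (intro conjI ballI impI refl subspace_0[OF subspace_poly_minus_forms])

lemma compatible_add:
  assumes p: "compatible d k p" and q: "compatible d k q"
  shows "compatible d k (\<lambda>T. p T + q T)"
  unfolding compatible_def trace_form_linear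
proof (intro conjI ballI impI)
  show "p T + q T \<in> poly_minus_forms (Suc d) k T" if "T \<in> \<T>" for T
    using compatibleD(1)[OF p that] compatibleD(1)[OF q that]
    by (rule subspace_add[OF subspace_poly_minus_forms])
  show "trace_form f (p T) + trace_form f (q T) = trace_form f (p T') + trace_form f (q T')"
    if "f \<in> mesh_faces \<T>" "int k \<le> aff_dim f" "T \<in> \<T>" "T' \<in> \<T>" "f \<subseteq> T \<and> f \<subseteq> T'" for f T T'
    using compatibleD(2)[OF p that(3,1,2,4)] compatibleD(2)[OF q that(3,1,2,4)] that(5)
    by (simp only: simp_thms)
qed

lemma compatible_scale:
  assumes p: "compatible d k p"
  shows "compatible d k (\<lambda>T. c *\<^sub>R p T)"
  unfolding compatible_def trace_form_linear
proof (intro conjI ballI impI)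
  show "c *\<^sub>R p T \<in> poly_minus_forms (Suc d) k T" if "T \<in> \<T>" for T
    using compatibleD(1)[OF p that] by (rule subspace_scale[OF subspace_poly_minus_forms])
  show "c *\<^sub>R trace_form f (p T) = c *\<^sub>R trace_form f (p T')"
    if "f \<in> mesh_faces \<T>" "int k \<le> aff_dim f" "T \<in> \<T>" "T' \<in> \<T>" "f \<subseteq> T \<and> f \<subseteq> T'" for f T T'
    using compatibleD(2)[OF p that(3,1,2,4)] that(5) by (simp only: simp_thms)
qed

lemma subspace_poly_minus_mesh: "subspace (poly_minus_mesh \<Omega> \<T> (Suc d) k)"
  unfolding poly_minus_mesh_eq subspace_def
proof (intro conjI ballI allI)
  have "glue (\<lambda>T. 0) = 0" by (rule glue_0) (rule refl)
  then show "0 \<in> {glue p |p. compatible d k p}" using compatible_0[of d k] by (intro CollectI) metis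
next
  fix u w assume "u \<in> {glue p |p. compatible d k p}" "w \<in> {glue p |p. compatible d k p}"
  then show "u + w \<in> {glue p |p. compatible d k p}" using compatible_add glue_add by blast
next
  fix c u assume "u \<in> {glue p |p. compatible d k p}"
  then show "c *\<^sub>R u \<in> {glue p |p. compatible d k p}" using compatible_scale glue_scale by blast
qed

text \<open>Faces of lower dimension are null sets, so a class has no values there; the trace is
  read off from the polynomial representative on some simplex containing the face. Compatibility
  makes it independent of the simplex.\<close>

definition mesh_trace :: "nat \<Rightarrow> nat \<Rightarrow> 'a set \<Rightarrow> 'a ae_form \<Rightarrow> 'a form" where
  "mesh_trace d k f W = (let T = (SOME T. T \<in> \<T> \<and> f \<subseteq> T) in
     trace_form f (THE q. q \<in> poly_minus_forms (Suc d) k T \<and> restricts_to W T q))"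

lemma mesh_face_subset: "f \<in> mesh_faces \<T> \<Longrightarrow> \<exists>T\<in>\<T>. f \<subseteq> T"
  by (auto simp: mesh_faces_def simplex_faces_def dest: face_of_imp_subset)

lemma mesh_trace_glue:
  assumes p: "compatible d k p" and f: "f \<in> mesh_faces \<T>" "int k \<le> aff_dim f"
    and T: "T \<in> \<T>" "f \<subseteq> T"
  shows "mesh_trace d k f (glue p) = trace_form f (p T)"
proof -
  define T' where "T' = (SOME T. T \<in> \<T> \<and> f \<subseteq> T)"
  have T': "T' \<in> \<T>" "f \<subseteq> T'"
    unfolding T'_def using someI[of "\<lambda>T. T \<in> \<T> \<and> f \<subseteq> T", OF conjI[OF T]] by auto
  have "(THE q. q \<in> poly_minus_forms (Suc d) k T' \<and> restricts_to (glue p) T' q) = p T'"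
  proof (rule the_equality)
    show "p T' \<in> poly_minus_forms (Suc d) k T' \<and> restricts_to (glue p) T' (p T')"
      using compatibleD(1)[OF p T'(1)] restricts_to_glue[OF T'(1)] by blast
    fix q assume q: "q \<in> poly_minus_forms (Suc d) k T' \<and> restricts_to (glue p) T' q"
    show "q = p T'"
      by (rule restricts_to_unique[OF T'(1)])
        (use q compatibleD(1)[OF p T'(1)] poly_minus_forms_poly_forms[OF T'(1)]
          restricts_to_glue[OF T'(1)] in blast)+
  qed
  then show ?thesis
    using compatibleD(2)[OF p T'(1) f T(1) T'(2) T(2)]
    by (simp only: mesh_trace_def Let_def flip: T'_def)
qed

definition face_family :: "nat \<Rightarrow> 'a set \<Rightarrow> 'a form \<Rightarrow> 'a set \<Rightarrow> 'a form" where
  "face_family d f \<mu> T = (if f \<subseteq> T then face_ext x N (Suc d) f T \<mu> else 0)"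

lemma face_family_poly_minus:
  assumes "f \<in> mesh_faces \<T>" "\<mu> \<in> poly_minus_forms (Suc d) k f" "T \<in> \<T>"
  shows "face_family d f \<mu> T \<in> poly_minus_forms (Suc d) k T"
proof (cases "f \<subseteq> T")
  case True
  have T: "T \<in> mesh_faces \<T>" using assms(3) by (rule mesh_mem_faces)
  show ?thesis
    unfolding face_family_def using True mesh_vertex_indices_mono[OF assms(1) T]
    by (simp only: if_True)
      (intro face_ext_poly_minus mesh_nondegenerate assms(1,2) T, simp)
qed (simp only: face_family_def if_False subspace_0[OF subspace_poly_minus_forms])

text \<open>The right-hand side does not involve \<open>T\<close>: this is the compatibility of the
  extended family, and at the same time the triangular structure of the traces.\<close>

lemma trace_form_face_family:
  assumes f: "f \<in> mesh_faces \<T>" and \<mu>: "\<mu> \<in> poly_minus_forms0 (Suc d) k f"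
    and g: "g \<in> mesh_faces \<T>" and T: "T \<in> \<T>" "g \<subseteq> T"
  shows "trace_form g (face_family d f \<mu> T) = (if f \<subseteq> g then face_ext x N (Suc d) f g \<mu> else 0)"
proof -
  have Tm: "T \<in> mesh_faces \<T>" using T(1) by (rule mesh_mem_faces)
  have gT: "vertex_indices x N g \<subseteq> vertex_indices x N T"
    using T(2) mesh_vertex_indices_mono[OF g Tm] by simp
  consider "f \<subseteq> g" | "\<not> f \<subseteq> g" "f \<subseteq> T" | "\<not> f \<subseteq> T" "\<not> f \<subseteq> g" using T(2) by blast
  then show ?thesis
  proof cases
    case 1
    then have "f \<subseteq> T" "vertex_indices x N f \<subseteq> vertex_indices x N g"
      using T(2) mesh_vertex_indices_mono[OF f g] by auto
    then show ?thesis
      using 1 trace_form_face_ext[OF mesh_nondegenerate[OF g] mesh_nondegenerate[OF Tm] gT]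
      by (simp only: face_family_def if_True)
  next
    case 2
    have "trace_form g (face_ext x N (Suc d) f T \<mu>) = 0"
    proof (rule trace_form_face_ext_eq_0[OF mesh_nondegenerate[OF g] mesh_nondegenerate[OF Tm] gT
          mesh_nondegenerate[OF f]])
      show "trace_form c \<mu> = 0" if "c \<in> simplex_faces f" "c \<noteq> f" for c
        using that \<mu> unfolding poly_minus_forms0_def by blast
    qed (use 2 mesh_vertex_indices_mono[OF f g] mesh_vertex_indices_mono[OF f Tm] in simp_all)
    then show ?thesis using 2 by (simp only: face_family_def if_True if_False)
  next
    case 3
    then show ?thesis by (simp only: face_family_def if_False trace_form_linear)
  qed
qed

lemma poly_minus_forms0_subset: "\<mu> \<in> poly_minus_forms0 r k f \<Longrightarrow> \<mu> \<in> poly_minus_forms r k f"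
  by (simp add: poly_minus_forms0_def)

lemma compatible_face_family:
  assumes "f \<in> mesh_faces \<T>" "\<mu> \<in> poly_minus_forms0 (Suc d) k f"
  shows "compatible d k (face_family d f \<mu>)"
  unfolding compatible_def
  using face_family_poly_minus[OF assms(1) poly_minus_forms0_subset[OF assms(2)]]
    trace_form_face_family[OF assms] by simp

text \<open>Resolves the description operator in \<open>global_ext\<close>: square integrable forms
  are 0 off the domain, so their restrictions to the simplices determine them.\<close>

lemma global_ext_eq:
  assumes f: "f \<in> mesh_faces \<T>" and \<mu>: "\<mu> \<in> poly_minus_forms0 (Suc d) k f"
  shows "global_ext \<Omega> \<T> x N (Suc d) k f \<mu> = glue (face_family d f \<mu>)"
proof -
  have ext: "(if f \<subseteq> T then bary_ext x N (Suc d) k f T \<mu> else 0) = face_family d f \<mu> T" if T: "T \<in> \<T>" for T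
  proof (cases "f \<subseteq> T")
    case True
    have Tm: "T \<in> mesh_faces \<T>" using T by (rule mesh_mem_faces)
    have sub: "vertex_indices x N f \<subseteq> vertex_indices x N T"
      using True mesh_vertex_indices_mono[OF f Tm] by simp
    show ?thesis
      using True bary_ext_eq[OF mesh_nondegenerate[OF f] mesh_nondegenerate[OF Tm] sub, of d k]
        poly_minus_forms0_subset[OF \<mu>]
      by (simp only: face_family_def if_True)
  qed (simp only: face_family_def if_False)
  have L2: "glue (face_family d f \<mu>) \<in> L2_forms k \<Omega>"
    by (rule compatible_glue_L2[OF compatible_face_family[OF f \<mu>]])
  show ?thesis
    unfolding global_ext_def
  proof (rule the_equality)
    show "glue (face_family d f \<mu>) \<in> L2_forms k \<Omega> \<and> (\<forall>T\<in>\<T>.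
        restricts_to (glue (face_family d f \<mu>)) T (if f \<subseteq> T then bary_ext x N (Suc d) k f T \<mu> else 0))"
    proof (intro conjI ballI L2)
      fix T assume T: "T \<in> \<T>"
      show "restricts_to (glue (face_family d f \<mu>)) T (if f \<subseteq> T then bary_ext x N (Suc d) k f T \<mu> else 0)"
        unfolding ext[OF T] by (rule restricts_to_glue[OF T])
    qed
    fix W
    assume W: "W \<in> L2_forms k \<Omega> \<and>
      (\<forall>T\<in>\<T>. restricts_to W T (if f \<subseteq> T then bary_ext x N (Suc d) k f T \<mu> else 0))"
    then have "restricts_to W T (face_family d f \<mu> T)" if "T \<in> \<T>" for T
      using that ext[OF that] by metis
    then show "W = glue (face_family d f \<mu>)"
      using W L2_forms_restricts_to_outside by (intro glue_eqI) blast+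
  qed
qed

lemma linear_glue_face_family: "linear (\<lambda>\<mu>. glue (face_family d f \<mu>))"
proof (rule linearI)
  show "glue (face_family d f (\<mu> + \<nu>)) = glue (face_family d f \<mu>) + glue (face_family d f \<nu>)" for \<mu> \<nu>
    unfolding glue_add by (rule arg_cong[of _ _ glue]) (auto simp: face_family_def face_ext_linear)
  show "glue (face_family d f (c *\<^sub>R \<mu>)) = c *\<^sub>R glue (face_family d f \<mu>)" for c \<mu>
    unfolding glue_scale
  proof (rule arg_cong[of _ _ glue], rule HOL.ext)
    show "face_family d f (c *\<^sub>R \<mu>) T = c *\<^sub>R face_family d f \<mu> T" for T
      by (cases "f \<subseteq> T") (simp_all only: face_family_def face_ext_linear scaleR_zero_right if_True if_False)
  qed
qed

theorem poly_minus_mesh_direct_sum: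
  assumes k: "k \<le> DIM('a)"
  shows "is_internal_direct_sum (poly_minus_mesh \<Omega> \<T> (Suc d) k)
           {f \<in> mesh_faces \<T>. int k \<le> aff_dim f}
           (\<lambda>f. global_ext \<Omega> \<T> x N (Suc d) k f ` poly_minus_forms0 (Suc d) k f)"
proof -
  let ?I = "{f \<in> mesh_faces \<T>. int k \<le> aff_dim f}"
  let ?W = "\<lambda>f. global_ext \<Omega> \<T> x N (Suc d) k f ` poly_minus_forms0 (Suc d) k f"
  have W: "?W f = (\<lambda>\<mu>. glue (face_family d f \<mu>)) ` poly_minus_forms0 (Suc d) k f" if "f \<in> ?I" for f
    using global_ext_eq that by (intro image_cong) auto
  have trace: "mesh_trace d k g (glue (face_family d f \<mu>)) =
      (if f \<subseteq> g then face_ext x N (Suc d) f g \<mu> else 0)"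
    if "f \<in> ?I" "g \<in> ?I" "\<mu> \<in> poly_minus_forms0 (Suc d) k f" for f g \<mu>
  proof -
    have f: "f \<in> mesh_faces \<T>" and g: "g \<in> mesh_faces \<T>" "int k \<le> aff_dim g" using that by auto
    obtain T where T: "T \<in> \<T>" "g \<subseteq> T" using mesh_face_subset[OF g(1)] by blast
    show ?thesis
      unfolding mesh_trace_glue[OF compatible_face_family[OF f that(3)] g T]
      by (rule trace_form_face_family[OF f that(3) g(1) T])
  qed
  have trace_self: "mesh_trace d k f (glue (face_family d f \<mu>)) = \<mu>"
    if "f \<in> ?I" "\<mu> \<in> poly_minus_forms0 (Suc d) k f" for f \<mu>
    using trace[OF that(1,1,2)] face_ext_self[OF mesh_nondegenerate poly_minus_forms0_subset[OF that(2)]]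
      that(1) by simp
  show ?thesis
  \<comment> \<open>Faces are sets, so the order in the abstract criterion is inclusion.\<close>
  proof (rule internal_direct_sum_of_traces[where tr = "mesh_trace d k"])
    show "finite ?I" using finite_mesh_faces by simp
    show "subspace (poly_minus_mesh \<Omega> \<T> (Suc d) k)" by (rule subspace_poly_minus_mesh)
  next
    fix f assume f: "f \<in> ?I"
    show "subspace (?W f)"
      unfolding W[OF f]
      by (rule linear_subspace_image[OF linear_glue_face_family subspace_poly_minus_forms0])
    show "?W f \<subseteq> poly_minus_mesh \<Omega> \<T> (Suc d) k"
      unfolding W[OF f] poly_minus_mesh_eq using compatible_face_family f by blast
    obtain T where T: "T \<in> \<T>" "f \<subseteq> T" using mesh_face_subset f by blast
    have fm: "f \<in> mesh_faces \<T>" "int k \<le> aff_dim f" using f by auto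
    note tr = mesh_trace_glue[OF _ fm T]
    show "linear_on_subspace (poly_minus_mesh \<Omega> \<T> (Suc d) k) (mesh_trace d k f)"
      unfolding linear_on_subspace_def poly_minus_mesh_eq
    proof (intro conjI ballI allI)
      fix u w assume "u \<in> {glue p |p. compatible d k p}" "w \<in> {glue p |p. compatible d k p}"
      then obtain p q where pq: "u = glue p" "w = glue q" "compatible d k p" "compatible d k q" by blast
      show "mesh_trace d k f (u + w) = mesh_trace d k f u + mesh_trace d k f w"
        unfolding pq(1,2) glue_add tr[OF pq(3)] tr[OF pq(4)] tr[OF compatible_add[OF pq(3,4)]]
        by (rule trace_form_linear)
    next
      fix c u assume "u \<in> {glue p |p. compatible d k p}"
      then obtain p where p: "u = glue p" "compatible d k p" by blast
      show "mesh_trace d k f (c *\<^sub>R u) = c *\<^sub>R mesh_trace d k f u"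
        unfolding p(1) glue_scale tr[OF p(2)] tr[OF compatible_scale[OF p(2)]]
        by (rule trace_form_linear)
    qed
  next
    fix f g w assume fg: "f \<in> ?I" "g \<in> ?I" "w \<in> ?W f" "\<not> f \<subseteq> g"
    then obtain \<mu> where \<mu>: "w = glue (face_family d f \<mu>)" "\<mu> \<in> poly_minus_forms0 (Suc d) k f"
      unfolding W[OF fg(1)] by blast
    show "mesh_trace d k g w = 0"
      unfolding \<mu>(1) trace[OF fg(1,2) \<mu>(2)] using fg(4) by (simp only: if_False)
  next
    fix f w assume f: "f \<in> ?I" "w \<in> ?W f" "mesh_trace d k f w = 0"
    then obtain \<mu> where \<mu>: "w = glue (face_family d f \<mu>)" "\<mu> \<in> poly_minus_forms0 (Suc d) k f"
      unfolding W[OF f(1)] by blast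
    then have "\<mu> = 0" using trace_self[OF f(1)] f(3) by simp
    then show "w = 0" unfolding \<mu>(1) using linear_0[OF linear_glue_face_family] by (simp only:)
  next
    fix f v assume f: "f \<in> ?I" and v: "v \<in> poly_minus_mesh \<Omega> \<T> (Suc d) k"
      and tr0: "\<And>e. e \<in> ?I \<Longrightarrow> e \<subset> f \<Longrightarrow> mesh_trace d k e v = 0"
    obtain p where p: "v = glue p" "compatible d k p" using v unfolding poly_minus_mesh_eq by blast
    have fm: "f \<in> mesh_faces \<T>" "int k \<le> aff_dim f" using f by auto
    obtain T where T: "T \<in> \<T>" "f \<subseteq> T" using mesh_face_subset f by blast
    have Tm: "T \<in> mesh_faces \<T>" using T(1) by (rule mesh_mem_faces)
    \<comment> \<open>The candidate for the component at \<open>f\<close> is the trace of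
      \<open>v\<close> itself; it remains to see that its boundary traces vanish.\<close>
    define \<mu> where "\<mu> = trace_form f (p T)"
    have \<mu>: "\<mu> \<in> poly_minus_forms (Suc d) k f"
      unfolding \<mu>_def using T(2) mesh_vertex_indices_mono[OF fm(1) Tm]
      by (intro trace_form_poly_minus[OF mesh_nondegenerate[OF fm(1)] mesh_nondegenerate[OF Tm]]
          compatibleD(1)[OF p(2) T(1)]) simp
    have "trace_form e \<mu> = 0" if e: "e \<in> simplex_faces f" "e \<noteq> f" for e
    proof -
      have em: "e \<in> mesh_faces \<T>" using mesh_faces_subface[OF fm(1) e(1)] .
      have ef: "e \<subseteq> f" using e(1) by (auto simp: simplex_faces_def dest: face_of_imp_subset)
      show ?thesis
      \<comment> \<open>\<open>tr0\<close> covers only faces in the index set. On a face of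
        dimension below \<open>k\<close> the space of forms is zero.\<close>
      proof (cases "int k \<le> aff_dim e")
        case True
        have "mesh_trace d k e v = 0" using True em e(2) ef by (intro tr0) auto
        then have "trace_form e (p T) = 0"
          using mesh_trace_glue[OF p(2) em True T(1)] ef T(2) p(1) by simp
        then show ?thesis unfolding \<mu>_def by (simp only: trace_form_trace_form[OF ef])
      next
        case False
        have "trace_form e \<mu> \<in> poly_minus_forms (Suc d) k e"
          using ef mesh_vertex_indices_mono[OF em fm(1)]
          by (intro trace_form_poly_minus[OF mesh_nondegenerate[OF em] mesh_nondegenerate[OF fm(1)]] \<mu>) simp
        then show ?thesis
          using False mesh_card_vertex_indices[OF em]
          by (intro poly_minus_forms_low_dim[OF mesh_nondegenerate[OF em], of k _ d]) auto
      qed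
    qed
    then have \<mu>0: "\<mu> \<in> poly_minus_forms0 (Suc d) k f" using \<mu> by (simp add: poly_minus_forms0_def)
    then have "glue (face_family d f \<mu>) \<in> ?W f" unfolding W[OF f] by blast
    moreover have "mesh_trace d k f (glue (face_family d f \<mu>)) = mesh_trace d k f v"
      using trace_self[OF f \<mu>0] mesh_trace_glue[OF p(2) fm T] by (simp only: p(1) \<mu>_def)
    ultimately show "\<exists>w\<in>?W f. mesh_trace d k f w = mesh_trace d k f v" by blast
  next
    fix v assume v: "v \<in> poly_minus_mesh \<Omega> \<T> (Suc d) k" and tr0: "\<And>f. f \<in> ?I \<Longrightarrow> mesh_trace d k f v = 0"
    obtain p where p: "v = glue p" "compatible d k p" using v unfolding poly_minus_mesh_eq by blast
    \<comment> \<open>As \<open>k\<close> is at most the dimension of the space, \<open>T\<close>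
      belongs to the index set, and the trace on \<open>T\<close> is \<open>p T\<close>
      itself.\<close>
    have "p T = 0" if T: "T \<in> \<T>" for T
    proof -
      have Tm: "T \<in> mesh_faces \<T>" and dim: "int k \<le> aff_dim T"
        using mesh_mem_faces[OF T] aff_dim_simplex[OF mesh_simplex[OF T]] k by auto
      have "trace_form T (p T) = 0"
        using tr0[of T] Tm dim mesh_trace_glue[OF p(2) Tm dim T subset_refl] p(1) by simp
      then show ?thesis
        using trace_form_self[OF mesh_nondegenerate[OF Tm] compatibleD(1)[OF p(2) T]] by (simp only:)
    qed
    then show "v = 0" unfolding p(1) by (rule glue_0)
  qed
qed

end

theorem theorem7p3:
  fixes \<Omega> :: "(real ^ 'n) set" and \<T> :: "(real ^ 'n) set set"
    and x :: "nat \<Rightarrow> real ^ 'n" and N r k :: nat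
  assumes "bounded_polyhedral_domain \<Omega>"
    and "simplicial_triangulation \<T> \<Omega>"
    and "vertex_numbering \<T> x N"
    and "1 \<le> r" and "k \<le> CARD('n)"
  shows "is_internal_direct_sum (poly_minus_mesh \<Omega> \<T> r k)
           {f \<in> mesh_faces \<T>. int k \<le> aff_dim f}
           (\<lambda>f. global_ext \<Omega> \<T> x N r k f ` poly_minus_forms0 r k f)"
proof -
  interpret numbered_mesh \<Omega> \<T> x N
    using assms(1-3) by unfold_locales
  show ?thesis
    using poly_minus_mesh_direct_sum[of k "r - 1"] assms(4,5) by simp
qed



end
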